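(* Let $\Omega\subset\mathbb{R}^2$ be either (a) an open regular hexagon, with the family of uniform partitions into equilateral triangles described in the context, or (b) $\Omega=(0,1)^2$, with the family of uniform partitions into right triangles described in the context. Let $a>0$ be a constant function and let $\vec\beta\in\mathbb{R}^2$ be a constant vector field. For each mesh, with $n=n(h)$ internal nodes, let $A_n(a,\vec\beta)$ be the convection-diffusion finite element matrix and $P_n(a)$ the preconditioner defined in the context. Then $P_n(a)^{-1}A_n(a,\vec\beta)$ can be diagonalized (over $\mathbb{C}$) as $$P_n(a)^{-1}A_n(a,\vec\beta)=V_nD_nV_n^{-1},$$ with $D_n$ diagonal, where the matrix of eigenvectors $V_n$ can be chosen such that $K_2(V_n)\sim h^{-1}$, i.e. such that there are constants $0<c\le C<\infty$, independent of $n$ and $h$, with $c\,h^{-1}\le K_2(V_n)\le C\,h^{-1}$ for every mesh of the family.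
   Context: Meshes. (a) $\Omega$ is an open regular hexagon of side length $L$; for each integer $m\ge1$, $\mathcal{T}_h$ is the partition of $\overline\Omega$ into congruent equilateral triangles of side $h=L/m$ obtained by dividing each side of the hexagon into $m$ equal parts and drawing all the lines through the division points parallel to the sides. (b) $\Omega=(0,1)^2$; for each integer $m\ge2$, with $h=1/m$, $\mathcal{T}_h$ is obtained by dividing $[0,1]^2$ into $m^2$ squares of side $h$ and splitting each of them into two right triangles by a diagonal, all diagonals being parallel (Friedrichs-Keller mesh). An internal node is a vertex of the mesh lying in $\Omega$; $n=n(h)$ is the number of internal nodes. Finite elements: $V_h$ is the space of continuous functions on $\overline\Omega$ that are affine on each triangle of $\mathcal{T}_h$ and vanish on $\partial\Omega$. For each internal node $i$, $\varphi_i\in V_h$ is the function equal to $1$ at node $i$ and $0$ at all other nodes. Matrices: for $i,j=1,\dots,n$, $$(\Theta_n(a))_{i,j}=\int_\Omega a\,\nabla\varphi_j\cdot\nabla\varphi_i,\qquad (\Psi_n(\vec\beta))_{i,j}=-\int_\Omega(\vec\beta\cdot\nabla\varphi_i)\,\varphi_j,\qquad A_n(a,\vec\beta)=\Theta_n(a)+\Psi_n(\vec\beta).$$ Let $\mathrm{diag}(X)$ be the diagonal matrix with the same main diagonal as $X$. Define $$P_n(a)=S_n^{1/2}(a)\,\Theta_n(1)\,S_n^{1/2}(a),\qquad S_n(a)=\mathrm{diag}(\Theta_n(a))\,\mathrm{diag}(\Theta_n(1))^{-1}.$$ $K_2(X)=\|X\|_2\,\|X^{-1}\|_2$ is the spectral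 condition number of an invertible matrix $X$. (The matrix $V_n$ is unrelated to the space $V_h$.) *)

theory Defs
  imports "Jordan_Normal_Form.Gauss_Jordan_Elimination" "HOL-Analysis.Analysis"
begin

(* Both Matrix and the Analysis library define notations \<bullet> and $, and constants vec and mat.
   Below, inner and real^2 refer to the Analysis library; matrices are those of
   Jordan_Normal_Form.Matrix, whose dimension may vary with the mesh. *)

type_synonym point = "real^2"

(* A mesh is the set of its closed triangles. *)
type_synonym mesh = "point set set"

section \<open>The hexagon\<close>

(* The regular hexagon of side length L (its circumradius is also L) with centre z, in any position:
   theta is the angle under which a vertex is seen from the centre. *)
definition hex_vertex :: "point \<Rightarrow> real \<Rightarrow> real \<Rightarrow> nat \<Rightarrow> point" where
  "hex_vertex z \<theta> L k =
     z + L *\<^sub>R vector [cos (\<theta> + real k * pi / 3), sin (\<theta> + real k * pi / 3)]"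

definition hexagon :: "point \<Rightarrow> real \<Rightarrow> real \<Rightarrow> point set" where
  "hexagon z \<theta> L = interior (convex hull (hex_vertex z \<theta> L ` {..<6}))"

definition hex_side :: "point \<Rightarrow> real \<Rightarrow> real \<Rightarrow> nat \<Rightarrow> point" where
  "hex_side z \<theta> L k = hex_vertex z \<theta> L (Suc k) - hex_vertex z \<theta> L k"

definition hex_division_points :: "point \<Rightarrow> real \<Rightarrow> real \<Rightarrow> nat \<Rightarrow> point set" where
  "hex_division_points z \<theta> L m =
     {hex_vertex z \<theta> L k + (real j / real m) *\<^sub>R hex_side z \<theta> L k | k j. k < 6 \<and> j \<le> m}"

(* The lines through the division points parallel to the sides. The end points of the sides count
   as division points, so that for m = 1 the three long diagonals are drawn. *)
definition hex_lines :: "point \<Rightarrow> real \<Rightarrow> real \<Rightarrow> nat \<Rightarrow> point set set" where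
  "hex_lines z \<theta> L m =
     {{d + t *\<^sub>R hex_side z \<theta> L l | t. True} | d l. d \<in> hex_division_points z \<theta> L m \<and> l < 6}"

(* The closed pieces into which these lines cut the hexagon. *)
definition hex_mesh :: "point \<Rightarrow> real \<Rightarrow> real \<Rightarrow> nat \<Rightarrow> mesh" where
  "hex_mesh z \<theta> L m = closure ` components (hexagon z \<theta> L - \<Union> (hex_lines z \<theta> L m))"

(* A family of meshes is a set of pairs (h, mesh of size h). *)
definition hex_family :: "point \<Rightarrow> real \<Rightarrow> real \<Rightarrow> (real \<times> mesh) set" where
  "hex_family z \<theta> L = {(L / real m, hex_mesh z \<theta> L m) | m. 1 \<le> m}"

section \<open>The unit square\<close>

definition unit_square :: "point set" where
  "unit_square = box (vector [0, 0]) (vector [1, 1])"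

(* Lower left corner of the square is (i h, j h). The flag selects which of the two diagonal
   directions is used, the same one in all squares of the mesh. *)
definition square_halves :: "bool \<Rightarrow> real \<Rightarrow> nat \<Rightarrow> nat \<Rightarrow> point set set" where
  "square_halves up h i j =
     (let p00 = vector [real i * h, real j * h];
          p10 = vector [real (i + 1) * h, real j * h];
          p01 = vector [real i * h, real (j + 1) * h];
          p11 = vector [real (i + 1) * h, real (j + 1) * h]
      in if up then {convex hull {p00, p10, p11}, convex hull {p00, p01, p11}}
         else {convex hull {p00, p10, p01}, convex hull {p10, p01, p11}})"

definition fk_mesh :: "bool \<Rightarrow> nat \<Rightarrow> mesh" where
  "fk_mesh up m = (\<Union>i<m. \<Union>j<m. square_halves up (1 / real m) i j)"

definition fk_family :: "(real \<times> mesh) set" where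
  "fk_family = {(1 / real m, fk_mesh up m) | m up. 2 \<le> m}"

section \<open>Finite elements\<close>

definition internal_nodes :: "point set \<Rightarrow> mesh \<Rightarrow> point set" where
  "internal_nodes \<Omega> T = {v \<in> \<Omega>. \<exists>K\<in>T. v extreme_point_of K}"

(* Functions on the closure of Omega vanishing on the boundary are represented by their extension
   by zero to the whole plane, which makes them determined by their values on Omega. *)
definition fe_space :: "point set \<Rightarrow> mesh \<Rightarrow> (point \<Rightarrow> real) set" where
  "fe_space \<Omega> T =
     {u. continuous_on (closure \<Omega>) u \<and>
         (\<forall>K\<in>T. \<exists>g b. \<forall>x\<in>K. u x = inner g x + b) \<and>
         (\<forall>x. x \<notin> \<Omega> \<longrightarrow> u x = 0)}"

definition hat :: "point set \<Rightarrow> mesh \<Rightarrow> point \<Rightarrow> (point \<Rightarrow> real)" where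
  "hat \<Omega> T p =
     (THE u. u \<in> fe_space \<Omega> T \<and> u p = 1 \<and> (\<forall>q\<in>internal_nodes \<Omega> T. q \<noteq> p \<longrightarrow> u q = 0))"

(* Unspecified where f is not differentiable; for finite element functions this is
   contained in the union of the triangle edges, a null set. *)
definition grad :: "(point \<Rightarrow> real) \<Rightarrow> point \<Rightarrow> point" where
  "grad f x = (THE D. GDERIV f x :> D)"

(* The internal nodes are numbered p 0, ..., p (n - 1), where n is their number. *)
definition Theta :: "point set \<Rightarrow> mesh \<Rightarrow> (nat \<Rightarrow> point) \<Rightarrow> (point \<Rightarrow> real) \<Rightarrow> real Matrix.mat" where
  "Theta \<Omega> T p a = (let n = card (internal_nodes \<Omega> T) in
     Matrix.mat n n (\<lambda>(i, j).
       set_lebesgue_integral lebesgue \<Omega>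
         (\<lambda>x. a x * inner (grad (hat \<Omega> T (p j)) x) (grad (hat \<Omega> T (p i)) x))))"

definition Psi :: "point set \<Rightarrow> mesh \<Rightarrow> (nat \<Rightarrow> point) \<Rightarrow> (point \<Rightarrow> point) \<Rightarrow> real Matrix.mat" where
  "Psi \<Omega> T p \<beta> = (let n = card (internal_nodes \<Omega> T) in
     Matrix.mat n n (\<lambda>(i, j).
       - set_lebesgue_integral lebesgue \<Omega>
         (\<lambda>x. inner (\<beta> x) (grad (hat \<Omega> T (p i)) x) * hat \<Omega> T (p j) x)))"

definition conv_diff_mat ::
    "point set \<Rightarrow> mesh \<Rightarrow> (nat \<Rightarrow> point) \<Rightarrow> (point \<Rightarrow> real) \<Rightarrow> (point \<Rightarrow> point) \<Rightarrow> real Matrix.mat" where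
  "conv_diff_mat \<Omega> T p a \<beta> = Theta \<Omega> T p a + Psi \<Omega> T p \<beta>"

section \<open>Matrices\<close>

(* Meaningful only for invertible matrices, as mat_inverse yields None otherwise. *)
definition mat_inv :: "'a::field Matrix.mat \<Rightarrow> 'a Matrix.mat" where
  "mat_inv X = the (mat_inverse X)"

definition diag_part :: "'a::zero Matrix.mat \<Rightarrow> 'a Matrix.mat" where
  "diag_part X = mat_diag (dim_row X) (\<lambda>i. X $$ (i, i))"

(* The square root of a diagonal matrix with nonnegative entries. *)
definition diag_sqrt :: "real Matrix.mat \<Rightarrow> real Matrix.mat" where
  "diag_sqrt X = mat_diag (dim_row X) (\<lambda>i. sqrt (X $$ (i, i)))"

definition S_mat :: "point set \<Rightarrow> mesh \<Rightarrow> (nat \<Rightarrow> point) \<Rightarrow> (point \<Rightarrow> real) \<Rightarrow> real Matrix.mat" where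
  "S_mat \<Omega> T p a = diag_part (Theta \<Omega> T p a) * mat_inv (diag_part (Theta \<Omega> T p (\<lambda>_. 1)))"

definition precond :: "point set \<Rightarrow> mesh \<Rightarrow> (nat \<Rightarrow> point) \<Rightarrow> (point \<Rightarrow> real) \<Rightarrow> real Matrix.mat" where
  "precond \<Omega> T p a =
     diag_sqrt (S_mat \<Omega> T p a) * Theta \<Omega> T p (\<lambda>_. 1) * diag_sqrt (S_mat \<Omega> T p a)"

definition vec_norm2 :: "complex Matrix.vec \<Rightarrow> real" where
  "vec_norm2 v = L2_set (\<lambda>i. cmod (vec_index v i)) {..<dim_vec v}"

definition spectral_norm :: "complex Matrix.mat \<Rightarrow> real" where
  "spectral_norm X = (SUP v\<in>{v \<in> carrier_vec (dim_col X). vec_norm2 v \<le> 1}. vec_norm2 (mult_mat_vec X v))"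

definition cond2 :: "complex Matrix.mat \<Rightarrow> real" where
  "cond2 X = spectral_norm X * spectral_norm (mat_inv X)"

end

(* With constant a, the preconditioner is P = a K, where K is the stiffness matrix for a = 1, and
   A = a K + W with W skew-symmetric. Diagonalizing the pencil (W, K) by a K-orthonormal basis,
   V^H K V = 1 and V^H W V diagonal, gives V^-1 P^-1 A V = 1 + V^H W V / a, and K_2(V) is the square
   root of K_2(K). So everything reduces to K_2(K) ~ h^-2.

   Both families of meshes are affine images of one and the same triangulation of the integer
   lattice. There the energy of a finite element function is comparable to the sum of its squared
   differences along edges: it is bounded by a multiple of the squared Euclidean norm of the nodal
   values, and below by h^2 times that norm (discrete Poincare inequality along lattice lines); a unit
   vector and a pyramid show that both bounds are attained up to constants. *)
theory Submission
  imports Defs "Jordan_Normal_Form.Spectral_Radius"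
begin

section \<open>Simultaneous diagonalization of a Hermitian and a skew-Hermitian form\<close>

text \<open>No eigenvalue of \<open>K\<close> is computed. For U = V^-1 = V^H K one has |U x|^2 =
  x^H K x, so two-sided bounds on this quadratic form bound both spectral norms from above, and one
  vector with large and one with small Rayleigh quotient bound them from below. Only ratios of these
  bounds enter, so the area of a mesh triangle cancels and is never evaluated. The matrix W is
  skew-symmetric for a constant field because the point reflection that swaps two nodes maps the
  lattice triangulation to itself; this replaces integration by parts. Eigenvalues of K^-1 W may be
  multiple, so the diagonalization deflates along K-orthogonal complements instead of collecting
  eigenvectors. The definitions are abstract: meshes are components of a complement, hat functions
  are unique elements of a space, gradients have no specified value on edges. Each is first
  identified with an explicit formula in lattice coordinates. Two integers then describe the size of
  a mesh: a bound \<open>N\<close> on the coordinates of internal nodes, and the radius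
  \<open>R\<close> of a square block of internal nodes. The estimates match because \<open>N\<close>
  and \<open>R\<close> are comparable.\<close>

definition adj :: "complex Matrix.mat \<Rightarrow> complex Matrix.mat" where
  "adj X = Matrix.mat (dim_col X) (dim_row X) (\<lambda>(i, j). cnj (X $$ (j, i)))"

definition sesq :: "complex Matrix.mat \<Rightarrow> complex Matrix.vec \<Rightarrow> complex Matrix.vec \<Rightarrow> complex" where
  "sesq A x y = (\<Sum>i<dim_row A. \<Sum>j<dim_col A. cnj (vec_index x i) * A $$ (i, j) * vec_index y j)"

lemma adj_carrier [simp]: "X \<in> carrier_mat n m \<Longrightarrow> adj X \<in> carrier_mat m n"
  by (auto simp: adj_def)

lemma adj_index [simp]: "i < dim_col X \<Longrightarrow> j < dim_row X \<Longrightarrow> adj X $$ (i, j) = cnj (X $$ (j, i))"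
  by (auto simp: adj_def)

lemma adj_dim [simp]: "dim_row (adj X) = dim_col X" "dim_col (adj X) = dim_row X"
  by (auto simp: adj_def)

text \<open>Reads a congruence entrywise as a form on columns, so that
  \<open>adj V * K * V = 1\<^sub>m n\<close> becomes orthonormality of the columns of
  \<open>V\<close>.\<close>

lemma adj_congruence_index:
  assumes X: "X \<in> carrier_mat n m" and A: "A \<in> carrier_mat n n" and Y: "Y \<in> carrier_mat n k"
    and i: "i < m" and j: "j < k"
  shows "(adj X * A * Y) $$ (i, j) = sesq A (col X i) (col Y j)"
proof -
  have "(adj X * A * Y) $$ (i, j) = (\<Sum>l<n. (\<Sum>r<n. cnj (X $$ (r, i)) * A $$ (r, l)) * Y $$ (l, j))"
    using assms by (simp add: scalar_prod_def atLeast0LessThan)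
  also have "\<dots> = (\<Sum>r<n. \<Sum>l<n. cnj (X $$ (r, i)) * A $$ (r, l) * Y $$ (l, j))"
    unfolding sum_distrib_right by (rule sum.swap)
  finally show ?thesis
    using assms by (simp add: sesq_def)
qed

lemma sesq_adj:
  assumes A: "A \<in> carrier_mat n n"
  shows "sesq (adj A) x y = cnj (sesq A y x)"
proof -
  have "sesq (adj A) x y = (\<Sum>i<n. \<Sum>j<n. cnj (vec_index x i) * cnj (A $$ (j, i)) * vec_index y j)"
    using A by (auto simp: sesq_def intro!: sum.cong)
  also have "\<dots> = (\<Sum>j<n. \<Sum>i<n. cnj (vec_index x i) * cnj (A $$ (j, i)) * vec_index y j)"
    by (rule sum.swap)
  also have "\<dots> = cnj (sesq A y x)"
    using A by (simp add: sesq_def mult_ac)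
  finally show ?thesis .
qed

lemma sesq_uminus: "sesq (- A) x y = - sesq A x y"
  by (auto simp: sesq_def simp flip: sum_negf intro!: sum.cong)

lemma sesq_mult_vec:
  assumes A: "A \<in> carrier_mat n n" and y: "y \<in> carrier_vec n"
  shows "sesq A x y = (\<Sum>i<n. cnj (vec_index x i) * vec_index (A *\<^sub>v y) i)"
  using assms by (auto simp: sesq_def scalar_prod_def sum_distrib_left mult_ac atLeast0LessThan intro!: sum.cong)

lemma sesq_congruence:
  assumes A: "A \<in> carrier_mat n n" and X: "X \<in> carrier_mat n m" 
    and x: "x \<in> carrier_vec m" and y: "y \<in> carrier_vec m"
  shows "sesq (adj X * A * X) x y = sesq A (X *\<^sub>v x) (X *\<^sub>v y)"
proof -
  have C: "adj X * A * X \<in> carrier_mat m m"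
    using A X by auto
  \<comment> \<open>Vectors become one-column matrices; both sides are then the single entry of the
    same product of five matrices, bracketed differently.\<close>
  let ?M = "\<lambda>z. Matrix.mat m 1 (\<lambda>(i,_). vec_index z i)"
  have M: "?M z \<in> carrier_mat m 1" for z :: "complex Matrix.vec" by simp
  have e: "adj (X * ?M x) = adj (?M x) * adj X"
    using X by (intro eq_matI) (auto simp: scalar_prod_def mult.commute)
  have "sesq (adj X * A * X) x y = (adj (?M x) * (adj X * A * X) * ?M y) $$ (0, 0)"
    using x y by (subst adj_congruence_index[OF M C M]) (auto intro!: arg_cong2[where f="sesq (adj X * A * X)"] eq_vecI)
  also have "adj (?M x) * (adj X * A * X) * ?M y = adj (X * ?M x) * A * (X * ?M y)"
  proof -
    have Q: "adj X \<in> carrier_mat m n" and P: "adj (?M x) \<in> carrier_mat 1 m"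
      using X by auto
    have "adj (?M x) * (adj X * A * X) = adj (?M x) * adj X * A * X"
      using assoc_mult_mat[OF P mult_carrier_mat[OF Q A] X] assoc_mult_mat[OF P Q A] by simp
    then show ?thesis
      unfolding e
      using assoc_mult_mat[OF mult_carrier_mat[OF mult_carrier_mat[OF P Q] A] X M] by simp
  qed
  also have "\<dots> $$ (0, 0) = sesq A (X *\<^sub>v x) (X *\<^sub>v y)"
    using x y X A by (subst adj_congruence_index[where n=n and m=1 and k=1])
       (auto intro!: arg_cong2[where f="sesq A"] eq_vecI simp: scalar_prod_def)
  finally show ?thesis .
qed

lemma nonsingular_imp_inverse:
  fixes A :: "'a :: field Matrix.mat"
  assumes A: "A \<in> carrier_mat n n"
    and inj: "\<And>x. x \<in> carrier_vec n \<Longrightarrow> A *\<^sub>v x = 0\<^sub>v n \<Longrightarrow> x = 0\<^sub>v n"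
  obtains B where "B \<in> carrier_mat n n" "A * B = 1\<^sub>m n" "B * A = 1\<^sub>m n"
proof -
  have "Determinant.det A \<noteq> 0"
    using det_0_iff_vec_prod_zero_field[OF A] inj by blast
  then obtain B where "B \<in> carrier_mat n n" "A * B = 1\<^sub>m n" "B * A = 1\<^sub>m n"
    using det_non_zero_imp_unit[OF A, of undefined] 
    by (auto simp: Units_def ring_mat_def)
  then show ?thesis ..
qed

text \<open>\<open>mat_inverse\<close> is an elimination algorithm with an optional result. A
  one-sided inverse over a field is two-sided and unique, which pins that result down.\<close>

lemma mat_inv_eq:
  assumes A: "A \<in> carrier_mat n n" and B: "B \<in> carrier_mat n n" and AB: "A * B = 1\<^sub>m n"
  shows "mat_inv A = B" "invertible_mat A"
proof -
  have BA: "B * A = 1\<^sub>m n"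
    using mat_mult_left_right_inverse[OF A B AB] .
  have "A \<in> Units (ring_mat TYPE('a) n ())"
    using A B AB BA by (auto simp: Units_def ring_mat_def)
  then obtain C where C: "mat_inverse A = Some C"
    using mat_inverse(1)[OF A, of "()"] by (cases "mat_inverse A") auto
  from mat_inverse(2)[OF A C] have "A * C = 1\<^sub>m n" "C * A = 1\<^sub>m n" "C \<in> carrier_mat n n"
    by auto
  then have "C = C * (A * B)" "C * A * B = B"
    using B unfolding AB by auto
  then have "C = B"
    using assoc_mult_mat[OF \<open>C \<in> carrier_mat n n\<close> A B] by simp
  then show "mat_inv A = B"
    using C by (simp add: mat_inv_def)
  show "invertible_mat A"
    using A B AB BA by (auto simp: invertible_mat_def inverts_mat_def)
qed

text \<open>An eigenvector of K^-1 N, which exists over the complex numbers in positive dimension;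
  multiplying by \<open>K\<close> removes the inverse.\<close>

lemma pencil_eigenvector:
  fixes K N :: "complex Matrix.mat"
  assumes K: "K \<in> carrier_mat n n" and N: "N \<in> carrier_mat n n" and n: "0 < n"
    and inj: "\<And>x. x \<in> carrier_vec n \<Longrightarrow> K *\<^sub>v x = 0\<^sub>v n \<Longrightarrow> x = 0\<^sub>v n"
  obtains v l where "v \<in> carrier_vec n" "v \<noteq> 0\<^sub>v n" "N *\<^sub>v v = l \<cdot>\<^sub>v (K *\<^sub>v v)"
proof -
  obtain B where B: "B \<in> carrier_mat n n" and KB: "K * B = 1\<^sub>m n"
    using nonsingular_imp_inverse[OF K inj] by metis
  have BN: "B * N \<in> carrier_mat n n"
    using B N by auto
  obtain l v where v: "v \<in> carrier_vec n" "v \<noteq> 0\<^sub>v n" and e: "(B * N) *\<^sub>v v = l \<cdot>\<^sub>v v"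
    using spectrum_non_empty[OF BN n] BN
    by (auto simp: spectrum_def eigenvalue_def eigenvector_def)
  have "N *\<^sub>v v = (K * B) *\<^sub>v (N *\<^sub>v v)"
    unfolding KB using N v by simp
  also have "\<dots> = K *\<^sub>v ((B * N) *\<^sub>v v)"
    using K B N v by (metis assoc_mult_mat_vec mult_mat_vec_carrier)
  also have "\<dots> = l \<cdot>\<^sub>v (K *\<^sub>v v)"
    unfolding e using mult_mat_vec[OF K v(1)] by simp
  finally show ?thesis
    using that v by blast
qed

text \<open>Completes \<open>u\<close> to a basis and orthogonalizes it with \<open>u\<close> kept
  in front; the other vectors are the columns of \<open>T\<close>. They are left unnormalized:
  orthogonality and nonzero self-products make \<open>T\<close> injective.\<close>

lemma orthogonal_complement_basis:
  fixes u :: "complex Matrix.vec"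
  assumes u: "u \<in> carrier_vec (Suc m)" "u \<noteq> 0\<^sub>v (Suc m)"
  obtains T where "T \<in> carrier_mat (Suc m) m"
    and "\<And>j. j < m \<Longrightarrow> (\<Sum>i<Suc m. cnj (T $$ (i, j)) * vec_index u i) = 0"
    and "\<And>x. x \<in> carrier_vec m \<Longrightarrow> T *\<^sub>v x = 0\<^sub>v (Suc m) \<Longrightarrow> x = 0\<^sub>v m"
proof -
  let ?n = "Suc m"
  interpret cof_vec_space ?n "TYPE(complex)" .
  define b where "b = basis_completion u"
  from basis_completion[OF u, folded b_def]
  have dist_b: "distinct b" and indep: "\<not> lin_dep (set b)" and b: "set b \<subseteq> carrier_vec ?n"
    and hdb: "hd b = u" and len_b: "length b = ?n"
    by auto
  from hdb len_b obtain vs where bv: "b = u # vs" by (cases b) auto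
  define ws where "ws = gram_schmidt ?n b"
  from gram_schmidt_result[OF b dist_b indep refl, folded ws_def]
  have ws: "set ws \<subseteq> carrier_vec ?n" and orth: "corthogonal ws" and len: "length ws = ?n"
    by (auto simp: len_b)
  from gram_schmidt_hd[OF u(1), of vs, folded bv] have "hd ws = u" unfolding ws_def .
  then have ws0: "ws ! 0 = u"
    using len by (cases ws) auto
  have wsc: "ws ! j \<in> carrier_vec ?n" if "j < ?n" for j
    using ws len that by auto
  define T where "T = Matrix.mat ?n m (\<lambda>(i, j). vec_index (ws ! Suc j) i)"
  have ip: "ws ! k \<bullet>c ws ! j = (\<Sum>i<?n. cnj (vec_index (ws ! j) i) * vec_index (ws ! k) i)" if "j < ?n" "k < ?n" for j k
    using wsc[OF that(1)] wsc[OF that(2)] by (auto simp: scalar_prod_def atLeast0LessThan mult.commute)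
  have "(\<Sum>i<?n. cnj (T $$ (i, j)) * vec_index u i) = 0" if "j < m" for j
    using corthogonalD[OF orth, of 0 "Suc j"] ip[of "Suc j" 0] that len ws0 by (simp add: T_def)
  moreover have "x = 0\<^sub>v m" if x: "x \<in> carrier_vec m" and Tx: "T *\<^sub>v x = 0\<^sub>v ?n" for x
  proof (rule eq_vecI)
    fix j assume "j < dim_vec (0\<^sub>v m :: complex Matrix.vec)"
    then have j: "j < m" by simp
    \<comment> \<open>Pairing \<open>T x\<close> with column \<open>j\<close> isolates coordinate
      \<open>j\<close> of \<open>x\<close>, up to the nonzero squared norm of that column.\<close>
    have "0 = (\<Sum>i<?n. cnj (vec_index (ws ! Suc j) i) * vec_index (T *\<^sub>v x) i)"
      unfolding Tx by simp
    also have "\<dots> = (\<Sum>i<?n. \<Sum>k<m. cnj (vec_index (ws ! Suc j) i) * (vec_index (ws ! Suc k) i * vec_index x k))"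
      using x by (intro sum.cong) (auto simp: T_def scalar_prod_def atLeast0LessThan sum_distrib_left)
    also have "\<dots> = (\<Sum>k<m. (\<Sum>i<?n. cnj (vec_index (ws ! Suc j) i) * vec_index (ws ! Suc k) i) * vec_index x k)"
      by (subst sum.swap) (simp only: sum_distrib_right mult.assoc)
    also have "\<dots> = (\<Sum>k<m. (ws ! Suc k \<bullet>c ws ! Suc j) * vec_index x k)"
      using j by (intro sum.cong) (auto simp: ip)
    also have "\<dots> = (\<Sum>k<m. if k = j then (ws ! Suc j \<bullet>c ws ! Suc j) * vec_index x j else 0)"
      using j len corthogonalD[OF orth] by (intro sum.cong) auto
    also have "\<dots> = (ws ! Suc j \<bullet>c ws ! Suc j) * vec_index x j"
      using j by simp
    finally have "(ws ! Suc j \<bullet>c ws ! Suc j) * vec_index x j = 0" by simp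
    then show "vec_index x j = vec_index (0\<^sub>v m) j"
      using corthogonalD[OF orth, of "Suc j" "Suc j"] len j by simp
  qed (use x in auto)
  ultimately show ?thesis
    using that[of T] by (auto simp: T_def)
qed


lemma mult_col_index:
  assumes "T \<in> carrier_mat n m" "x \<in> carrier_vec m" "i < n"
  shows "vec_index (T *\<^sub>v x) i = (\<Sum>j<m. T $$ (i, j) * vec_index x j)"
  using assms by (simp add: scalar_prod_def atLeast0LessThan)

text \<open>Induction on the dimension by deflation. If N v = l K v, then every x that is
  K-orthogonal to v satisfies x^H N v = l x^H K v = 0, and skewness gives v^H N x = 0 too. Both
  forms therefore split along v and its K-orthogonal complement, and the compressed pair satisfies
  the same hypotheses one dimension lower.\<close>

theorem simultaneous_diagonalization:
  assumes "K \<in> carrier_mat n n" "N \<in> carrier_mat n n"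
    and "adj K = K" "adj N = - N"
    and "\<And>x. x \<in> carrier_vec n \<Longrightarrow> x \<noteq> 0\<^sub>v n \<Longrightarrow> 0 < Re (sesq K x x)"
  shows "\<exists>V \<in> carrier_mat n n. adj V * K * V = 1\<^sub>m n \<and> diagonal_mat (adj V * N * V)"
  using assms
proof (induction n arbitrary: K N)
  case 0
  then show ?case
    by (intro bexI[of _ "1\<^sub>m 0"]) (auto simp: diagonal_mat_def)
next
  case (Suc m)
  let ?n = "Suc m"
  note K = Suc.prems(1) and N = Suc.prems(2)
  have Kinj: "x = 0\<^sub>v ?n" if x: "x \<in> carrier_vec ?n" and e: "K *\<^sub>v x = 0\<^sub>v ?n" for x
  proof (rule ccontr)
    assume "x \<noteq> 0\<^sub>v ?n"
    then have "0 < Re (sesq K x x)" using Suc.prems(5) x by blast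
    then show False
      using sesq_mult_vec[OF K x, of x] e by simp
  qed
  obtain v0 l where v0: "v0 \<in> carrier_vec ?n" "v0 \<noteq> 0\<^sub>v ?n" and ev0: "N *\<^sub>v v0 = l \<cdot>\<^sub>v (K *\<^sub>v v0)"
    using pencil_eigenvector[OF K N _ Kinj] by blast
  have herm: "sesq K x y = cnj (sesq K y x)" for x y
    using sesq_adj[OF K, of x y] Suc.prems(3) by simp
  have skew: "sesq N x y = - cnj (sesq N y x)" for x y
  proof -
    have "sesq (- N) x y = cnj (sesq N y x)"
      using sesq_adj[OF N, of x y] unfolding Suc.prems(4) .
    then have "- (- sesq N x y) = - cnj (sesq N y x)"
      unfolding sesq_uminus by (rule arg_cong)
    then show ?thesis by simp
  qed
  define q where "q = Re (sesq K v0 v0)"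
  have q: "0 < q"
    using Suc.prems(5) v0 by (simp add: q_def)
  have qq: "sesq K v0 v0 = of_real q"
    using herm[of v0 v0] by (simp add: complex_eq_iff q_def)
  define v where "v = complex_of_real (1 / sqrt q) \<cdot>\<^sub>v v0"
  have v: "v \<in> carrier_vec ?n" using v0 by (simp add: v_def)
  have ev: "N *\<^sub>v v = l \<cdot>\<^sub>v (K *\<^sub>v v)"
    using ev0 mult_mat_vec[OF N v0(1)] mult_mat_vec[OF K v0(1)]
    by (simp add: v_def smult_smult_assoc mult.commute)
  have vKv: "sesq K v v = 1"
  proof -
    have "sesq K v v = of_real (1 / sqrt q) * of_real (1 / sqrt q) * sesq K v0 v0"
      using K v0 unfolding sesq_def sum_distrib_left
      by (intro sum.cong) (auto simp: v_def)
    also have "\<dots> = 1"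
      unfolding qq using q by (simp flip: of_real_mult add: field_simps)
    finally show ?thesis .
  qed
  \<comment> \<open>K-orthogonality to \<open>v\<close> is ordinary orthogonality to
    \<open>u\<close>, so the standard Gram-Schmidt process yields the complement.\<close>
  define u where "u = K *\<^sub>v v"
  have u: "u \<in> carrier_vec ?n" using K v by (simp add: u_def)
  have u0: "u \<noteq> 0\<^sub>v ?n"
  proof
    assume "u = 0\<^sub>v ?n"
    then have "v = 0\<^sub>v ?n" using Kinj[OF v] by (simp add: u_def)
    then show False using vKv K by (simp add: sesq_def)
  qed
  obtain T where T: "T \<in> carrier_mat ?n m"
    and orth: "\<And>j. j < m \<Longrightarrow> (\<Sum>i<?n. cnj (T $$ (i, j)) * vec_index u i) = 0"
    and inj: "\<And>x. x \<in> carrier_vec m \<Longrightarrow> T *\<^sub>v x = 0\<^sub>v ?n \<Longrightarrow> x = 0\<^sub>v m"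
    by (rule orthogonal_complement_basis[OF u u0]) (rule that)
  have TKv: "sesq K (T *\<^sub>v x) v = 0" if x: "x \<in> carrier_vec m" for x
  proof -
    have "sesq K (T *\<^sub>v x) v = (\<Sum>i<?n. \<Sum>j<m. cnj (vec_index x j) * (cnj (T $$ (i, j)) * vec_index u i))"
      using sesq_mult_vec[OF K v, of "T *\<^sub>v x"] mult_col_index[OF T x]
      by (simp add: u_def sum_distrib_right sum_distrib_left mult_ac cong: sum.cong_simp)
    also have "\<dots> = (\<Sum>j<m. cnj (vec_index x j) * (\<Sum>i<?n. cnj (T $$ (i, j)) * vec_index u i))"
      by (subst sum.swap) (simp only: sum_distrib_left)
    also have "\<dots> = 0"
      using orth by (simp add: sum.neutral)
    finally show ?thesis .
  qed
  have TNv: "sesq N (T *\<^sub>v x) v = 0" if x: "x \<in> carrier_vec m" for x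
  proof -
    have "sesq N (T *\<^sub>v x) v = l * sesq K (T *\<^sub>v x) v"
      using sesq_mult_vec[OF K v, of "T *\<^sub>v x"] sesq_mult_vec[OF N v, of "T *\<^sub>v x"] K v
      by (simp add: ev sum_distrib_left mult_ac del: sum.lessThan_Suc cong: sum.cong_simp)
    then show ?thesis using TKv[OF x] by simp
  qed
  define K' where "K' = adj T * K * T"
  define N' where "N' = adj T * N * T"
  have K': "K' \<in> carrier_mat m m" and N': "N' \<in> carrier_mat m m"
    using T K N by (auto simp: K'_def N'_def)
  have "adj K' = K'"
  proof (rule eq_matI)
    fix i j assume "i < dim_row K'" "j < dim_col K'"
    then have "i < m" "j < m" using K' by auto
    then show "adj K' $$ (i, j) = K' $$ (i, j)"
      using K' adj_congruence_index[OF T K T] herm[of "col T j" "col T i"] by (simp add: K'_def[symmetric])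
  qed (use K' in auto)
  moreover have "adj N' = - N'"
  proof (rule eq_matI)
    fix i j assume "i < dim_row (- N')" "j < dim_col (- N')"
    then have "i < m" "j < m" using N' by auto
    then show "adj N' $$ (i, j) = (- N') $$ (i, j)"
      using N' adj_congruence_index[OF T N T] skew[of "col T j" "col T i"] by (simp add: N'_def[symmetric])
  qed (use N' in auto)
  moreover have "0 < Re (sesq K' x x)" if "x \<in> carrier_vec m" "x \<noteq> 0\<^sub>v m" for x
    unfolding K'_def sesq_congruence[OF K T that(1) that(1)]
    using Suc.prems(5)[of "T *\<^sub>v x"] inj[OF that(1)] that T by auto
  ultimately obtain W where W: "W \<in> carrier_mat m m" and WK: "adj W * K' * W = 1\<^sub>m m"
    and WN: "diagonal_mat (adj W * N' * W)"
    using Suc.IH[OF K' N'] by blast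
  \<comment> \<open>The first column is \<open>v\<close>; the others are the columns of the smaller
    solution \<open>W\<close> carried back by \<open>T\<close>, hence the index shift.\<close>
  define V where "V = Matrix.mat ?n ?n (\<lambda>(i, j). if j = 0 then vec_index v i else vec_index (T *\<^sub>v col W (j - 1)) i)"
  have V: "V \<in> carrier_mat ?n ?n" by (simp add: V_def)
  have c0: "col V 0 = v"
    using v by (auto simp: V_def)
  have cS: "col V (Suc j) = T *\<^sub>v col W j" if "j < m" for j
    using that T W by (auto simp: V_def)
  have WC: "col W j \<in> carrier_vec m" for j using W by (auto intro: carrier_vecI)
  have KW: "sesq K (T *\<^sub>v col W i) (T *\<^sub>v col W j) = (if i = j then 1 else 0)" if "i < m" "j < m" for i j
    using adj_congruence_index[OF W K' W that] sesq_congruence[OF K T WC WC, of i j] WK that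
    by (simp add: K'_def[symmetric])
  have NW: "sesq N (T *\<^sub>v col W i) (T *\<^sub>v col W j) = 0" if "i < m" "j < m" "i \<noteq> j" for i j
    using adj_congruence_index[OF W N' W that(1,2)] sesq_congruence[OF N T WC WC, of i j] WN that W N'
    by (simp add: N'_def[symmetric] diagonal_mat_def)
  have vT: "sesq K v (T *\<^sub>v col W i) = 0" "sesq N v (T *\<^sub>v col W i) = 0" for i
    using TKv[OF WC, of i] TNv[OF WC, of i] herm[of v "T *\<^sub>v col W i"] skew[of v "T *\<^sub>v col W i"] by auto
  have "adj V * K * V = 1\<^sub>m ?n"
  proof (rule eq_matI)
    fix i j assume "i < dim_row (1\<^sub>m ?n :: complex Matrix.mat)" "j < dim_col (1\<^sub>m ?n :: complex Matrix.mat)"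
    then have ij: "i < ?n" "j < ?n" by auto
    show "(adj V * K * V) $$ (i, j) = 1\<^sub>m ?n $$ (i, j)"
      unfolding adj_congruence_index[OF V K V ij]
      using ij by (cases i; cases j) (auto simp: c0 cS KW vT vKv TKv WC)
  qed (use V in auto)
  moreover have "diagonal_mat (adj V * N * V)"
    unfolding diagonal_mat_def
  proof (intro allI impI)
    fix i j assume "i < dim_row (adj V * N * V)" "j < dim_col (adj V * N * V)" and ne: "i \<noteq> j"
    then have ij: "i < ?n" "j < ?n" using V by auto
    show "(adj V * N * V) $$ (i, j) = 0"
      unfolding adj_congruence_index[OF V N V ij]
      using ij ne by (cases i; cases j) (auto simp: c0 cS NW vT TNv WC)
  qed
  ultimately show ?case
    using V by blast
qed


section \<open>Spectral norms and condition numbers from Rayleigh quotients\<close>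

lemma vec_norm2_power2: "(vec_norm2 x)\<^sup>2 = (\<Sum>i<dim_vec x. (cmod (vec_index x i))\<^sup>2)"
  by (simp add: vec_norm2_def L2_set_def sum_nonneg)

lemma vec_norm2_nonneg [simp]: "0 \<le> vec_norm2 x"
  by (simp add: vec_norm2_def)

lemma vec_norm2_smult: "vec_norm2 (c \<cdot>\<^sub>v x) = cmod c * vec_norm2 x"
  unfolding vec_norm2_def by (simp add: norm_mult L2_set_right_distrib cong: L2_set_cong_simp)

lemma spectral_norm_le:
  assumes b: "0 \<le> b" and X: "X \<in> carrier_mat n m"
    and le: "\<And>v. v \<in> carrier_vec m \<Longrightarrow> vec_norm2 (X *\<^sub>v v) \<le> b * vec_norm2 v"
  shows "spectral_norm X \<le> b"
  unfolding spectral_norm_def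
proof (rule cSUP_least)
  have "0\<^sub>v m \<in> {v \<in> carrier_vec (dim_col X). vec_norm2 v \<le> 1}"
    using X by (auto simp: vec_norm2_def L2_set_def)
  then show "{v \<in> carrier_vec (dim_col X). vec_norm2 v \<le> 1} \<noteq> {}" by blast
  fix v assume "v \<in> {v \<in> carrier_vec (dim_col X). vec_norm2 v \<le> 1}"
  then have "v \<in> carrier_vec m" "vec_norm2 v \<le> 1" using X by auto
  then show "vec_norm2 (X *\<^sub>v v) \<le> b"
    using le[of v] mult_left_mono[of "vec_norm2 v" 1 b] b by auto
qed

text \<open>A supremum dominates its members only if it is bounded above, so some growth bound
  \<open>b\<close> accompanies the test vector \<open>v\<close>, which is rescaled to norm
  one.\<close>

lemma spectral_norm_ge:
  assumes b: "0 \<le> b" and X: "X \<in> carrier_mat n m"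
    and le: "\<And>v. v \<in> carrier_vec m \<Longrightarrow> vec_norm2 (X *\<^sub>v v) \<le> b * vec_norm2 v"
    and v: "v \<in> carrier_vec m" "0 < vec_norm2 v" and ge: "c * vec_norm2 v \<le> vec_norm2 (X *\<^sub>v v)"
  shows "c \<le> spectral_norm X"
proof -
  define w where "w = complex_of_real (1 / vec_norm2 v) \<cdot>\<^sub>v v"
  have "c \<le> vec_norm2 (X *\<^sub>v w)"
    using v ge X by (simp add: w_def mult_mat_vec[OF X] vec_norm2_smult norm_divide field_simps)
  also have "\<dots> \<le> spectral_norm X"
    unfolding spectral_norm_def
  proof (rule cSUP_upper)
    show "w \<in> {v \<in> carrier_vec (dim_col X). vec_norm2 v \<le> 1}"
      using v X by (simp add: w_def vec_norm2_smult norm_divide)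
    show "bdd_above ((\<lambda>v. vec_norm2 (X *\<^sub>v v)) ` {v \<in> carrier_vec (dim_col X). vec_norm2 v \<le> 1})"
    proof (rule bdd_aboveI2)
      fix v assume "v \<in> {v \<in> carrier_vec (dim_col X). vec_norm2 v \<le> 1}"
      then have "v \<in> carrier_vec m" "vec_norm2 v \<le> 1" using X by auto
      then show "vec_norm2 (X *\<^sub>v v) \<le> b"
        using le[of v] mult_left_mono[of "vec_norm2 v" 1 b] b by auto
    qed
  qed
  finally show ?thesis .
qed

definition quad :: "real Matrix.mat \<Rightarrow> (nat \<Rightarrow> real) \<Rightarrow> real" where
  "quad K x = (\<Sum>i<dim_row K. \<Sum>j<dim_row K. x i * K $$ (i, j) * x j)"

text \<open>Holds term by term: for a real entry, the real part of cnj x_i * x_j is Re x_i Re x_j +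
  Im x_i Im x_j. Bounds for real nodal vectors thus carry over to complex ones.\<close>

lemma Re_sesq_of_real:
  assumes K: "K \<in> carrier_mat n n"
  shows "Re (sesq (map_mat complex_of_real K) x x) =
    quad K (\<lambda>i. Re (vec_index x i)) + quad K (\<lambda>i. Im (vec_index x i))"
  using K unfolding sesq_def quad_def Re_sum sum.distrib[symmetric]
  by (intro sum.cong) (auto simp: algebra_simps)

lemma vec_norm2_Re_Im:
  "(vec_norm2 x)\<^sup>2 = (\<Sum>i<dim_vec x. (Re (vec_index x i))\<^sup>2) + (\<Sum>i<dim_vec x. (Im (vec_index x i))\<^sup>2)"
  by (simp add: vec_norm2_power2 cmod_power2 sum.distrib)

lemma sesq_one: 
  assumes "x \<in> carrier_vec n"
  shows "sesq (1\<^sub>m n) x x = of_real ((vec_norm2 x)\<^sup>2)"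
proof -
  have "sesq (1\<^sub>m n) x x = (\<Sum>i<n. cnj (vec_index x i) * vec_index x i)"
    using assms by (subst sesq_mult_vec[of _ n]) auto
  also have "\<dots> = of_real ((vec_norm2 x)\<^sup>2)"
    using assms unfolding vec_norm2_power2 of_real_sum
    by (intro sum.cong refl) (auto simp: mult.commute simp flip: complex_norm_square)
  finally show ?thesis .
qed

lemma smult_smult_mat: "k \<cdot>\<^sub>m (l \<cdot>\<^sub>m A) = (k * l :: 'a :: semigroup_mult) \<cdot>\<^sub>m A"
  by (rule eq_matI) (auto simp: mult.assoc)

text \<open>With \<open>U\<close> = V^-1 one has |U x|^2 = x^H K x. The bounds \<open>c1\<close> and
  \<open>c2\<close> on Rayleigh quotients of \<open>K\<close> give |V| \<le> 1 / sqrt c1 and |U|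
  \<le> sqrt c2. The vector \<open>y\<close>, of quotient at least \<open>c3\<close>, bounds |U|
  from below, and \<open>z\<close>, of quotient at most \<open>c4\<close>, bounds |V| from
  below.\<close>

theorem preconditioned_diagonalization:
  fixes K W :: "real Matrix.mat"
  assumes K: "K \<in> carrier_mat n n" and W: "W \<in> carrier_mat n n" and a: "0 < a"
    and sym: "\<And>i j. i < n \<Longrightarrow> j < n \<Longrightarrow> K $$ (i, j) = K $$ (j, i)"
    and skew: "\<And>i j. i < n \<Longrightarrow> j < n \<Longrightarrow> W $$ (i, j) = - W $$ (j, i)"
    and c1: "0 < c1" and lower: "\<And>x. c1 * (\<Sum>i<n. (x i)\<^sup>2) \<le> quad K x"
    and c2: "0 \<le> c2" and upper: "\<And>x. quad K x \<le> c2 * (\<Sum>i<n. (x i)\<^sup>2)"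
    and y: "0 < (\<Sum>i<n. (y i)\<^sup>2)" "c3 * (\<Sum>i<n. (y i)\<^sup>2) \<le> quad K y" and c3: "0 \<le> c3"
    and z: "0 < (\<Sum>i<n. (z i)\<^sup>2)" "quad K z \<le> c4 * (\<Sum>i<n. (z i)\<^sup>2)"
  shows "invertible_mat (a \<cdot>\<^sub>m K) \<and>
    (\<exists>V D. V \<in> carrier_mat n n \<and> D \<in> carrier_mat n n \<and> invertible_mat V \<and> diagonal_mat D \<and>
      map_mat complex_of_real (mat_inv (a \<cdot>\<^sub>m K) * (a \<cdot>\<^sub>m K + W)) = V * D * mat_inv V \<and>
      sqrt (c3 / c4) \<le> cond2 V \<and> cond2 V \<le> sqrt (c2 / c1))"
proof -
  \<comment> \<open>The Rayleigh quotient of \<open>z\<close> lies between \<open>c1\<close> and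
    \<open>c4\<close>.\<close>
  have c4: "0 < c4"
    using mult_right_le_imp_le[OF order_trans[OF lower z(2)] z(1)] c1 by linarith
  let ?K = "map_mat complex_of_real K" and ?W = "map_mat complex_of_real W"
  have KC: "?K \<in> carrier_mat n n" and WC: "?W \<in> carrier_mat n n"
    using K W by auto
  have lowerC: "c1 * (vec_norm2 x)\<^sup>2 \<le> Re (sesq ?K x x)" if "x \<in> carrier_vec n" for x
    using that lower[of "\<lambda>i. Re (vec_index x i)"] lower[of "\<lambda>i. Im (vec_index x i)"]
    by (simp add: Re_sesq_of_real[OF K] vec_norm2_Re_Im distrib_left)
  have upperC: "Re (sesq ?K x x) \<le> c2 * (vec_norm2 x)\<^sup>2" if "x \<in> carrier_vec n" for x
    using that upper[of "\<lambda>i. Re (vec_index x i)"] upper[of "\<lambda>i. Im (vec_index x i)"]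
    by (simp add: Re_sesq_of_real[OF K] vec_norm2_Re_Im distrib_left)
  have "adj ?K = ?K"
    using K by (intro eq_matI) (auto simp: sym)
  moreover have "adj ?W = - ?W"
  proof (rule eq_matI)
    fix i j assume "i < dim_row (- ?W)" "j < dim_col (- ?W)"
    then have "i < n" "j < n" using W by auto
    then show "adj ?W $$ (i, j) = (- ?W) $$ (i, j)"
      using W skew[of j i] by simp
  qed (use W in auto)
  moreover have "0 < Re (sesq ?K x x)" if x: "x \<in> carrier_vec n" "x \<noteq> 0\<^sub>v n" for x
  proof -
    obtain i where "i < n" "vec_index x i \<noteq> 0"
      using x by (metis carrier_vecD eq_vecI index_zero_vec)
    then have "0 < (vec_norm2 x)\<^sup>2"
      using x unfolding vec_norm2_power2 by (intro sum_pos2[of _ i]) auto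
    then show ?thesis
      using mult_pos_pos[OF c1] lowerC[OF x(1)] by (meson less_le_trans)
  qed
  ultimately obtain V where V: "V \<in> carrier_mat n n" and VK: "adj V * ?K * V = 1\<^sub>m n"
    and VW: "diagonal_mat (adj V * ?W * V)"
    using simultaneous_diagonalization[OF KC WC] by blast
  define U where "U = adj V * ?K"
  have U: "U \<in> carrier_mat n n" using V KC by (auto simp: U_def)
  have UV: "U * V = 1\<^sub>m n" using VK by (simp add: U_def)
  have VU: "V * U = 1\<^sub>m n" using mat_mult_left_right_inverse[OF U V UV] .
  have invV: "mat_inv V = U" "invertible_mat V"
    using mat_inv_eq[OF V U VU] by auto
  have normV: "Re (sesq ?K (V *\<^sub>v x) (V *\<^sub>v x)) = (vec_norm2 x)\<^sup>2" if "x \<in> carrier_vec n" for x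
    unfolding sesq_congruence[OF KC V that that, symmetric] VK sesq_one[OF that] by (simp only: Re_complex_of_real)
  have VUx: "V *\<^sub>v (U *\<^sub>v x) = x" if "x \<in> carrier_vec n" for x
    using V U VU that by (metis assoc_mult_mat_vec one_mult_mat_vec)
  have Ux: "U *\<^sub>v x \<in> carrier_vec n" if "x \<in> carrier_vec n" for x
    using U that by auto
  have Vx: "V *\<^sub>v x \<in> carrier_vec n" if "x \<in> carrier_vec n" for x
    using V that by auto
  have normU: "(vec_norm2 (U *\<^sub>v x))\<^sup>2 = Re (sesq ?K x x)" if "x \<in> carrier_vec n" for x
    using normV[OF Ux[OF that]] VUx[OF that] by simp
  have sqrt_le: "vec_norm2 x \<le> sqrt b * vec_norm2 x'" if "(vec_norm2 x)\<^sup>2 \<le> b * (vec_norm2 x')\<^sup>2" "0 \<le> b" for x x' b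
    using real_sqrt_le_mono[OF that(1)] by (simp add: real_sqrt_mult)
  have sqrt_ge: "sqrt b * vec_norm2 x' \<le> vec_norm2 x" if "b * (vec_norm2 x')\<^sup>2 \<le> (vec_norm2 x)\<^sup>2" "0 \<le> b" for x x' b
    using real_sqrt_le_mono[OF that(1)] by (simp add: real_sqrt_mult)
  have Vle: "vec_norm2 (V *\<^sub>v x) \<le> sqrt (1 / c1) * vec_norm2 x" if "x \<in> carrier_vec n" for x
    using normV[OF that] lowerC[OF Vx[OF that]] c1 by (intro sqrt_le) (auto simp: field_simps)
  have Ule: "vec_norm2 (U *\<^sub>v x) \<le> sqrt c2 * vec_norm2 x" if "x \<in> carrier_vec n" for x
    using normU[OF that] upperC[OF that] c2 by (intro sqrt_le) auto
  let ?y = "Matrix.vec n (\<lambda>i. complex_of_real (y i))" and ?z = "Matrix.vec n (\<lambda>i. complex_of_real (z i))"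
  have quad_cong: "quad K x = quad K x'" if "\<And>i. i < n \<Longrightarrow> x i = x' i" for x x'
    using that K by (simp add: quad_def)
  have quad0: "quad K x = 0" if "\<And>i. i < n \<Longrightarrow> x i = 0" for x
    using that K by (simp add: quad_def)
  have yC: "?y \<in> carrier_vec n" "(vec_norm2 ?y)\<^sup>2 = (\<Sum>i<n. (y i)\<^sup>2)" "Re (sesq ?K ?y ?y) = quad K y"
    by (auto simp: vec_norm2_Re_Im Re_sesq_of_real[OF K] intro!: quad_cong quad0 trans[OF arg_cong2[where f="(+)", OF quad_cong quad0]])
  have zC: "?z \<in> carrier_vec n" "(vec_norm2 ?z)\<^sup>2 = (\<Sum>i<n. (z i)\<^sup>2)" "Re (sesq ?K ?z ?z) = quad K z"
    by (auto simp: vec_norm2_Re_Im Re_sesq_of_real[OF K] intro!: quad_cong quad0 trans[OF arg_cong2[where f="(+)", OF quad_cong quad0]])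
  have pos: "0 < vec_norm2 x" if "0 < (vec_norm2 x)\<^sup>2" for x
    using that by (simp add: order_less_le)
  \<comment> \<open>\<open>V\<close> is tested at the preimage of \<open>z\<close>: it maps U z to
    z, while |U z|^2 = z^T K z is small.\<close>
  have Vge: "sqrt (1 / c4) \<le> spectral_norm V"
  proof (rule spectral_norm_ge[OF _ V Vle, of "U *\<^sub>v ?z"])
    have "0 < Re (sesq ?K ?z ?z)"
      using mult_pos_pos[OF c1 z(1)] lowerC[OF zC(1), unfolded zC(2)] by linarith
    then show "0 < vec_norm2 (U *\<^sub>v ?z)"
      using normU[OF zC(1)] by (intro pos) simp
    show "sqrt (1 / c4) * vec_norm2 (U *\<^sub>v ?z) \<le> vec_norm2 (V *\<^sub>v (U *\<^sub>v ?z))"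
      unfolding VUx[OF zC(1)]
      using normU[OF zC(1)] z zC c4 by (intro sqrt_ge) (auto simp: field_simps)
  qed (use c1 Ux zC in auto)
  have Uge: "sqrt c3 \<le> spectral_norm U"
  proof (rule spectral_norm_ge[OF _ U Ule yC(1)])
    show "0 < vec_norm2 ?y"
      using y yC by (intro pos) simp
    show "sqrt c3 * vec_norm2 ?y \<le> vec_norm2 (U *\<^sub>v ?y)"
      using normU[OF yC(1)] y yC c3 by (intro sqrt_ge) auto
  qed (use c2 in auto)
  have "spectral_norm V \<le> sqrt (1 / c1)" "spectral_norm U \<le> sqrt c2"
    using spectral_norm_le[OF _ V Vle] spectral_norm_le[OF _ U Ule] c1 c2 by auto
  moreover have "0 \<le> sqrt (1 / c4)" "0 \<le> sqrt c3" "0 \<le> sqrt (1 / c1)"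
    using c1 c3 c4 by auto
  moreover from this have "0 \<le> spectral_norm V" "0 \<le> spectral_norm U"
    using Vge Uge by linarith+
  ultimately have "cond2 V \<le> sqrt (1 / c1) * sqrt c2" and "sqrt (1 / c4) * sqrt c3 \<le> cond2 V"
    unfolding cond2_def invV using Vge Uge by (blast intro: mult_mono)+
  then have cond: "sqrt (c3 / c4) \<le> cond2 V" "cond2 V \<le> sqrt (c2 / c1)"
    by (simp_all add: real_sqrt_divide mult.commute)
  obtain R where R: "R \<in> carrier_mat n n" and KR: "K * R = 1\<^sub>m n" and RK: "R * K = 1\<^sub>m n"
  proof (rule nonsingular_imp_inverse[OF K])
    fix x assume x: "x \<in> carrier_vec n" and Kx: "K *\<^sub>v x = 0\<^sub>v n"
    have "quad K (vec_index x) = (\<Sum>i<n. vec_index x i * vec_index (K *\<^sub>v x) i)"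
      using K x by (auto simp: quad_def scalar_prod_def atLeast0LessThan sum_distrib_left mult.assoc intro!: sum.cong)
    then have "c1 * (\<Sum>i<n. (vec_index x i)\<^sup>2) \<le> 0"
      using lower[of "vec_index x"] Kx by simp
    then have "(\<Sum>i<n. (vec_index x i)\<^sup>2) \<le> 0"
      using c1 by (simp add: mult_le_0_iff)
    then have "(\<Sum>i<n. (vec_index x i)\<^sup>2) = 0"
      by (simp add: order_antisym sum_nonneg)
    then show "x = 0\<^sub>v n"
      using x by (intro eq_vecI) (auto simp: sum_nonneg_eq_0_iff)
  qed auto
  have aK: "a \<cdot>\<^sub>m K \<in> carrier_mat n n" using K by simp
  have aR: "(1 / a) \<cdot>\<^sub>m R \<in> carrier_mat n n" using R by simp
  have "(a \<cdot>\<^sub>m K) * ((1 / a) \<cdot>\<^sub>m R) = 1\<^sub>m n"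
    unfolding mult_smult_assoc_mat[OF K aR] mult_smult_distrib[OF K R] smult_smult_mat KR
    using a by (intro eq_matI) auto
  from mat_inv_eq[OF aK aR this] have inv: "mat_inv (a \<cdot>\<^sub>m K) = (1 / a) \<cdot>\<^sub>m R" "invertible_mat (a \<cdot>\<^sub>m K)"
    by auto
  \<comment> \<open>The diffusion part becomes the identity, so only K^-1 W (with \<open>R\<close> =
    K^-1) has to be diagonalized.\<close>
  have M: "mat_inv (a \<cdot>\<^sub>m K) * (a \<cdot>\<^sub>m K + W) = 1\<^sub>m n + (1 / a) \<cdot>\<^sub>m (R * W)"
    unfolding inv mult_add_distrib_mat[OF aR aK W] mult_smult_assoc_mat[OF R aK] mult_smult_assoc_mat[OF R W]
      mult_smult_distrib[OF R K] smult_smult_mat RK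
    using R W a by (intro eq_matI) auto
  let ?R = "map_mat complex_of_real R"
  have RC: "?R \<in> carrier_mat n n" using R by simp
  have RKC: "?R * ?K = 1\<^sub>m n"
    using RK K R by (metis of_real_hom.mat_hom_mult of_real_hom.mat_hom_one)
  have KRC: "?K * ?R = 1\<^sub>m n"
    using KR K R by (metis of_real_hom.mat_hom_mult of_real_hom.mat_hom_one)
  define E where "E = adj V * ?W * V"
  have E: "E \<in> carrier_mat n n" using V WC by (auto simp: E_def)
  define D where "D = 1\<^sub>m n + complex_of_real (1 / a) \<cdot>\<^sub>m E"
  have D: "D \<in> carrier_mat n n" using E by (auto simp: D_def)
  have "diagonal_mat D"
    using VW E unfolding D_def E_def[symmetric] diagonal_mat_def by simp
  have aV: "adj V \<in> carrier_mat n n" using V by simp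
  have "U * (?R * ?W) = adj V * ?W"
  proof -
    have "U * (?R * ?W) = U * ?R * ?W" using assoc_mult_mat[OF U RC WC] by simp
    also have "U * ?R = adj V"
      unfolding U_def using assoc_mult_mat[OF aV KC RC] KRC right_mult_one_mat[OF aV] by simp
    finally show ?thesis .
  qed
  then have UE: "U * (?R * ?W) * V = E" by (simp add: E_def)
  have RW: "?R * ?W \<in> carrier_mat n n" using RC WC by simp
  have VEU: "V * E * U = ?R * ?W"
  proof -
    have "V * E * U = V * (U * (?R * ?W)) * V * U"
      unfolding UE[symmetric] using assoc_mult_mat[OF V mult_carrier_mat[OF U RW] V] by simp
    also have "\<dots> = V * (U * (?R * ?W)) * (V * U)"
      using assoc_mult_mat[OF mult_carrier_mat[OF V mult_carrier_mat[OF U RW]] V U] by simp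
    also have "\<dots> = V * U * (?R * ?W) * (V * U)"
      using assoc_mult_mat[OF V U RW] by simp
    finally show ?thesis
      using VU left_mult_one_mat[OF RW] right_mult_one_mat[OF RW] by simp
  qed
  have "V * D * U = (V + complex_of_real (1 / a) \<cdot>\<^sub>m (V * E)) * U"
    unfolding D_def using V E
    by (simp add: mult_add_distrib_mat[OF V one_carrier_mat] mult_smult_distrib[OF V E])
  also have "\<dots> = 1\<^sub>m n + complex_of_real (1 / a) \<cdot>\<^sub>m (V * E * U)"
    using V E U VU by (simp add: add_mult_distrib_mat[OF V _ U] mult_smult_assoc_mat[OF mult_carrier_mat[OF V E] U])
  also have "\<dots> = map_mat complex_of_real (1\<^sub>m n + (1 / a) \<cdot>\<^sub>m (R * W))"
    unfolding VEU using R W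
    by (simp add: of_real_hom.mat_hom_mult[OF R W, symmetric]) (rule eq_matI, auto)
  finally have "map_mat complex_of_real (mat_inv (a \<cdot>\<^sub>m K) * (a \<cdot>\<^sub>m K + W)) = V * D * mat_inv V"
    unfolding M invV by simp
  then show ?thesis
    using inv V D invV \<open>diagonal_mat D\<close> cond by blast
qed

section \<open>The triangulated lattice\<close>

text \<open>\<open>f1\<close>, \<open>f2\<close> is the basis dual to \<open>e1\<close>,
  \<open>e2\<close>: it reads off the coordinates of a point, and divided by \<open>h\<close> it
  consists of the gradients of the lattice coordinates.\<close>

locale affine_lattice =
  fixes org e1 e2 f1 f2 :: point and h :: real
  assumes h: "0 < h"
    and dual: "inner f1 e1 = 1" "inner f1 e2 = 0" "inner f2 e1 = 0" "inner f2 e2 = 1"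
    and expand: "\<And>x. x = inner f1 x *\<^sub>R e1 + inner f2 x *\<^sub>R e2"
begin

definition sc :: "point \<Rightarrow> real" where "sc x = inner f1 (x - org) / h"
definition tc :: "point \<Rightarrow> real" where "tc x = inner f2 (x - org) / h"
definition pt :: "real \<Rightarrow> real \<Rightarrow> point" where "pt s t = org + h *\<^sub>R (s *\<^sub>R e1 + t *\<^sub>R e2)"

definition node :: "int \<times> int \<Rightarrow> point" where
  "node k = pt (of_int (fst k)) (of_int (snd k))"

lemma sc_pt [simp]: "sc (pt s t) = s" and tc_pt [simp]: "tc (pt s t) = t"
  using h dual by (simp_all add: sc_def tc_def pt_def inner_add_right)

lemma pt_sc_tc [simp]: "pt (sc x) (tc x) = x"
  using h expand[of "x - org"] by (simp add: sc_def tc_def pt_def scaleR_add_right)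

lemma point_eq_iff: "x = y \<longleftrightarrow> sc x = sc y \<and> tc x = tc y"
  by (metis pt_sc_tc)

lemma sc_node [simp]: "sc (node k) = of_int (fst k)" and tc_node [simp]: "tc (node k) = of_int (snd k)"
  by (simp_all add: node_def)

lemma node_eq_iff [simp]: "node k = node l \<longleftrightarrow> k = l"
  by (auto simp: point_eq_iff prod_eq_iff)

lemma sc_convex: "u + v = 1 \<Longrightarrow> sc (u *\<^sub>R x + v *\<^sub>R y) = u * sc x + v * sc y"
  and tc_convex: "u + v = 1 \<Longrightarrow> tc (u *\<^sub>R x + v *\<^sub>R y) = u * tc x + v * tc y"
proof -
  assume "u + v = 1"
  then have "u *\<^sub>R x + v *\<^sub>R y - org = u *\<^sub>R (x - org) + v *\<^sub>R (y - org)"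
    by (simp add: algebra_simps flip: scaleR_add_left)
  then show "sc (u *\<^sub>R x + v *\<^sub>R y) = u * sc x + v * sc y" "tc (u *\<^sub>R x + v *\<^sub>R y) = u * tc x + v * tc y"
    by (simp_all add: sc_def tc_def inner_add_right add_divide_distrib)
qed

lemma sc_convex3: "u + v + w = 1 \<Longrightarrow> sc (u *\<^sub>R x + v *\<^sub>R y + w *\<^sub>R z) = u * sc x + v * sc y + w * sc z"
  and tc_convex3: "u + v + w = 1 \<Longrightarrow> tc (u *\<^sub>R x + v *\<^sub>R y + w *\<^sub>R z) = u * tc x + v * tc y + w * tc z"
proof -
  assume "u + v + w = 1"
  then have "u *\<^sub>R x + v *\<^sub>R y + w *\<^sub>R z - org = u *\<^sub>R (x - org) + v *\<^sub>R (y - org) + w *\<^sub>R (z - org)"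
    by (simp add: algebra_simps flip: scaleR_add_left)
  then show "sc (u *\<^sub>R x + v *\<^sub>R y + w *\<^sub>R z) = u * sc x + v * sc y + w * sc z"
    "tc (u *\<^sub>R x + v *\<^sub>R y + w *\<^sub>R z) = u * tc x + v * tc y + w * tc z"
    by (simp_all add: sc_def tc_def inner_add_right add_divide_distrib)
qed

lemma continuous_sc [continuous_intros]: "continuous_on A sc"
  and continuous_tc [continuous_intros]: "continuous_on A tc"
  unfolding sc_def[abs_def] tc_def[abs_def] using h by (auto intro!: continuous_intros)

lemma sc_eq: "sc x = inner (f1 /\<^sub>R h) x - inner f1 org / h"
  and tc_eq: "tc x = inner (f2 /\<^sub>R h) x - inner f2 org / h"
  by (simp_all add: sc_def tc_def inner_diff_right divide_inverse algebra_simps)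

text \<open>The hat function in closed form. Edges of the triangulation point along
  \<open>e1\<close>, \<open>e2\<close> and \<open>e1 - e2\<close>, so the six triangles around a
  node form the unit ball of the norm max of |s|, |t|, |s + t|; the hat is one minus this norm, cut
  off at zero.\<close>

definition phi :: "int \<times> int \<Rightarrow> point \<Rightarrow> real" where
  "phi k x = max 0 (1 - max \<bar>sc x - fst k\<bar> (max \<bar>tc x - snd k\<bar> \<bar>sc x - fst k + (tc x - snd k)\<bar>))"

text \<open>Each lattice parallelogram is cut along the diagonal on which the coordinates sum to i +
  j + 1; \<open>b\<close> selects the half away from the corner (i, j).\<close>

definition tri :: "int \<Rightarrow> int \<Rightarrow> bool \<Rightarrow> point set" where
  "tri i j b = (if b then {x. sc x \<le> i + 1 \<and> tc x \<le> j + 1 \<and> i + j + 1 \<le> sc x + tc x}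
                else {x. i \<le> sc x \<and> j \<le> tc x \<and> sc x + tc x \<le> i + j + 1})"

definition otri :: "int \<Rightarrow> int \<Rightarrow> bool \<Rightarrow> point set" where
  "otri i j b = (if b then {x. sc x < i + 1 \<and> tc x < j + 1 \<and> i + j + 1 < sc x + tc x}
                else {x. i < sc x \<and> j < tc x \<and> sc x + tc x < i + j + 1})"

definition verts :: "int \<Rightarrow> int \<Rightarrow> bool \<Rightarrow> (int \<times> int) set" where
  "verts i j b = (if b then {(i + 1, j), (i, j + 1), (i + 1, j + 1)} else {(i, j), (i + 1, j), (i, j + 1)})"

lemma otri_subset_tri: "otri i j b \<subseteq> tri i j b"
  by (auto simp: otri_def tri_def)

lemma open_otri: "open (otri i j b)"
  by (cases b) (auto simp: otri_def intro!: open_Collect_conj open_Collect_less continuous_intros)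

lemma closed_tri: "closed (tri i j b)"
  by (cases b) (auto simp: tri_def intro!: closed_Collect_conj closed_Collect_le continuous_intros)

lemma convex_Collect_sc_tc: "convex {x. \<alpha> * sc x + \<beta> * tc x < c}"
  "convex {x. \<alpha> * sc x + \<beta> * tc x \<le> c}"
proof -
  have *: "\<alpha> * sc (u *\<^sub>R x + v *\<^sub>R y) + \<beta> * tc (u *\<^sub>R x + v *\<^sub>R y) =
    u * (\<alpha> * sc x + \<beta> * tc x) + v * (\<alpha> * sc y + \<beta> * tc y)" if "u + v = 1" for u v x y
    using that by (simp add: sc_convex tc_convex algebra_simps)
  show "convex {x. \<alpha> * sc x + \<beta> * tc x < c}" "convex {x. \<alpha> * sc x + \<beta> * tc x \<le> c}"
    by (auto simp: convex_def * intro: convex_bound_lt convex_bound_le)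
qed

lemma convex_otri: "convex (otri i j b)"
  and convex_tri: "convex (tri i j b)"
proof -
  have eq: "otri i j True = {x. 1 * sc x + 0 * tc x < i + 1} \<inter> {x. 0 * sc x + 1 * tc x < j + 1} \<inter>
     {x. (-1) * sc x + (-1) * tc x < -(i + j + 1)}" 
    "otri i j False = {x. (-1) * sc x + 0 * tc x < - i} \<inter> {x. 0 * sc x + (-1) * tc x < - j} \<inter>
     {x. 1 * sc x + 1 * tc x < i + j + 1}" 
    "tri i j True = {x. 1 * sc x + 0 * tc x \<le> i + 1} \<inter> {x. 0 * sc x + 1 * tc x \<le> j + 1} \<inter>
     {x. (-1) * sc x + (-1) * tc x \<le> -(i + j + 1)}" 
    "tri i j False = {x. (-1) * sc x + 0 * tc x \<le> - i} \<inter> {x. 0 * sc x + (-1) * tc x \<le> - j} \<inter>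
     {x. 1 * sc x + 1 * tc x \<le> i + j + 1}"
    by (auto simp: otri_def tri_def)
  show "convex (otri i j b)" "convex (tri i j b)"
    by (cases b; simp only: eq; intro convex_Int convex_Collect_sc_tc)+
qed

lemma tri_centre: "pt (if b then i + 2/3 else i + 1/3) (if b then j + 2/3 else j + 1/3) \<in> otri i j b"
  by (auto simp: otri_def)

text \<open>The segment from the centroid to a point of the closed triangle stays in the open
  triangle up to its far end. This matches the hexagon meshes, whose triangles are closures of
  components.\<close>

lemma closure_otri: "closure (otri i j b) = tri i j b"
proof
  show "closure (otri i j b) \<subseteq> tri i j b"
    using otri_subset_tri closed_tri by (rule closure_minimal)
  show "tri i j b \<subseteq> closure (otri i j b)"
  proof
    fix x assume x: "x \<in> tri i j b"
    define c where "c = pt (if b then i + 2/3 else i + 1/3) (if b then j + 2/3 else j + 1/3)"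
    have c: "c \<in> otri i j b" using tri_centre by (simp add: c_def)
    show "x \<in> closure (otri i j b)"
    proof (cases "x = c")
      case True
      then show ?thesis using c closure_subset by blast
    next
      case False
      have "open_segment c x \<subseteq> otri i j b"
      proof
        fix y assume "y \<in> open_segment c x"
        then obtain u where u: "0 < u" "u < 1" and y: "y = (1 - u) *\<^sub>R c + u *\<^sub>R x"
          by (auto simp: in_segment)
        have lt: "(1 - u) * p + u * q < r" if "p < r" "q \<le> r" for p q r :: real
        proof -
          have "(1 - u) * p < (1 - u) * r" "u * q \<le> u * r" using that u by auto
          then show ?thesis by (simp add: algebra_simps)
        qed
        have gt: "r < (1 - u) * p + u * q" if "r < p" "r \<le> q" for p q r :: real
          using lt[of "-p" "-r" "-q"] that by simp
        have e: "sc y + tc y = (1 - u) * (sc c + tc c) + u * (sc x + tc x)"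
          by (simp add: y sc_convex tc_convex) (simp add: algebra_simps)
        show "y \<in> otri i j b"
          using c x lt gt e by (cases b) (simp_all add: otri_def tri_def y sc_convex tc_convex)
      qed
      then have "closure (open_segment c x) \<subseteq> closure (otri i j b)"
        by (rule closure_mono)
      then show ?thesis using False by auto
    qed
  qed
qed

lemma tri_eq_hull: "tri i j b = convex hull (node ` verts i j b)"
proof
  show "convex hull (node ` verts i j b) \<subseteq> tri i j b"
  proof (rule hull_minimal)
    show "node ` verts i j b \<subseteq> tri i j b"
      by (auto simp: tri_def verts_def split: if_splits)
  qed (rule convex_tri)
  show "tri i j b \<subseteq> convex hull (node ` verts i j b)"
  proof
    fix x assume x: "x \<in> tri i j b"
    show "x \<in> convex hull (node ` verts i j b)"
    proof (cases b)
      case True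
      let ?u = "j + 1 - tc x" and ?v = "i + 1 - sc x" and ?w = "sc x + tc x - (i + j + 1)"
      have "x = ?u *\<^sub>R node (i + 1, j) + ?v *\<^sub>R node (i, j + 1) + ?w *\<^sub>R node (i + 1, j + 1)"
        by (simp add: point_eq_iff sc_convex3 tc_convex3) (simp add: algebra_simps)
      moreover have "0 \<le> ?u" "0 \<le> ?v" "0 \<le> ?w" "?u + ?v + ?w = 1"
        using x True by (auto simp: tri_def)
      moreover have V: "node ` verts i j b = {node (i + 1, j), node (i, j + 1), node (i + 1, j + 1)}"
        using True by (simp add: verts_def)
      ultimately show ?thesis
        unfolding V convex_hull_3 by blast
    next
      case False
      let ?u = "i + j + 1 - sc x - tc x" and ?v = "sc x - i" and ?w = "tc x - j"
      have "x = ?u *\<^sub>R node (i, j) + ?v *\<^sub>R node (i + 1, j) + ?w *\<^sub>R node (i, j + 1)"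
        by (simp add: point_eq_iff sc_convex3 tc_convex3) (simp add: algebra_simps)
      moreover have "0 \<le> ?u" "0 \<le> ?v" "0 \<le> ?w" "?u + ?v + ?w = 1"
        using x False by (auto simp: tri_def)
      moreover have V: "node ` verts i j b = {node (i, j), node (i + 1, j), node (i, j + 1)}"
        using False by (simp add: verts_def)
      ultimately show ?thesis
        unfolding V convex_hull_3 by blast
    qed
  qed
qed

lemma extreme_point_of_tri: "x extreme_point_of tri i j b \<longleftrightarrow> x \<in> node ` verts i j b"
proof
  assume "x extreme_point_of tri i j b"
  then show "x \<in> node ` verts i j b"
    unfolding tri_eq_hull by (rule extreme_point_of_convex_hull)
next
  \<comment> \<open>Each vertex is the unique minimizer over the triangle of some affine function of
    the coordinates, hence a one-point face; the six cases supply these functions.\<close>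
  have *: "x extreme_point_of tri i j b"
    if ge: "\<And>y. y \<in> tri i j b \<Longrightarrow> c \<le> \<alpha> * sc y + \<beta> * tc y"
      and eq: "\<And>y. y \<in> tri i j b \<Longrightarrow> \<alpha> * sc y + \<beta> * tc y = c \<Longrightarrow> y = x"
      and x: "x \<in> tri i j b" "\<alpha> * sc x + \<beta> * tc x = c" for x \<alpha> \<beta> c
  proof -
    define g where "g = (\<alpha> / h) *\<^sub>R f1 + (\<beta> / h) *\<^sub>R f2"
    define d where "d = inner g org"
    have g: "inner g y = \<alpha> * sc y + \<beta> * tc y + d" for y
      by (simp add: g_def d_def sc_def tc_def inner_add_left inner_diff_right divide_inverse algebra_simps)
    have "tri i j b \<inter> {y. inner g y = c + d} face_of tri i j b"
      by (rule face_of_Int_supporting_hyperplane_ge[OF convex_tri]) (use ge in \<open>simp add: g\<close>)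
    also have "tri i j b \<inter> {y. inner g y = c + d} = {x}"
    proof -
      have "inner g y = c + d \<longleftrightarrow> \<alpha> * sc y + \<beta> * tc y = c" for y
        by (simp add: g)
      then show ?thesis
        using eq x by blast
    qed
    finally show ?thesis by (simp only: face_of_singleton)
  qed
  assume "x \<in> node ` verts i j b"
  then consider "b" "x = node (i + 1, j)" | "b" "x = node (i, j + 1)" | "b" "x = node (i + 1, j + 1)"
    | "\<not> b" "x = node (i, j)" | "\<not> b" "x = node (i + 1, j)" | "\<not> b" "x = node (i, j + 1)"
    by (auto simp: verts_def split: if_splits)
  then show "x extreme_point_of tri i j b"
  proof cases
    case 1 then show ?thesis by (intro *[of j 0 1]) (auto simp: tri_def point_eq_iff)
  next
    case 2 then show ?thesis by (intro *[of i 1 0]) (auto simp: tri_def point_eq_iff)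
  next
    case 3 then show ?thesis by (intro *[of "-(i + j + 2)" "-1" "-1"]) (auto simp: tri_def point_eq_iff)
  next
    case 4 then show ?thesis by (intro *[of "i + j" 1 1]) (auto simp: tri_def point_eq_iff)
  next
    case 5 then show ?thesis by (intro *[of "-(i + 1)" "-1" 0]) (auto simp: tri_def point_eq_iff)
  next
    case 6 then show ?thesis by (intro *[of "-(j + 1)" 0 "-1"]) (auto simp: tri_def point_eq_iff)
  qed
qed

lemma node_in_tri: "node k \<in> tri i j b \<Longrightarrow> k \<in> verts i j b"
  by (cases k; cases b) (simp add: tri_def verts_def; linarith)+

end

section \<open>Lebesgue integrals up to null sets and under point reflection\<close>

lemma lebesgue_measurable_cong_AE:
  fixes f g :: "'a::euclidean_space \<Rightarrow> 'b::topological_space"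
  assumes g: "g \<in> borel_measurable lebesgue" and ae: "AE x in lebesgue. f x = g x"
  shows "f \<in> borel_measurable lebesgue"
proof (rule measurableI)
  fix S :: "'b set" assume S: "S \<in> sets borel"
  show "f -` S \<inter> space lebesgue \<in> sets lebesgue"
  proof (rule completion.in_sets_AE)
    show "g -` S \<inter> space lebesgue \<in> sets lebesgue"
      using g S by (rule measurable_sets)
    show "AE x in lebesgue. x \<in> g -` S \<inter> space lebesgue \<longleftrightarrow> x \<in> f -` S \<inter> space lebesgue"
      using ae by eventually_elim auto
  qed auto
qed auto

text \<open>Measurability is demanded of \<open>g\<close> only: integrands containing
  \<open>grad\<close> are unspecified on the edges, and completeness of Lebesgue measure transfers
  measurability to them.\<close>

lemma lebesgue_integral_cong_AE:
  fixes f :: "'a::euclidean_space \<Rightarrow> real"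
  assumes g: "g \<in> borel_measurable lebesgue" and ae: "AE x in lebesgue. f x = g x"
  shows "integral\<^sup>L lebesgue f = integral\<^sup>L lebesgue g"
  using lebesgue_measurable_cong_AE[OF assms] g ae by (rule integral_cong_AE)

lemma lebesgue_reflect:
  fixes c :: "'a::euclidean_space"
  shows "distr lebesgue lebesgue (\<lambda>x. c - x) = lebesgue" "(\<lambda>x. c - x) \<in> lebesgue \<rightarrow>\<^sub>M lebesgue"
proof -
  have *: "(\<lambda>x::'a. c + (\<Sum>j\<in>Basis. (- 1 * (x \<bullet> j)) *\<^sub>R j)) = (\<lambda>x. c - x)"
    by (simp add: sum_negf euclidean_representation)
  show "distr lebesgue lebesgue (\<lambda>x. c - x) = lebesgue"
    using lebesgue_affine_euclidean[of "\<lambda>_::'a. -1" c] unfolding * by (simp add: density_1)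
  show "(\<lambda>x. c - x) \<in> lebesgue \<rightarrow>\<^sub>M lebesgue"
    using lebesgue_affine_measurable[of "\<lambda>_::'a. -1" c] unfolding * by simp
qed

lemma lebesgue_integral_reflect:
  fixes f :: "'a::euclidean_space \<Rightarrow> real"
  assumes f: "f \<in> borel_measurable lebesgue"
  shows "integral\<^sup>L lebesgue (\<lambda>x. f (c - x)) = integral\<^sup>L lebesgue f"
  using integral_distr[OF lebesgue_reflect(2)[of c] f] by (simp add: lebesgue_reflect(1))

section \<open>Gradients of hat functions and cells of the lattice\<close>

context affine_lattice
begin

text \<open>\<open>D1\<close> and \<open>D2\<close> are differences along the two edges that meet at
  the corner (i, j) of a lower cell, or (i + 1, j + 1) of an upper one: the slopes, in lattice
  coordinates, of the affine interpolant of \<open>X\<close>.\<close>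

definition D1 :: "(int \<times> int \<Rightarrow> real) \<Rightarrow> int \<times> int \<times> bool \<Rightarrow> real" where
  "D1 X = (\<lambda>(i, j, b). if b then X (i + 1, j + 1) - X (i, j + 1) else X (i + 1, j) - X (i, j))"

definition D2 :: "(int \<times> int \<Rightarrow> real) \<Rightarrow> int \<times> int \<times> bool \<Rightarrow> real" where
  "D2 X = (\<lambda>(i, j, b). if b then X (i + 1, j + 1) - X (i + 1, j) else X (i, j + 1) - X (i, j))"

text \<open>The constant gradient on a cell of the piecewise affine interpolant of
  \<open>X\<close>.\<close>

definition cgrad :: "(int \<times> int \<Rightarrow> real) \<Rightarrow> int \<times> int \<times> bool \<Rightarrow> point" where
  "cgrad X c = (1 / h) *\<^sub>R (D1 X c *\<^sub>R f1 + D2 X c *\<^sub>R f2)"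

definition ocell :: "int \<times> int \<times> bool \<Rightarrow> point set" where
  "ocell = (\<lambda>(i, j, b). otri i j b)"

abbreviation dlt :: "int \<times> int \<Rightarrow> int \<times> int \<Rightarrow> real" where
  "dlt k l \<equiv> of_bool (l = k)"

lemma phi_nonneg: "0 \<le> phi k x"
  unfolding phi_def by (rule max.cobounded1)

lemma phi_eq_0:
  assumes "1 \<le> \<bar>sc x - real_of_int (fst k)\<bar> \<or> 1 \<le> \<bar>tc x - real_of_int (snd k)\<bar> \<or>
    1 \<le> \<bar>sc x - real_of_int (fst k) + (tc x - real_of_int (snd k))\<bar>"
  shows "phi k x = 0"
  unfolding phi_def by (rule max_absorb1) (use assms in \<open>simp add: le_max_iff_disj\<close>)

lemma phi_node: "phi k (node l) = dlt k l"
proof (cases "l = k")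
  case False
  then have "1 \<le> \<bar>fst l - fst k\<bar> \<or> 1 \<le> \<bar>snd l - snd k\<bar>" by (auto simp: prod_eq_iff)
  then have "1 \<le> \<bar>real_of_int (fst l) - fst k\<bar> \<or> 1 \<le> \<bar>real_of_int (snd l) - snd k\<bar>" by linarith
  then show ?thesis using False by (subst phi_eq_0) auto
qed (simp add: phi_def)

lemma continuous_phi: "continuous_on A (phi k)"
  unfolding phi_def[abs_def] by (intro continuous_intros)

lemma phi_off:
  assumes x: "x \<in> tri i j b" and k: "k \<notin> verts i j b"
  shows "phi k x = 0"
proof -
  obtain p q where kp: "k = (p, q)" by fastforce
  \<comment> \<open>Either \<open>k\<close> differs by at least one, in one coordinate, from every
    point of the parallelogram, or it is the corner cut off by the diagonal. The latter case is
    where the |s + t| term of \<open>phi\<close> acts.\<close>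
  have *: "i - p \<ge> 1 \<or> i - p \<le> - 2 \<or> j - q \<ge> 1 \<or> j - q \<le> - 2 \<or> (b \<and> i = p \<and> j = q) \<or> (\<not> b \<and> i = p - 1 \<and> j = q - 1)"
    using k unfolding kp by (cases b; simp add: verts_def; presburger)
  have s: "real_of_int i \<le> sc x" "sc x \<le> i + 1" "real_of_int j \<le> tc x" "tc x \<le> j + 1"
    using x by (auto simp: tri_def split: if_splits)
  have "1 \<le> \<bar>sc x - p\<bar> \<or> 1 \<le> \<bar>tc x - q\<bar> \<or> 1 \<le> \<bar>sc x - p + (tc x - q)\<bar>"
    using * 
  proof (elim disjE)
    assume "b \<and> i = p \<and> j = q" then show ?thesis using x by (auto simp: tri_def)
  next
    assume "\<not> b \<and> i = p - 1 \<and> j = q - 1" then show ?thesis using x by (auto simp: tri_def)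
  qed (use s in linarith)+
  then show ?thesis unfolding kp by (intro phi_eq_0) simp
qed

text \<open>The affine interpolant of the nodal values, expanded at the corner where the two
  coordinate edges of the cell meet.\<close>

lemma phi_tri:
  assumes x: "x \<in> tri i j b"
  shows "phi k x = dlt k (i + of_bool b, j + of_bool b) + D1 (dlt k) (i, j, b) * (sc x - (i + of_bool b))
     + D2 (dlt k) (i, j, b) * (tc x - (j + of_bool b))"
proof (cases "k \<in> verts i j b")
  case False
  then show ?thesis
    using phi_off[OF x False] by (cases b) (auto simp: D1_def D2_def verts_def)
next
  case True
  \<comment> \<open>On a triangle with vertex \<open>k\<close>, the same one of the three absolute
    values is the largest throughout, which is why \<open>phi\<close> is affine there.\<close>
  have max_abs: "max 0 (1 - max \<bar>u\<bar> (max \<bar>v\<bar> \<bar>u + v\<bar>)) = w"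
    if "0 \<le> w" "\<bar>u\<bar> \<le> 1 - w" "\<bar>v\<bar> \<le> 1 - w" "\<bar>u + v\<bar> \<le> 1 - w"
      "\<bar>u\<bar> = 1 - w \<or> \<bar>v\<bar> = 1 - w \<or> \<bar>u + v\<bar> = 1 - w" for u v w :: real
  proof -
    have "max \<bar>u\<bar> (max \<bar>v\<bar> \<bar>u + v\<bar>) \<le> 1 - w" using that(2-4) by (intro max.boundedI)
    moreover have "1 - w \<le> max \<bar>u\<bar> (max \<bar>v\<bar> \<bar>u + v\<bar>)" using that(5) unfolding le_max_iff_disj by argo
    ultimately have max: "max \<bar>u\<bar> (max \<bar>v\<bar> \<bar>u + v\<bar>) = 1 - w" by (rule antisym)
    show ?thesis unfolding max using that(1) by simp
  qed
  from True consider "b" "k = (i + 1, j)" | "b" "k = (i, j + 1)" | "b" "k = (i + 1, j + 1)"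
    | "\<not> b" "k = (i, j)" | "\<not> b" "k = (i + 1, j)" | "\<not> b" "k = (i, j + 1)"
    by (auto simp: verts_def split: if_splits)
  then show ?thesis
    unfolding phi_def
    by cases (rule max_abs; use x in \<open>simp add: D1_def D2_def tri_def\<close>; linarith)+
qed

text \<open>With the support condition on a mesh, this shows that a cell outside the domain has no
  internal node as a vertex.\<close>

lemma phi_pos_otri:
  assumes x: "x \<in> otri i j b" and k: "k \<in> verts i j b"
  shows "0 < phi k x"
  using phi_tri[of x i j b k] x k otri_subset_tri[of i j b]
  by (cases b) (auto simp: D1_def D2_def verts_def otri_def tri_def)

lemma gderiv_phi:
  assumes x: "x \<in> ocell c"
  shows "GDERIV (phi k) x :> cgrad (dlt k) c"
proof -
  obtain i j b where c: "c = (i, j, b)" by (cases c)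
  have o: "x \<in> otri i j b" using x by (simp add: c ocell_def)
  let ?A = "\<lambda>x. dlt k (i + of_bool b, j + of_bool b) + D1 (dlt k) c * (sc x - (i + of_bool b))
     + D2 (dlt k) c * (tc x - (j + of_bool b))"
  have "(?A has_derivative (\<lambda>v. inner v (cgrad (dlt k) c))) (at x)"
    unfolding sc_eq tc_eq
    by (auto intro!: derivative_eq_intros simp: cgrad_def inner_add_right inner_commute divide_inverse algebra_simps)
  then have "(phi k has_derivative (\<lambda>v. inner v (cgrad (dlt k) c))) (at x)"
  proof (rule has_derivative_transform_within_open[OF _ open_otri o])
    fix y assume "y \<in> otri i j b"
    then have "y \<in> tri i j b" using otri_subset_tri by blast
    then show "?A y = phi k y" unfolding c by (rule phi_tri[symmetric])
  qed
  then show ?thesis by (simp add: gderiv_def)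
qed

lemma grad_phi:
  assumes x: "x \<in> ocell c"
  shows "grad (phi k) x = cgrad (dlt k) c"
  unfolding grad_def
proof (rule the_equality)
  show "GDERIV (phi k) x :> cgrad (dlt k) c" using gderiv_phi[OF x] .
  fix D assume "GDERIV (phi k) x :> D"
  then have "(\<lambda>v. inner v D) = (\<lambda>v. inner v (cgrad (dlt k) c))"
    using gderiv_phi[OF x] unfolding gderiv_def by (rule has_derivative_unique)
  then show "D = cgrad (dlt k) c"
    unfolding fun_eq_iff vector_eq_ldot .
qed

text \<open>The exceptional points lie on countably many lines, on which \<open>sc\<close>,
  \<open>tc\<close> or their sum is an integer.\<close>

lemma AE_ocell: "AE x in lebesgue. \<exists>c. x \<in> ocell c"
proof -
  have ne: "f1 \<noteq> 0" "f2 \<noteq> 0" "f1 + f2 \<noteq> 0"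
  proof -
    show "f1 \<noteq> 0" using dual by auto
    show "f2 \<noteq> 0" using dual by auto
    have "inner (f1 + f2) e1 \<noteq> 0" using dual by (simp add: inner_add_left)
    then show "f1 + f2 \<noteq> 0" by (metis inner_zero_left)
  qed
  have AEh: "AE x in lebesgue. inner f (x - org) / h \<noteq> of_int n" if "f \<noteq> 0" for f :: point and n :: int
  proof -
    have "negligible {x. inner f x = of_int n * h + inner f org}"
      using that by (intro negligible_hyperplane) auto
    then have "{x. inner f x = of_int n * h + inner f org} \<in> null_sets lebesgue"
      by (simp add: negligible_iff_null_sets)
    then show ?thesis
      by (rule AE_I') (use h in \<open>auto simp: inner_diff_right field_simps\<close>)
  qed
  have sum: "inner (f1 + f2) (x - org) / h = sc x + tc x" for x
    by (simp add: sc_def tc_def inner_add_left add_divide_distrib)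
  have "AE x in lebesgue. \<forall>n::int. sc x \<noteq> n" "AE x in lebesgue. \<forall>n::int. tc x \<noteq> n"
    "AE x in lebesgue. \<forall>n::int. sc x + tc x \<noteq> n"
    using AEh ne by (auto simp: AE_all_countable sc_def tc_def sum[unfolded sc_def tc_def, symmetric])
  then show ?thesis
  proof eventually_elim
    case (elim x)
    define i j where "i = \<lfloor>sc x\<rfloor>" and "j = \<lfloor>tc x\<rfloor>"
    have "i \<le> sc x" "sc x < i + 1" "j \<le> tc x" "tc x < j + 1" by (simp_all add: i_def j_def)
    moreover have "sc x \<noteq> i" "tc x \<noteq> j" "sc x + tc x \<noteq> real_of_int (i + j + 1)"
      using elim by blast+
    ultimately have "x \<in> otri i j (i + j + 1 < sc x + tc x)"
      by (auto simp: otri_def)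
    then show ?case by (intro exI[of _ "(i, j, i + j + 1 < sc x + tc x)"]) (simp add: ocell_def)
  qed
qed

lemma ocell_disjoint: "x \<in> ocell c \<Longrightarrow> x \<in> ocell d \<Longrightarrow> c = d"
proof -
  assume x: "x \<in> ocell c" "x \<in> ocell d"
  obtain i j b i' j' b' where cd: "c = (i, j, b)" "d = (i', j', b')" by (metis prod_cases3)
  have *: "i < sc x \<and> sc x < i + 1 \<and> j < tc x \<and> tc x < j + 1 \<and> (if b then i + j + 1 < sc x + tc x else sc x + tc x < i + j + 1)"
    if "x \<in> ocell (i, j, b)" for i j b
    using that by (cases b) (auto simp: ocell_def otri_def)
  have ij: "i = i'" "j = j'"
    using *[OF x(1)[unfolded cd]] *[OF x(2)[unfolded cd]] by linarith+
  then show "c = d"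
    using *[OF x(1)[unfolded cd]] *[OF x(2)[unfolded cd]] unfolding cd ij by (cases b; cases b'; simp)
qed

lemma sum_indicator_ocell:
  assumes "finite C" "x \<in> ocell c"
  shows "(\<Sum>d\<in>C. indicator (ocell d) x *\<^sub>R F d) = (if c \<in> C then F c else (0 :: 'b :: real_vector))"
proof -
  have "(\<Sum>d\<in>C. indicator (ocell d) x *\<^sub>R F d) = (\<Sum>d\<in>C. if d = c then F c else 0)"
  proof (intro sum.cong refl)
    fix d
    show "indicator (ocell d) x *\<^sub>R F d = (if d = c then F c else 0)"
      using assms(2) ocell_disjoint[OF assms(2), of d] by (cases "x \<in> ocell d") auto
  qed
  also have "\<dots> = (if c \<in> C then F c else 0)" using assms by simp
  finally show ?thesis .
qed

lemma cgrad_dlt_off: "k \<notin> verts i j b \<Longrightarrow> cgrad (dlt k) (i, j, b) = 0"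
  by (cases b) (auto simp: cgrad_def D1_def D2_def verts_def)

text \<open>Area of the triangle spanned by \<open>e1\<close> and \<open>e2\<close>. It is a common
  positive factor of all bounds and cancels in the condition number, so it stays
  unevaluated.\<close>

definition cell_area :: real where
  "cell_area = measure lebesgue {x. 0 < inner f1 x \<and> 0 < inner f2 x \<and> inner f1 x + inner f2 x < 1}"

lemma measure_ocell: "measure lebesgue (ocell c) = h\<^sup>2 * cell_area"
proof -
  obtain i j b where c: "c = (i, j, b)" by (cases c)
  let ?S = "{x. 0 < inner f1 x \<and> 0 < inner f2 x \<and> inner f1 x + inner f2 x < 1}"
  \<comment> \<open>A lower cell is the reference triangle scaled by \<open>h\<close>; an upper cell
    is a point reflection of such a copy, hence the factor \<open>- h\<close>.\<close>
  have im: "ocell c = (\<lambda>x. m *\<^sub>R x + d) ` ?S"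
    if m: "m = (if b then - h else h)" and d: "d = (if b then node (i + 1, j + 1) else node (i, j))" for m d
  proof -
    have m0: "m \<noteq> 0" using h m by auto
    have sct: "sc (m *\<^sub>R y + d) = (m / h) * inner f1 y + sc d" "tc (m *\<^sub>R y + d) = (m / h) * inner f2 y + tc d" for y
      by (simp_all add: sc_def tc_def inner_add_right inner_diff_right add_divide_distrib diff_divide_distrib)
    have *: "m / h = (if b then - 1 else 1)" "sc d = (if b then i + 1 else i)" "tc d = (if b then j + 1 else j)"
      using h by (simp_all add: m d)
    have "m *\<^sub>R y + d \<in> ocell (i, j, b) \<longleftrightarrow> y \<in> ?S" for y
      unfolding ocell_def otri_def prod.case if_distrib[of "(\<in>) _"] mem_Collect_eq sct *
      by (cases b) auto
    then have iff: "m *\<^sub>R y + d \<in> ocell c \<longleftrightarrow> y \<in> ?S" for y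
      by (simp add: c)
    have "x \<in> (\<lambda>x. m *\<^sub>R x + d) ` ?S" if "x \<in> ocell c" for x
    proof -
      define y where "y = (1 / m) *\<^sub>R (x - d)"
      have xy: "x = m *\<^sub>R y + d" using m0 by (simp add: y_def)
      have "y \<in> ?S" using that unfolding xy iff .
      then show ?thesis unfolding xy by (rule imageI)
    qed
    then show ?thesis using iff by blast
  qed
  show ?thesis
    unfolding im[OF refl refl] measure_lebesgue_affine cell_area_def by simp
qed

lemma open_ocell: "open (ocell c)"
  by (cases c) (simp add: ocell_def open_otri)

lemma lmeasurable_ocell: "ocell c \<in> lmeasurable"
proof (rule lmeasurable_open[OF _ open_ocell])
  obtain i j b where c: "c = (i, j, b)" by (cases c)
  have "finite (node ` verts i j b)" by (simp add: verts_def)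
  then have "bounded (tri i j b)"
    unfolding tri_eq_hull by (simp add: bounded_convex_hull finite_imp_bounded)
  then show "bounded (ocell c)"
    using bounded_subset[OF _ otri_subset_tri] by (simp add: c ocell_def)
qed

lemma cell_area_pos: "0 < cell_area"
proof -
  have "ocell (0, 0, False) \<noteq> {}"
    using tri_centre[of False 0 0] by (auto simp: ocell_def)
  then have "\<not> negligible (ocell (0, 0, False))"
    using open_ocell open_not_negligible by blast
  then have "measure lebesgue (ocell (0, 0, False)) \<noteq> 0"
    using lmeasurable_ocell by (metis negligible_iff_measure)
  then show ?thesis
    unfolding measure_ocell using h by (simp add: order_less_le cell_area_def)
qed

end

section \<open>Finite elements on parts of the lattice\<close>

text \<open>What the estimates use about a domain. By \<open>star\<close>, hat functions of internal
  nodes vanish outside it, so integrals over the domain become integrals over the plane;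
  \<open>N\<close> measures its extent in mesh steps.\<close>

locale lattice_mesh = affine_lattice org e1 e2 f1 f2 h for org e1 e2 f1 f2 :: point and h :: real +
  fixes \<Omega> :: "point set" and T :: mesh and N :: nat
  assumes cells: "K \<in> T \<Longrightarrow> \<exists>i j b. K = tri i j b"
    and cover: "\<Omega> \<subseteq> \<Union>T"
    and star: "node k \<in> \<Omega> \<Longrightarrow> 0 < phi k x \<Longrightarrow> x \<in> \<Omega>"
    and bound: "node k \<in> \<Omega> \<Longrightarrow> \<bar>fst k\<bar> < int N \<and> \<bar>snd k\<bar> < int N"
begin

definition J :: "(int \<times> int) set" where "J = {k. node k \<in> \<Omega>}"

lemma J_subset: "J \<subseteq> {- int N<..<int N} \<times> {- int N<..<int N}"
  using bound unfolding J_def by fastforce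

lemma finite_J: "finite J"
  by (rule finite_subset[OF J_subset]) auto

lemma internal_nodes_eq: "internal_nodes \<Omega> T = node ` J"
proof (intro Set.set_eqI iffI)
  fix v assume "v \<in> internal_nodes \<Omega> T"
  then obtain K where "v \<in> \<Omega>" "K \<in> T" "v extreme_point_of K" by (auto simp: internal_nodes_def)
  then show "v \<in> node ` J"
    using cells[of K] by (auto simp: extreme_point_of_tri J_def)
next
  fix v assume "v \<in> node ` J"
  then obtain k where k: "v = node k" "node k \<in> \<Omega>" by (auto simp: J_def)
  then obtain K where K: "K \<in> T" "node k \<in> K" using cover by blast
  then obtain i j b where "K = tri i j b" using cells by blast
  then have "node k extreme_point_of K"
    using K(2) node_in_tri[of k i j b] by (simp add: extreme_point_of_tri)
  then show "v \<in> internal_nodes \<Omega> T"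
    using k K by (auto simp: internal_nodes_def)
qed

lemma phi_outside: "k \<in> J \<Longrightarrow> x \<notin> \<Omega> \<Longrightarrow> phi k x = 0"
  using star[of k x] phi_nonneg[of k x] unfolding J_def mem_Collect_eq by linarith

lemma phi_fe_space:
  assumes k: "k \<in> J"
  shows "phi k \<in> fe_space \<Omega> T"
proof -
  have "\<exists>g b. \<forall>x\<in>K. phi k x = inner g x + b" if KT: "K \<in> T" for K
  proof -
    obtain i j b where K: "K = tri i j b" using cells[OF KT] by blast
    let ?c = "(i, j, b)"
    let ?g = "D1 (dlt k) ?c *\<^sub>R (f1 /\<^sub>R h) + D2 (dlt k) ?c *\<^sub>R (f2 /\<^sub>R h)"
    let ?b = "dlt k (i + of_bool b, j + of_bool b) - D1 (dlt k) ?c * (inner f1 org / h + (i + of_bool b))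
       - D2 (dlt k) ?c * (inner f2 org / h + (j + of_bool b))"
    have "phi k x = inner ?g x + ?b" if "x \<in> K" for x
      unfolding phi_tri[OF that[unfolded K]] sc_eq tc_eq
      by (simp add: inner_add_left algebra_simps)
    then show ?thesis by blast
  qed
  then show ?thesis
    using k continuous_phi phi_outside by (auto simp: fe_space_def)
qed

text \<open>Affine functions that agree at the vertices of a triangle agree on it. At nodes outside
  the domain both functions are zero by the definition of the space, so comparing internal nodes is
  enough.\<close>

lemma fe_space_unique:
  assumes u: "u \<in> fe_space \<Omega> T" and v: "v \<in> fe_space \<Omega> T"
    and eq: "\<And>k. k \<in> J \<Longrightarrow> u (node k) = v (node k)"
  shows "u = v"
proof
  fix x
  show "u x = v x"
  proof (cases "x \<in> \<Omega>")
    case False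
    then show ?thesis using u v by (simp add: fe_space_def)
  next
    case True
    then obtain K where K: "K \<in> T" "x \<in> K" using cover by blast
    then obtain i j b where Kt: "K = tri i j b" using cells by blast
    obtain g c where gc: "\<forall>x\<in>K. u x = inner g x + c" using u K(1) unfolding fe_space_def by blast
    obtain g' c' where gc': "\<forall>x\<in>K. v x = inner g' x + c'" using v K(1) unfolding fe_space_def by blast
    have nodes: "u (node k) = v (node k)" for k
      using eq[of k] u v by (cases "k \<in> J") (auto simp: J_def fe_space_def)
    have "node ` verts i j b \<subseteq> K" unfolding Kt tri_eq_hull by (rule hull_subset)
    then have "node ` verts i j b \<subseteq> {y. inner (g - g') y = c' - c}"
      using nodes gc gc' by (force simp: inner_diff_left)
    then have "convex hull (node ` verts i j b) \<subseteq> {y. inner (g - g') y = c' - c}"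
      using convex_hyperplane by (rule hull_minimal)
    then have "inner (g - g') x = c' - c"
      using K unfolding Kt tri_eq_hull by blast
    then show ?thesis
      using gc gc' K by (simp add: inner_diff_left)
  qed
qed

lemma hat_eq:
  assumes k: "k \<in> J"
  shows "hat \<Omega> T (node k) = phi k"
  unfolding hat_def
proof (rule the_equality)
  show "phi k \<in> fe_space \<Omega> T \<and> phi k (node k) = 1 \<and> (\<forall>q\<in>internal_nodes \<Omega> T. q \<noteq> node k \<longrightarrow> phi k q = 0)"
    using phi_fe_space[OF k] by (auto simp: phi_node internal_nodes_eq)
  fix u assume u: "u \<in> fe_space \<Omega> T \<and> u (node k) = 1 \<and> (\<forall>q\<in>internal_nodes \<Omega> T. q \<noteq> node k \<longrightarrow> u q = 0)"
  show "u = phi k"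
    by (rule fe_space_unique) (use u phi_fe_space[OF k] in \<open>auto simp: phi_node internal_nodes_eq\<close>)
qed

text \<open>Internal nodes have coordinates strictly between -N and N. The closed range adds a layer
  of zeros on each side, so that \<open>cellbox\<close> contains every cell touching an internal
  node.\<close>

definition ibox :: "(int \<times> int) set" where "ibox = {- int N..int N} \<times> {- int N..int N}"

definition cellbox :: "(int \<times> int \<times> bool) set" where
  "cellbox = {- int N..int N} \<times> {- int N..int N} \<times> UNIV"

lemma finite_ibox: "finite ibox" and finite_cellbox: "finite cellbox"
  by (auto simp: ibox_def cellbox_def)

lemma sum_cellbox: "(\<Sum>c\<in>cellbox. F c) = (\<Sum>(i, j)\<in>ibox. F (i, j, False) + F (i, j, True) :: real)"
  unfolding cellbox_def ibox_def sum.cartesian_product' by (simp add: UNIV_bool)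

lemma cgrad_off_cellbox:
  assumes "k \<in> J" "c \<notin> cellbox"
  shows "cgrad (dlt k) c = 0"
proof -
  obtain i j b where c: "c = (i, j, b)" by (cases c)
  have "k \<notin> verts i j b"
    using assms J_subset by (auto simp: c verts_def cellbox_def split: if_splits)
  then show ?thesis unfolding c by (rule cgrad_dlt_off)
qed

lemma grad_phi_sum:
  assumes k: "k \<in> J" and x: "x \<in> ocell c"
  shows "grad (phi k) x = (\<Sum>d\<in>cellbox. indicator (ocell d) x *\<^sub>R cgrad (dlt k) d)"
  using cgrad_off_cellbox[OF k] by (simp add: sum_indicator_ocell[OF finite_cellbox x] grad_phi[OF x])

lemma borel_measurable_ocell_sum:
  "(\<lambda>x. \<Sum>d\<in>cellbox. indicator (ocell d) x *\<^sub>R (F d :: real)) \<in> borel_measurable lebesgue"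
  using lmeasurable_ocell by (intro borel_measurable_sum borel_measurable_scaleR borel_measurable_indicator) (auto simp: fmeasurable_def)

lemma theta_integral:
  assumes k: "k \<in> J" and l: "l \<in> J"
  shows "set_lebesgue_integral lebesgue \<Omega> (\<lambda>x. a * inner (grad (phi l) x) (grad (phi k) x)) =
    a * (h\<^sup>2 * cell_area * (\<Sum>c\<in>cellbox. inner (cgrad (dlt l) c) (cgrad (dlt k) c)))"
proof -
  let ?F = "\<lambda>c. a * inner (cgrad (dlt l) c) (cgrad (dlt k) c)"
  have "set_lebesgue_integral lebesgue \<Omega> (\<lambda>x. a * inner (grad (phi l) x) (grad (phi k) x)) =
    (\<integral>x. (\<Sum>c\<in>cellbox. indicator (ocell c) x *\<^sub>R ?F c) \<partial>lebesgue)"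
    unfolding set_lebesgue_integral_def
  proof (rule lebesgue_integral_cong_AE[OF borel_measurable_ocell_sum])
    show "AE x in lebesgue. indicator \<Omega> x *\<^sub>R (a * inner (grad (phi l) x) (grad (phi k) x)) =
      (\<Sum>c\<in>cellbox. indicator (ocell c) x *\<^sub>R ?F c)"
      using AE_ocell
    proof eventually_elim
      case (elim x)
      then obtain c where x: "x \<in> ocell c" by blast
      obtain i j b where c: "c = (i, j, b)" by (cases c)
      \<comment> \<open>The sum also runs over cells outside the domain, where the gradient of an
        internal hat function is zero.\<close>
      have "cgrad (dlt k) c = 0" if "x \<notin> \<Omega>"
      proof -
        have "\<not> 0 < phi k x" using star[of k x] k that by (auto simp: J_def)
        then have "k \<notin> verts i j b" using phi_pos_otri[of x i j b k] x by (auto simp: c ocell_def)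
        then show ?thesis unfolding c by (rule cgrad_dlt_off)
      qed
      then show ?case
        unfolding sum_indicator_ocell[OF finite_cellbox x, of ?F] grad_phi[OF x]
        using cgrad_off_cellbox[OF k, of c] by (cases "x \<in> \<Omega>") auto
    qed
  qed
  also have "\<dots> = (\<Sum>c\<in>cellbox. measure lebesgue (ocell c) * ?F c)"
  proof (subst Bochner_Integration.integral_sum)
    fix c
    have "integrable lebesgue (indicator (ocell c) :: point \<Rightarrow> real)"
      using lmeasurable_ocell[of c] by (intro integrable_real_indicator) (auto simp: fmeasurable_def)
    then show "integrable lebesgue (\<lambda>x. indicator (ocell c) x *\<^sub>R ?F c)"
      by simp
  next
    show "(\<Sum>c\<in>cellbox. \<integral>x. indicator (ocell c) x *\<^sub>R ?F c \<partial>lebesgue) = (\<Sum>c\<in>cellbox. measure lebesgue (ocell c) * ?F c)"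
      using lmeasurable_ocell by (intro sum.cong) (auto simp: fmeasurable_def)
  qed
  also have "\<dots> = a * (h\<^sup>2 * cell_area * (\<Sum>c\<in>cellbox. inner (cgrad (dlt l) c) (cgrad (dlt k) c)))"
    by (simp add: measure_ocell sum_distrib_left mult_ac)
  finally show ?thesis .
qed

definition conv :: "point \<Rightarrow> int \<times> int \<Rightarrow> int \<times> int \<Rightarrow> real" where
  "conv \<beta> k l = integral\<^sup>L lebesgue (\<lambda>x. inner \<beta> (grad (phi k) x) * phi l x)"

lemma psi_integral:
  assumes l: "l \<in> J"
  shows "set_lebesgue_integral lebesgue \<Omega> (\<lambda>x. inner \<beta> (grad (phi k) x) * phi l x) = conv \<beta> k l"
  unfolding set_lebesgue_integral_def conv_def
  using phi_outside[OF l] by (intro Bochner_Integration.integral_cong) (auto simp: indicator_def)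

text \<open>The point reflection exchanging the nodes \<open>k\<close> and \<open>l\<close> exchanges the two (even) hat functions
  and reverses gradients.\<close>

lemma conv_skew:
  assumes k: "k \<in> J" and l: "l \<in> J"
  shows "conv \<beta> k l = - conv \<beta> l k"
proof -
  let ?f = "\<lambda>k l x. inner \<beta> (grad (phi k) x) * phi l x"
  \<comment> \<open>The reflection formula needs a measurable integrand; off the edges,
    \<open>grad\<close> is a finite combination of cell indicators.\<close>
  have meas: "?f k l \<in> borel_measurable lebesgue" if "k \<in> J" for k l
  proof (rule lebesgue_measurable_cong_AE)
    have "phi l \<in> borel_measurable lebesgue"
      using borel_measurable_continuous_onI[OF continuous_phi, of l] by (intro measurable_completion) simp
    then show "(\<lambda>x. (\<Sum>d\<in>cellbox. indicator (ocell d) x *\<^sub>R inner \<beta> (cgrad (dlt k) d)) * phi l x) \<in> borel_measurable lebesgue"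
      using borel_measurable_ocell_sum by (rule borel_measurable_times[rotated])
    show "AE x in lebesgue. ?f k l x = (\<Sum>d\<in>cellbox. indicator (ocell d) x *\<^sub>R inner \<beta> (cgrad (dlt k) d)) * phi l x"
      using AE_ocell
    proof eventually_elim
      case (elim x)
      then obtain c where "x \<in> ocell c" by blast
      then show ?case by (simp add: grad_phi_sum[OF that] inner_sum_right)
    qed
  qed
  define s where "s = node k + node l"
  have sc: "sc (s - x) = fst k + fst l - sc x" and tc: "tc (s - x) = snd k + snd l - tc x" for x
  proof -
    have "s - x - org = (node k - org) + (node l - org) - (x - org)" by (simp add: s_def)
    then have "sc (s - x) = sc (node k) + sc (node l) - sc x" "tc (s - x) = tc (node k) + tc (node l) - tc x"
      unfolding sc_def tc_def by (simp_all add: inner_add_right inner_diff_right add_divide_distrib diff_divide_distrib)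
    then show "sc (s - x) = fst k + fst l - sc x" "tc (s - x) = snd k + snd l - tc x" by simp_all
  qed
  have refl_phi: "phi l (s - x) = phi k x" for x
  proof -
    have "sc (s - x) - fst l = - (sc x - fst k)" "tc (s - x) - snd l = - (tc x - snd k)"
      by (simp_all add: sc tc)
    then show ?thesis
      unfolding phi_def by (simp only: abs_minus_cancel flip: minus_add_distrib) 
  qed
  \<comment> \<open>Reflection exchanges lower and upper triangles, hence the negated flag, and
    turns a left end into a right end, hence the shift by one.\<close>
  have refl_cell: "s - x \<in> ocell (fst k + fst l - i - 1, snd k + snd l - j - 1, \<not> b)" if "x \<in> ocell (i, j, b)" for x i j b
    using that by (cases b) (auto simp: ocell_def otri_def sc tc)
  have refl_grad: "cgrad (dlt k) (fst k + fst l - i - 1, snd k + snd l - j - 1, \<not> b) = - cgrad (dlt l) (i, j, b)" for i j b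
  proof -
    have D: "D1 (dlt k) (fst k + fst l - i - 1, snd k + snd l - j - 1, \<not> b) = - D1 (dlt l) (i, j, b)"
      "D2 (dlt k) (fst k + fst l - i - 1, snd k + snd l - j - 1, \<not> b) = - D2 (dlt l) (i, j, b)"
      by (auto simp: D1_def D2_def of_bool_def prod_eq_iff)
    show ?thesis unfolding cgrad_def D by (simp add: scaleR_add_right scaleR_diff_right)
  qed
  have "conv \<beta> k l = integral\<^sup>L lebesgue (\<lambda>x. ?f k l (s - x))"
    unfolding conv_def using lebesgue_integral_reflect[OF meas[OF k, of l], of s] by simp
  also have "\<dots> = integral\<^sup>L lebesgue (\<lambda>x. - ?f l k x)"
  proof (rule lebesgue_integral_cong_AE)
    show "(\<lambda>x. - ?f l k x) \<in> borel_measurable lebesgue"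
      using meas[OF l] by simp
    show "AE x in lebesgue. ?f k l (s - x) = - ?f l k x"
      using AE_ocell
    proof eventually_elim
      case (elim x)
      then obtain i j b where x: "x \<in> ocell (i, j, b)" by (metis prod_cases3)
      show ?case
        unfolding grad_phi[OF refl_cell[OF x]] grad_phi[OF x] refl_grad refl_phi by simp
    qed
  qed
  also have "\<dots> = - conv \<beta> l k"
    by (simp add: conv_def)
  finally show ?thesis .
qed

end

section \<open>Two-sided energy estimates\<close>

context lattice_mesh
begin

text \<open>The Dirichlet integral of the interpolant over the cells of the box, divided by their
  common area.\<close>

definition energy :: "(int \<times> int \<Rightarrow> real) \<Rightarrow> real" where
  "energy X = (\<Sum>c\<in>cellbox. (norm (cgrad X c))\<^sup>2)"

definition gsize :: real where "gsize = (norm f1)\<^sup>2 + (norm f2)\<^sup>2"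

lemma norm_cgrad_le: "(norm (cgrad X c))\<^sup>2 \<le> 2 * gsize / h\<^sup>2 * ((D1 X c)\<^sup>2 + (D2 X c)\<^sup>2)"
proof -
  let ?u = "D1 X c" and ?v = "D2 X c"
  have "norm (?u *\<^sub>R f1 + ?v *\<^sub>R f2) \<le> \<bar>?u\<bar> * norm f1 + \<bar>?v\<bar> * norm f2"
    using norm_triangle_ineq[of "?u *\<^sub>R f1" "?v *\<^sub>R f2"] by simp
  then have "(norm (?u *\<^sub>R f1 + ?v *\<^sub>R f2))\<^sup>2 \<le> (\<bar>?u\<bar> * norm f1 + \<bar>?v\<bar> * norm f2)\<^sup>2"
    by (rule power_mono) simp
  also have "\<dots> \<le> 2 * ((\<bar>?u\<bar> * norm f1)\<^sup>2 + (\<bar>?v\<bar> * norm f2)\<^sup>2)"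
    using sum_squares_bound[of "\<bar>?u\<bar> * norm f1" "\<bar>?v\<bar> * norm f2"] by (simp add: power2_sum)
  also have "\<dots> = 2 * (?u\<^sup>2 * (norm f1)\<^sup>2 + ?v\<^sup>2 * (norm f2)\<^sup>2)"
    by (simp add: power_mult_distrib)
  also have "\<dots> \<le> 2 * (gsize * (?u\<^sup>2 + ?v\<^sup>2))"
    by (simp add: gsize_def algebra_simps)
  finally have "(norm (?u *\<^sub>R f1 + ?v *\<^sub>R f2))\<^sup>2 \<le> 2 * gsize * (?u\<^sup>2 + ?v\<^sup>2)" by simp
  then have "(norm (?u *\<^sub>R f1 + ?v *\<^sub>R f2))\<^sup>2 / h\<^sup>2 \<le> 2 * gsize * (?u\<^sup>2 + ?v\<^sup>2) / h\<^sup>2"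
    by (rule divide_right_mono) simp
  then show ?thesis
    using h by (simp add: cgrad_def power_divide)
qed

text \<open>By duality \<open>D1\<close> is \<open>h\<close> times the derivative of the interpolant
  along \<open>e1\<close>; Cauchy-Schwarz does the rest.\<close>

lemma D1_sq_le: "(D1 X c)\<^sup>2 \<le> h\<^sup>2 * (norm e1)\<^sup>2 * (norm (cgrad X c))\<^sup>2"
proof -
  have "D1 X c = h * inner (cgrad X c) e1"
    using h dual by (simp add: cgrad_def inner_add_left)
  then have "\<bar>D1 X c\<bar> \<le> h * (norm (cgrad X c) * norm e1)"
    using Cauchy_Schwarz_ineq2[of "cgrad X c" e1] h by (simp add: abs_mult)
  then have "\<bar>D1 X c\<bar>\<^sup>2 \<le> (h * (norm (cgrad X c) * norm e1))\<^sup>2"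
    by (rule power_mono) simp
  then show ?thesis by (simp add: power_mult_distrib mult_ac)
qed

lemma sum_shift_le:
  fixes g :: "int \<times> int \<Rightarrow> real"
  assumes "inj s" "\<And>l. 0 \<le> g l" "\<And>l. l \<notin> J \<Longrightarrow> g l = 0"
  shows "(\<Sum>l\<in>ibox. g (s l)) \<le> sum g J"
proof -
  have "(\<Sum>l\<in>ibox. g (s l)) = sum g (s ` ibox)"
    using assms(1) by (subst sum.reindex) (auto intro: inj_on_subset)
  also have "\<dots> = sum g (s ` ibox \<inter> J)"
    using finite_ibox assms(3) by (intro sum.mono_neutral_right) auto
  also have "\<dots> \<le> sum g J"
    using finite_J assms(2) by (intro sum_mono2) auto
  finally show ?thesis .
qed

text \<open>Two coordinate differences on two kinds of triangles give four sums. Each is at most 4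
  times the sum of squares, because a squared difference is at most twice the sum of the two squares
  and shifting the index over the box cannot increase the sum. The factor 2 of
  \<open>norm_cgrad_le\<close> turns 16 into 32.\<close>

lemma energy_le:
  assumes X: "\<And>l. l \<notin> J \<Longrightarrow> X l = 0"
  shows "energy X \<le> 32 * gsize / h\<^sup>2 * (\<Sum>l\<in>J. (X l)\<^sup>2)"
proof -
  have sq: "(p - q)\<^sup>2 \<le> 2 * p\<^sup>2 + 2 * q\<^sup>2" for p q :: real
    using sum_squares_bound[of p "-q"] by (simp add: power2_diff)
  let ?S = "\<Sum>l\<in>J. (X l)\<^sup>2"
  have shift: "(\<Sum>(i, j)\<in>ibox. (X (i + a, j + b))\<^sup>2) \<le> ?S" for a b
    using sum_shift_le[of "\<lambda>(i, j). (i + a, j + b)" "\<lambda>l. (X l)\<^sup>2"] X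
    by (auto simp: inj_def case_prod_unfold)
  have D: "(\<Sum>(i, j)\<in>ibox. (X (i + a, j + b) - X (i + a', j + b'))\<^sup>2) \<le> 4 * ?S" for a b a' b'
  proof -
    have "(\<Sum>(i, j)\<in>ibox. (X (i + a, j + b) - X (i + a', j + b'))\<^sup>2) \<le>
      (\<Sum>(i, j)\<in>ibox. 2 * ((X (i + a, j + b))\<^sup>2 + (X (i + a', j + b'))\<^sup>2))"
      by (intro sum_mono) (auto simp: sq)
    also have "\<dots> = 2 * ((\<Sum>(i, j)\<in>ibox. (X (i + a, j + b))\<^sup>2) + (\<Sum>(i, j)\<in>ibox. (X (i + a', j + b'))\<^sup>2))"
      by (simp add: case_prod_unfold sum.distrib sum_distrib_left)
    also have "\<dots> \<le> 2 * (?S + ?S)"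
      by (intro mult_left_mono add_mono shift) simp
    finally show ?thesis by simp
  qed
  have "(\<Sum>c\<in>cellbox. (D1 X c)\<^sup>2 + (D2 X c)\<^sup>2) =
    (\<Sum>(i, j)\<in>ibox. (X (i + 1, j + 0) - X (i + 0, j + 0))\<^sup>2) + (\<Sum>(i, j)\<in>ibox. (X (i + 1, j + 1) - X (i + 0, j + 1))\<^sup>2) +
    (\<Sum>(i, j)\<in>ibox. (X (i + 0, j + 1) - X (i + 0, j + 0))\<^sup>2) + (\<Sum>(i, j)\<in>ibox. (X (i + 1, j + 1) - X (i + 1, j + 0))\<^sup>2)"
    unfolding sum_cellbox by (simp add: D1_def D2_def case_prod_unfold sum.distrib)
  also have "\<dots> \<le> 16 * ?S"
    using D[of 1 0 0 0] D[of 1 1 0 1] D[of 0 1 0 0] D[of 1 1 1 0] by linarith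
  finally have *: "(\<Sum>c\<in>cellbox. (D1 X c)\<^sup>2 + (D2 X c)\<^sup>2) \<le> 16 * ?S" .
  have "energy X \<le> (\<Sum>c\<in>cellbox. 2 * gsize / h\<^sup>2 * ((D1 X c)\<^sup>2 + (D2 X c)\<^sup>2))"
    unfolding energy_def by (intro sum_mono norm_cgrad_le)
  also have "\<dots> = 2 * gsize / h\<^sup>2 * (\<Sum>c\<in>cellbox. (D1 X c)\<^sup>2 + (D2 X c)\<^sup>2)"
    by (simp only: sum_distrib_left)
  also have "\<dots> \<le> 2 * gsize / h\<^sup>2 * (16 * ?S)"
    using * by (intro mult_left_mono) (auto simp: gsize_def)
  finally show ?thesis by simp
qed

text \<open>Counts cells: there are 2 (2 N + 1)^2 \<le> 18 N^2 of them, each contributing at most 4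
  \<open>gsize\<close> / h^2.\<close>

lemma energy_le_Lipschitz:
  assumes N: "0 < N" and X: "\<And>c. \<bar>D1 X c\<bar> \<le> 1" "\<And>c. \<bar>D2 X c\<bar> \<le> 1"
  shows "energy X \<le> 72 * gsize / h\<^sup>2 * (real N)\<^sup>2"
proof -
  have card: "card cellbox = 2 * (2 * N + 1)\<^sup>2"
  proof -
    have "card {- int N..int N} = 2 * N + 1"
      by (subst card_atLeastAtMost_int) linarith
    then show ?thesis
      by (simp add: cellbox_def card_cartesian_product power2_eq_square del: card_atLeastAtMost_int)
  qed
  have "(2 * real N + 1)\<^sup>2 \<le> (3 * real N)\<^sup>2"
    using N by (intro power_mono) auto
  then have card_le: "real (card cellbox) \<le> 18 * (real N)\<^sup>2"
    unfolding card by (simp add: power_mult_distrib add.commute)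
  have "energy X \<le> (\<Sum>c\<in>cellbox. 2 * gsize / h\<^sup>2 * (1 + 1))"
    unfolding energy_def
  proof (rule sum_mono)
    fix c
    have "(D1 X c)\<^sup>2 \<le> 1" "(D2 X c)\<^sup>2 \<le> 1"
      using X by (auto simp: abs_square_le_1)
    then have "2 * gsize / h\<^sup>2 * ((D1 X c)\<^sup>2 + (D2 X c)\<^sup>2) \<le> 2 * gsize / h\<^sup>2 * (1 + 1)"
      by (intro mult_left_mono add_mono) (auto simp: gsize_def)
    then show "(norm (cgrad X c))\<^sup>2 \<le> 2 * gsize / h\<^sup>2 * (1 + 1)"
      using norm_cgrad_le[of X c] by linarith
  qed
  also have "\<dots> = real (card cellbox) * (4 * gsize / h\<^sup>2)"
    by simp
  also have "\<dots> \<le> 18 * (real N)\<^sup>2 * (4 * gsize / h\<^sup>2)"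
    using card_le by (intro mult_right_mono) (auto simp: gsize_def)
  finally show ?thesis by (simp add: mult_ac)
qed

text \<open>Keeps one edge along \<open>e1\<close> per lattice parallelogram, that of its lower
  triangle.\<close>

lemma energy_ge_differences:
  "(\<Sum>(i, j)\<in>ibox. (X (i + 1, j) - X (i, j))\<^sup>2) \<le> h\<^sup>2 * (norm e1)\<^sup>2 * energy X"
proof -
  have "(\<Sum>(i, j)\<in>ibox. (X (i + 1, j) - X (i, j))\<^sup>2) \<le> (\<Sum>c\<in>cellbox. (D1 X c)\<^sup>2)"
    unfolding sum_cellbox by (intro sum_mono) (auto simp: D1_def)
  also have "\<dots> \<le> (\<Sum>c\<in>cellbox. h\<^sup>2 * (norm e1)\<^sup>2 * (norm (cgrad X c))\<^sup>2)"
    by (intro sum_mono D1_sq_le)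
  finally show ?thesis by (simp add: energy_def sum_distrib_left)
qed

text \<open>Each row starts with the value zero at -N, so X (p, q) telescopes into at most 2 N
  differences, and Cauchy-Schwarz costs a factor 2 N. Summing over at most 2 N values of p costs
  another.\<close>

lemma discrete_Poincare:
  assumes X: "\<And>l. l \<notin> J \<Longrightarrow> X l = 0"
  shows "(\<Sum>l\<in>J. (X l)\<^sup>2) \<le> 4 * (real N)\<^sup>2 * (\<Sum>(i, j)\<in>ibox. (X (i + 1, j) - X (i, j))\<^sup>2)"
proof -
  let ?I = "{- int N..int N}" and ?I' = "{- int N<..<int N}"
  define R where "R j = (\<Sum>i\<in>?I. (X (i + 1, j) - X (i, j))\<^sup>2)" for j
  have R0: "0 \<le> R j" for j by (simp add: R_def sum_nonneg)
  have pointwise: "(X (p, q))\<^sup>2 \<le> 2 * real N * R q" if p: "p \<in> ?I'" for p q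
  proof -
    define f where "f m = X (- int N + int m, q)" for m :: nat
    define M where "M = nat (p + int N)"
    have "(- int N, q) \<notin> J" using J_subset by auto
    then have f0: "f 0 = 0" using X by (simp add: f_def)
    have M: "M \<le> 2 * N" "f M = X (p, q)" using p by (auto simp: M_def f_def)
    have "X (p, q) = (\<Sum>m<M. f (Suc m) - f m)"
      using M f0 by (simp add: sum_lessThan_telescope)
    then have "(X (p, q))\<^sup>2 \<le> (\<Sum>m<M. (f (Suc m) - f m)\<^sup>2) * real M"
      using sum_squared_le_sum_of_squares[of "\<lambda>m. f (Suc m) - f m" "{..<M}"] by simp
    also have "(\<Sum>m<M. (f (Suc m) - f m)\<^sup>2) = (\<Sum>i\<in>(\<lambda>m. - int N + int m) ` {..<M}. (X (i + 1, q) - X (i, q))\<^sup>2)"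
      by (subst sum.reindex) (auto simp: inj_on_def f_def add_ac)
    also have "\<dots> \<le> R q"
      unfolding R_def using M by (intro sum_mono2) auto
    also have "R q * real M \<le> R q * (2 * real N)"
      using M R0 by (intro mult_left_mono) auto
    finally show ?thesis using p by (simp add: mult_ac mult_right_mono)
  qed
  have "(\<Sum>l\<in>J. (X l)\<^sup>2) \<le> (\<Sum>l\<in>?I' \<times> ?I'. (X l)\<^sup>2)"
    using J_subset by (intro sum_mono2) auto
  also have "\<dots> \<le> (\<Sum>l\<in>?I' \<times> ?I'. 2 * real N * R (snd l))"
    using pointwise by (intro sum_mono) auto
  also have "\<dots> = (\<Sum>p\<in>?I'. \<Sum>q\<in>?I'. 2 * real N * R q)"
    by (simp add: sum.cartesian_product')
  also have "\<dots> = real (card ?I') * (2 * real N * (\<Sum>q\<in>?I'. R q))"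
    by (simp add: sum_distrib_left)
  also have "\<dots> \<le> (2 * real N) * (2 * real N * (\<Sum>q\<in>?I. R q))"
    using R0 by (intro mult_mono mult_left_mono sum_mono2) (auto intro!: sum_nonneg mult_nonneg_nonneg)
  also have "(\<Sum>q\<in>?I. R q) = (\<Sum>(i, j)\<in>ibox. (X (i + 1, j) - X (i, j))\<^sup>2)"
    unfolding R_def ibox_def sum.cartesian_product' by (subst sum.swap) simp
  finally show ?thesis by (simp add: power2_eq_square mult_ac)
qed

lemma energy_ge:
  assumes X: "\<And>l. l \<notin> J \<Longrightarrow> X l = 0"
  shows "(\<Sum>l\<in>J. (X l)\<^sup>2) \<le> 4 * (real N)\<^sup>2 * (h\<^sup>2 * (norm e1)\<^sup>2) * energy X"
proof -
  have "(\<Sum>l\<in>J. (X l)\<^sup>2) \<le> 4 * (real N)\<^sup>2 * (\<Sum>(i, j)\<in>ibox. (X (i + 1, j) - X (i, j))\<^sup>2)"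
    using X by (rule discrete_Poincare)
  also have "\<dots> \<le> 4 * (real N)\<^sup>2 * (h\<^sup>2 * (norm e1)\<^sup>2 * energy X)"
    by (intro mult_left_mono energy_ge_differences) auto
  finally show ?thesis by (simp add: mult_ac)
qed

end

section \<open>The preconditioner for constant coefficients and the assembled matrices\<close>

lemma mat_diag_cong: "(\<And>i. i < n \<Longrightarrow> f i = g i) \<Longrightarrow> mat_diag n f = mat_diag n g"
  by (rule eq_matI) (auto simp: mat_diag_def)

lemma mat_diag_const: "mat_diag n (\<lambda>_. c :: real) = c \<cdot>\<^sub>m 1\<^sub>m n"
  by (rule eq_matI) (auto simp: mat_diag_def)

text \<open>For constant \<open>a\<close> the scaling matrix \<open>S_mat\<close> is
  \<open>a\<close> times the identity, and its two square roots together restore the factor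
  \<open>a\<close>. Positive diagonal entries make the inverse inside \<open>S_mat\<close>
  meaningful.\<close>

lemma precond_const:
  assumes K: "Theta \<Omega> T p (\<lambda>_. 1) = K" "K \<in> carrier_mat n n"
    and A: "Theta \<Omega> T p (\<lambda>_. a) = a \<cdot>\<^sub>m K" and a: "0 < a"
    and pos: "\<And>i. i < n \<Longrightarrow> 0 < K $$ (i, i)"
  shows "precond \<Omega> T p (\<lambda>_. a) = a \<cdot>\<^sub>m K"
proof -
  let ?d = "\<lambda>i. K $$ (i, i)"
  have ne: "?d i \<noteq> 0" if "i < n" for i using pos[OF that] by simp
  have K_diag: "diag_part K = mat_diag n ?d" using K(2) by (simp add: diag_part_def)
  have aK_diag: "diag_part (a \<cdot>\<^sub>m K) = mat_diag n (\<lambda>i. a * ?d i)"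
    using K(2) by (auto simp: diag_part_def intro!: mat_diag_cong)
  have "mat_inv (diag_part K) = mat_diag n (\<lambda>i. 1 / ?d i)"
  proof (rule mat_inv_eq(1))
    show "diag_part K * mat_diag n (\<lambda>i. 1 / ?d i) = 1\<^sub>m n"
      unfolding K_diag mat_diag_diag mat_diag_one[symmetric] using ne by (intro mat_diag_cong) simp
  qed (simp_all add: K_diag)
  then have "S_mat \<Omega> T p (\<lambda>_. a) = mat_diag n (\<lambda>i. a)"
    unfolding S_mat_def K A aK_diag by (simp only: mat_diag_diag) (rule mat_diag_cong, use ne in simp)
  then have "diag_sqrt (S_mat \<Omega> T p (\<lambda>_. a)) = mat_diag n (\<lambda>_. sqrt a)"
    by (auto simp: diag_sqrt_def mat_diag_def intro!: eq_matI)
  then have S: "diag_sqrt (S_mat \<Omega> T p (\<lambda>_. a)) = sqrt a \<cdot>\<^sub>m 1\<^sub>m n"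
    by (simp only: mat_diag_const)
  have aK: "sqrt a \<cdot>\<^sub>m K \<in> carrier_mat n n" using K(2) by simp
  have "precond \<Omega> T p (\<lambda>_. a) = (sqrt a * sqrt a) \<cdot>\<^sub>m K"
    unfolding precond_def K S mult_smult_assoc_mat[OF one_carrier_mat K(2)] left_mult_one_mat[OF K(2)]
      mult_smult_distrib[OF aK one_carrier_mat] right_mult_one_mat[OF aK] smult_smult_mat ..
  then show ?thesis using a by simp
qed

context lattice_mesh
begin

text \<open>Turns a coefficient vector, numbered like the matrix rows, into a lattice function, the
  form in which the energy estimates are stated.\<close>

definition interpolant :: "(nat \<Rightarrow> int \<times> int) \<Rightarrow> nat \<Rightarrow> (nat \<Rightarrow> real) \<Rightarrow> int \<times> int \<Rightarrow> real" where
  "interpolant \<kappa> n x l = (\<Sum>i<n. x i * dlt (\<kappa> i) l)"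

lemma cgrad_interpolant: "cgrad (interpolant \<kappa> n x) c = (\<Sum>i<n. x i *\<^sub>R cgrad (dlt (\<kappa> i)) c)"
proof -
  obtain i j b where c: "c = (i, j, b)" by (cases c)
  have D: "D1 (interpolant \<kappa> n x) c = (\<Sum>i<n. x i * D1 (dlt (\<kappa> i)) c)"
    "D2 (interpolant \<kappa> n x) c = (\<Sum>i<n. x i * D2 (dlt (\<kappa> i)) c)"
    unfolding c D1_def D2_def interpolant_def prod.case
    by (cases b; simp only: if_True if_False right_diff_distrib sum_subtractf)+
  show ?thesis
    unfolding cgrad_def D scaleR_sum_left scaleR_sum_right scaleR_add_right sum.distrib
    by (simp add: mult_ac)
qed

context
  fixes \<kappa> :: "nat \<Rightarrow> int \<times> int" and n :: nat
  assumes bij: "bij_betw \<kappa> {..<n} J"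
begin

lemma interpolant_index: "i < n \<Longrightarrow> interpolant \<kappa> n x (\<kappa> i) = x i"
proof -
  assume i: "i < n"
  have "interpolant \<kappa> n x (\<kappa> i) = (\<Sum>j<n. if j = i then x i else 0)"
    unfolding interpolant_def using i bij by (intro sum.cong) (auto simp: bij_betw_def inj_on_def)
  then show ?thesis using i by simp
qed

lemma interpolant_off: "l \<notin> J \<Longrightarrow> interpolant \<kappa> n x l = 0"
  unfolding interpolant_def using bij by (intro sum.neutral) (auto simp: bij_betw_def)

lemma interpolant_sum: "(\<Sum>l\<in>J. (interpolant \<kappa> n x l)\<^sup>2) = (\<Sum>i<n. (x i)\<^sup>2)"
  by (subst sum.reindex_bij_betw[OF bij, symmetric]) (simp add: interpolant_index)

lemma interpolant_restrict:
  assumes X: "\<And>l. l \<notin> J \<Longrightarrow> X l = 0"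
  shows "interpolant \<kappa> n (X \<circ> \<kappa>) = X"
proof
  fix l
  show "interpolant \<kappa> n (X \<circ> \<kappa>) l = X l"
  proof (cases "l \<in> J")
    case True
    then obtain i where "i < n" "l = \<kappa> i" using bij by (auto simp: bij_betw_def)
    then show ?thesis by (simp add: interpolant_index)
  qed (simp add: interpolant_off X)
qed

text \<open>The gradient of the interpolant is linear in the coefficients, so its squared norm
  expands into the matrix entries; \<open>r\<close> will be the area of a cell.\<close>

lemma quad_energy:
  assumes K: "K \<in> carrier_mat n n"
    and entries: "\<And>i j. i < n \<Longrightarrow> j < n \<Longrightarrow>
      K $$ (i, j) = r * (\<Sum>c\<in>cellbox. inner (cgrad (dlt (\<kappa> j)) c) (cgrad (dlt (\<kappa> i)) c))"
  shows "quad K x = r * energy (interpolant \<kappa> n x)"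
proof -
  let ?g = "\<lambda>i c. cgrad (dlt (\<kappa> i)) c"
  have "quad K x = (\<Sum>i<n. \<Sum>j<n. \<Sum>c\<in>cellbox. r * (x i * x j * inner (?g j c) (?g i c)))"
    using K by (auto simp: quad_def entries sum_distrib_left sum_distrib_right mult_ac intro!: sum.cong)
  also have "\<dots> = (\<Sum>i<n. \<Sum>c\<in>cellbox. \<Sum>j<n. r * (x i * x j * inner (?g j c) (?g i c)))"
    by (intro sum.cong refl sum.swap)
  also have "\<dots> = (\<Sum>c\<in>cellbox. \<Sum>i<n. \<Sum>j<n. r * (x i * x j * inner (?g j c) (?g i c)))"
    by (rule sum.swap)
  also have "\<dots> = (\<Sum>c\<in>cellbox. r * inner (\<Sum>i<n. x i *\<^sub>R ?g i c) (\<Sum>i<n. x i *\<^sub>R ?g i c))"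
    unfolding inner_sum_left inner_sum_right sum_distrib_left
    by (intro sum.cong refl) (simp add: inner_commute mult_ac)
  also have "\<dots> = r * energy (interpolant \<kappa> n x)"
    by (simp add: energy_def cgrad_interpolant power2_norm_eq_inner sum_distrib_left)
  finally show ?thesis .
qed

end

section \<open>The pyramid, a test function of small Rayleigh quotient\<close>

lemma pyramid_Lipschitz:
  fixes u v w r :: real
  assumes "\<bar>u - v\<bar> \<le> 1"
  shows "\<bar>max 0 (r - max \<bar>u\<bar> \<bar>w\<bar>) - max 0 (r - max \<bar>v\<bar> \<bar>w\<bar>)\<bar> \<le> 1"
proof -
  have max: "\<bar>max c x - max c y\<bar> \<le> \<bar>x - y\<bar>" for c x y :: real
    by linarith
  have "\<bar>max \<bar>u\<bar> \<bar>w\<bar> - max \<bar>v\<bar> \<bar>w\<bar>\<bar> \<le> 1"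
    unfolding max.commute[of _ "\<bar>w\<bar>"]
    by (rule order_trans[OF max order_trans[OF abs_triangle_ineq3 assms]])
  moreover have "\<bar>max 0 (r - x) - max 0 (r - y)\<bar> \<le> 1" if "\<bar>x - y\<bar> \<le> 1" for x y
    using order_trans[OF max, of "r - x" "r - y" 1 0] that by (simp add: abs_minus_commute)
  ultimately show ?thesis by blast
qed

lemma pyramid_Lipschitz':
  fixes u v w r :: real
  assumes "\<bar>u - v\<bar> \<le> 1"
  shows "\<bar>max 0 (r - max \<bar>w\<bar> \<bar>u\<bar>) - max 0 (r - max \<bar>w\<bar> \<bar>v\<bar>)\<bar> \<le> 1"
  using pyramid_Lipschitz[OF assms, of r w] by (simp only: max.commute[of "\<bar>w\<bar>"])

text \<open>A cone in the maximum norm, of height and radius \<open>R\<close>. Its coordinate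
  differences are at most one, while its values are of order \<open>R\<close> on about R^2 nodes;
  with \<open>N\<close> comparable to \<open>R\<close>, its Rayleigh quotient is of order R^-2
  relative to that of a single hat.\<close>

definition pyramid :: "nat \<Rightarrow> int \<Rightarrow> int \<Rightarrow> int \<times> int \<Rightarrow> real" where
  "pyramid R p q l = max 0 (real R - max \<bar>real_of_int (fst l - p)\<bar> \<bar>real_of_int (snd l - q)\<bar>)"

lemma pyramid_D: "\<bar>D1 (pyramid R p q) c\<bar> \<le> 1" "\<bar>D2 (pyramid R p q) c\<bar> \<le> 1"
proof -
  obtain i j b where c: "c = (i, j, b)" by (cases c)
  show "\<bar>D1 (pyramid R p q) c\<bar> \<le> 1"
    unfolding c D1_def pyramid_def by (cases b) (simp_all only: prod.case if_True if_False fst_conv snd_conv, (rule pyramid_Lipschitz, simp)+)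
  show "\<bar>D2 (pyramid R p q) c\<bar> \<le> 1"
    unfolding c D2_def pyramid_def by (cases b) (simp_all only: prod.case if_True if_False fst_conv snd_conv, (rule pyramid_Lipschitz', simp)+)
qed

lemma pyramid_sum:
  assumes R: "0 < R" and block: "\<And>i j. \<bar>i - p\<bar> < int R \<Longrightarrow> \<bar>j - q\<bar> < int R \<Longrightarrow> (i, j) \<in> J"
  shows "(real R) ^ 4 / 4 \<le> (\<Sum>l\<in>J. (pyramid R p q l)\<^sup>2)"
proof -
  \<comment> \<open>On the block of half the radius the pyramid is at least R / 2, and rounding down
    still leaves (2 r + 1)^2 \<ge> R^2 nodes; together R^2 (R / 2)^2 = R^4 / 4.\<close>
  define r where "r = int (R div 2)"
  have r: "2 * r \<le> int R" "int R \<le> 2 * r + 1" "0 \<le> r" "r < int R" using R by (auto simp: r_def)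
  let ?S = "{p - r..p + r} \<times> {q - r..q + r}"
  have card: "real (card ?S) = (2 * of_int r + 1)\<^sup>2"
    using r by (simp add: card_cartesian_product power2_eq_square)
  have "(real R) ^ 4 / 4 = (real R)\<^sup>2 * (real R / 2)\<^sup>2"
    by (simp add: power_divide flip: power_add)
  also have "\<dots> \<le> real (card ?S) * (real R / 2)\<^sup>2"
    unfolding card using r by (intro mult_right_mono power_mono) auto
  also have "\<dots> = (\<Sum>l\<in>?S. (real R / 2)\<^sup>2)" by simp
  also have "\<dots> \<le> (\<Sum>l\<in>?S. (pyramid R p q l)\<^sup>2)"
  proof (intro sum_mono power_mono)
    fix l assume "l \<in> ?S"
    then have "\<bar>fst l - p\<bar> \<le> r" "\<bar>snd l - q\<bar> \<le> r" by auto
    then have "max \<bar>real_of_int (fst l - p)\<bar> \<bar>real_of_int (snd l - q)\<bar> \<le> real_of_int r" by linarith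
    moreover have "2 * real_of_int r \<le> real R" using r(1) by linarith
    ultimately show "real R / 2 \<le> pyramid R p q l" unfolding pyramid_def by linarith
  qed simp
  also have "\<dots> \<le> (\<Sum>l\<in>J. (pyramid R p q l)\<^sup>2)"
  proof (rule sum_mono2[OF finite_J])
    show "?S \<subseteq> J" using block r by (auto simp: abs_less_iff)
  qed simp
  finally show ?thesis .
qed

lemma pyramid_off:
  assumes block: "\<And>i j. \<bar>i - p\<bar> < int R \<Longrightarrow> \<bar>j - q\<bar> < int R \<Longrightarrow> (i, j) \<in> J" and l: "l \<notin> J"
  shows "pyramid R p q l = 0"
proof -
  have "int R \<le> \<bar>fst l - p\<bar> \<or> int R \<le> \<bar>snd l - q\<bar>"
    using block[of "fst l" "snd l"] l by force
  then show ?thesis unfolding pyramid_def by linarith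
qed

text \<open>The pyramid lives on the block of internal nodes around (p0, q0), and its centre carries
  the unit test vector. The bounds are of order \<open>N\<close> above and R^2 / N below.\<close>

theorem mesh_diagonalization:
  assumes a: "0 < a" and R: "0 < R"
    and block: "\<And>i j. \<bar>i - p0\<bar> < int R \<Longrightarrow> \<bar>j - q0\<bar> < int R \<Longrightarrow> node (i, j) \<in> \<Omega>"
    and n: "n = card (internal_nodes \<Omega> T)" and p: "bij_betw p {..<n} (internal_nodes \<Omega> T)"
  shows "invertible_mat (precond \<Omega> T p (\<lambda>_. a)) \<and>
    (\<exists>V D. V \<in> carrier_mat n n \<and> D \<in> carrier_mat n n \<and> invertible_mat V \<and> diagonal_mat D \<and>
      map_mat complex_of_real
        (mat_inv (precond \<Omega> T p (\<lambda>_. a)) * conv_diff_mat \<Omega> T p (\<lambda>_. a) (\<lambda>_. \<beta>)) = V * D * mat_inv V \<and>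
      (real R)\<^sup>2 / (real N * sqrt (288 * gsize * (norm e1)\<^sup>2)) \<le> cond2 V \<and>
      cond2 V \<le> real N * sqrt (128 * gsize * (norm e1)\<^sup>2))"
proof -
  \<comment> \<open>The numbering \<open>p\<close> of the nodes is arbitrary; \<kappa> pulls it back
    to lattice indices.\<close>
  define \<kappa> where "\<kappa> = inv_into J node \<circ> p"
  have node: "bij_betw node J (internal_nodes \<Omega> T)"
    unfolding internal_nodes_eq by (simp add: bij_betw_def inj_on_def)
  have bij: "bij_betw \<kappa> {..<n} J"
    unfolding \<kappa>_def using p bij_betw_inv_into[OF node] by (rule bij_betw_trans)
  have pk: "p i = node (\<kappa> i)" if "i < n" for i
  proof -
    have "p i \<in> node ` J"
      using that p by (auto simp: bij_betw_def simp flip: internal_nodes_eq)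
    then show ?thesis by (simp add: \<kappa>_def f_inv_into_f)
  qed
  have kJ: "\<kappa> i \<in> J" if "i < n" for i
    using that bij by (auto simp: bij_betw_def)
  have blockJ: "(i, j) \<in> J" if "\<bar>i - p0\<bar> < int R" "\<bar>j - q0\<bar> < int R" for i j
    using block[OF that] by (simp add: J_def)
  have c0: "(p0, q0) \<in> J" using blockJ R by simp
  have N: "0 < N" using c0 J_subset by auto
  have e1: "0 < norm e1" using dual by auto
  have "f1 \<noteq> 0" using dual by auto
  then have gs: "0 < gsize" by (simp add: gsize_def add_pos_nonneg)
  note pos = h N e1 gs cell_area_pos
  define r where "r = h\<^sup>2 * cell_area"
  have r: "0 < r" using pos by (simp add: r_def)
  define K where "K = Theta \<Omega> T p (\<lambda>_. 1)"
  have K: "K \<in> carrier_mat n n" by (simp add: K_def Theta_def Let_def n)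
  define W where "W = Psi \<Omega> T p (\<lambda>_. \<beta>)"
  have W: "W \<in> carrier_mat n n" by (simp add: W_def Psi_def Let_def n)
  have theta: "Theta \<Omega> T p (\<lambda>_. s) $$ (i, j) = s * (r * (\<Sum>c\<in>cellbox. inner (cgrad (dlt (\<kappa> j)) c) (cgrad (dlt (\<kappa> i)) c)))"
    if "i < n" "j < n" for i j s
    using that theta_integral[OF kJ kJ, of i j s] unfolding r_def Theta_def Let_def n[symmetric]
    by (simp add: pk hat_eq kJ)
  have Kij: "K $$ (i, j) = r * (\<Sum>c\<in>cellbox. inner (cgrad (dlt (\<kappa> j)) c) (cgrad (dlt (\<kappa> i)) c))"
    if "i < n" "j < n" for i j
    using theta[OF that, of 1] by (simp add: K_def)
  have Wij: "W $$ (i, j) = - conv \<beta> (\<kappa> i) (\<kappa> j)" if "i < n" "j < n" for i j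
    using that psi_integral[OF kJ, of j \<beta> "\<kappa> i"] unfolding W_def Psi_def Let_def n[symmetric]
    by (simp add: pk hat_eq kJ)
  have A: "Theta \<Omega> T p (\<lambda>_. a) = a \<cdot>\<^sub>m K"
  proof (rule eq_matI)
    fix i j assume "i < dim_row (a \<cdot>\<^sub>m K)" "j < dim_col (a \<cdot>\<^sub>m K)"
    then have "i < n" "j < n" using K by auto
    then show "Theta \<Omega> T p (\<lambda>_. a) $$ (i, j) = (a \<cdot>\<^sub>m K) $$ (i, j)"
      using theta[of i j a] Kij[of i j] K by simp
  qed (simp_all add: K_def Theta_def Let_def)
  have quad: "quad K x = r * energy (interpolant \<kappa> n x)" for x
    using quad_energy[OF bij K] Kij by blast
  \<comment> \<open>The h^2 in \<open>r\<close> cancels the h^-2 of squared gradients. The Poincare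
    inequality gives \<open>c1\<close>, \<open>energy_le\<close> gives \<open>c2\<close>, a unit
    vector \<open>c3\<close>, and the pyramid \<open>c4\<close>, where 288 is 72 from
    \<open>energy_le_Lipschitz\<close> times 4 from R^4 / 4.\<close>
  define c1 where "c1 = cell_area / (4 * (real N)\<^sup>2 * (norm e1)\<^sup>2)"
  define c2 where "c2 = 32 * gsize * cell_area"
  define c3 where "c3 = cell_area / (norm e1)\<^sup>2"
  define c4 where "c4 = 288 * gsize * cell_area * (real N)\<^sup>2 / (real R) ^ 4"
  have c1: "0 < c1" and c2: "0 \<le> c2" and c3: "0 \<le> c3"
    using pos by (simp_all add: c1_def c2_def c3_def)
  have lower: "c1 * (\<Sum>i<n. (x i)\<^sup>2) \<le> quad K x" for x
    using energy_ge[of "interpolant \<kappa> n x"] interpolant_off[OF bij, of _ x] pos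
    by (simp add: quad interpolant_sum[OF bij] c1_def r_def field_simps)
  have upper: "quad K x \<le> c2 * (\<Sum>i<n. (x i)\<^sup>2)" for x
    using energy_le[of "interpolant \<kappa> n x"] interpolant_off[OF bij, of _ x] pos
    by (simp add: quad interpolant_sum[OF bij] c2_def r_def field_simps)
  define y where "y = dlt (p0, q0) \<circ> \<kappa>"
  have y: "interpolant \<kappa> n y = dlt (p0, q0)"
    unfolding y_def using c0 by (intro interpolant_restrict[OF bij]) auto
  have ysum: "(\<Sum>i<n. (y i)\<^sup>2) = 1"
    using interpolant_sum[OF bij, of y] finite_J c0 by (simp add: y of_bool_def if_distrib[of "\<lambda>x. x\<^sup>2"] cong: if_cong)
  \<comment> \<open>One term is the jump from 1 at (p0, q0) to 0 at the next node along
    \<open>e1\<close>.\<close>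
  have "1 \<le> (\<Sum>(i, j)\<in>ibox. (dlt (p0, q0) (i + 1, j) - dlt (p0, q0) (i, j))\<^sup>2 :: real)"
    using member_le_sum[of "(p0, q0)" ibox "\<lambda>(i, j). (dlt (p0, q0) (i + 1, j) - dlt (p0, q0) (i, j))\<^sup>2"] c0 J_subset finite_ibox
    by (auto simp: ibox_def)
  then have "1 \<le> h\<^sup>2 * (norm e1)\<^sup>2 * energy (dlt (p0, q0))"
    using energy_ge_differences[of "dlt (p0, q0)"] by (rule order_trans)
  then have yq: "c3 * (\<Sum>i<n. (y i)\<^sup>2) \<le> quad K y"
    using pos by (simp add: ysum quad y c3_def r_def field_simps)
  define z where "z = pyramid R p0 q0 \<circ> \<kappa>"
  have z: "interpolant \<kappa> n z = pyramid R p0 q0"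
    unfolding z_def using blockJ by (intro interpolant_restrict[OF bij] pyramid_off)
  have zsum: "(real R) ^ 4 / 4 \<le> (\<Sum>i<n. (z i)\<^sup>2)"
    using pyramid_sum[of R p0 q0] R blockJ interpolant_sum[OF bij, of z] by (simp add: z)
  have zpos: "0 < (\<Sum>i<n. (z i)\<^sup>2)"
    by (rule less_le_trans[OF _ zsum]) (use R in simp)
  have "quad K z \<le> c4 * ((real R) ^ 4 / 4)"
    using energy_le_Lipschitz[OF N pyramid_D, of R p0 q0] pos R by (simp add: quad z c4_def r_def field_simps)
  also have "\<dots> \<le> c4 * (\<Sum>i<n. (z i)\<^sup>2)"
    using zsum pos by (intro mult_left_mono) (auto simp: c4_def)
  finally have zq: "quad K z \<le> c4 * (\<Sum>i<n. (z i)\<^sup>2)" .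
  have Kpos: "0 < K $$ (i, i)" if i: "i < n" for i
  proof -
    have "K $$ (i, i) = quad K (\<lambda>j. of_bool (j = i))"
      using i K by (simp add: quad_def of_bool_def if_distrib[of "\<lambda>x. x * _"] if_distrib[of "\<lambda>x. _ * x"] cong: if_cong)
    moreover have "(\<Sum>j<n. (of_bool (j = i) :: real)\<^sup>2) = 1"
      using i by (simp add: of_bool_def if_distrib[of "\<lambda>x. x\<^sup>2"] cong: if_cong)
    ultimately show ?thesis using lower[of "\<lambda>j. of_bool (j = i)"] c1 by simp
  qed
  have P: "precond \<Omega> T p (\<lambda>_. a) = a \<cdot>\<^sub>m K"
    using precond_const[OF K_def[symmetric] K A a Kpos] .
  have C: "conv_diff_mat \<Omega> T p (\<lambda>_. a) (\<lambda>_. \<beta>) = a \<cdot>\<^sub>m K + W"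
    by (simp add: conv_diff_mat_def A W_def)
  have sym: "K $$ (i, j) = K $$ (j, i)" if "i < n" "j < n" for i j
    using that by (simp add: Kij inner_commute)
  have skew: "W $$ (i, j) = - W $$ (j, i)" if "i < n" "j < n" for i j
    using that conv_skew[OF kJ kJ, of i j \<beta>] by (simp add: Wij)
  have "c2 / c1 = (real N)\<^sup>2 * (128 * gsize * (norm e1)\<^sup>2)"
    using pos by (simp add: c1_def c2_def field_simps)
  then have s2: "sqrt (c2 / c1) = real N * sqrt (128 * gsize * (norm e1)\<^sup>2)"
    by (simp only: real_sqrt_mult real_sqrt_abs abs_of_nat)
  have "c3 / c4 = ((real R)\<^sup>2 / real N)\<^sup>2 / (288 * gsize * (norm e1)\<^sup>2)"
    using pos R by (simp add: c3_def c4_def field_simps)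
  then have s1: "sqrt (c3 / c4) = (real R)\<^sup>2 / (real N * sqrt (288 * gsize * (norm e1)\<^sup>2))"
    by (simp add: real_sqrt_divide)
  show ?thesis
    using preconditioned_diagonalization[OF K W a sym skew c1 lower c2 upper _ yq c3 zpos zq]
    unfolding P C s1 s2 ysum by simp
qed

end

section \<open>The meshes of the square\<close>

context affine_lattice
begin

lemma phi_posD:
  assumes "0 < phi k x"
  shows "\<bar>sc x - fst k\<bar> < 1" "\<bar>tc x - snd k\<bar> < 1" "\<bar>sc x + tc x - (fst k + snd k)\<bar> < 1"
proof -
  have "max \<bar>sc x - fst k\<bar> (max \<bar>tc x - snd k\<bar> \<bar>sc x - fst k + (tc x - snd k)\<bar>) < 1"
    using assms by (simp add: phi_def less_max_iff_disj)
  then show "\<bar>sc x - fst k\<bar> < 1" "\<bar>tc x - snd k\<bar> < 1" "\<bar>sc x + tc x - (fst k + snd k)\<bar> < 1"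
    by (simp_all add: algebra_simps)
qed

lemma tri_floor:
  "x \<in> tri \<lfloor>sc x\<rfloor> \<lfloor>tc x\<rfloor> (\<lfloor>sc x\<rfloor> + \<lfloor>tc x\<rfloor> + 1 < sc x + tc x)"
proof -
  define i j where "i = \<lfloor>sc x\<rfloor>" and "j = \<lfloor>tc x\<rfloor>"
  have "i \<le> sc x" "sc x < i + 1" "j \<le> tc x" "tc x < j + 1" by (simp_all add: i_def j_def)
  then show ?thesis unfolding i_def[symmetric] j_def[symmetric] by (auto simp: tri_def)
qed

text \<open>Coordinates of internal nodes are integers from 1 to m - 1, so points at coordinate
  distance less than one stay inside; this gives \<open>star\<close> with N = m.\<close>

lemma square_lattice_mesh:
  assumes \<Omega>: "\<Omega> = {x. 0 < sc x \<and> sc x < real m \<and> 0 < tc x \<and> tc x < real m}"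
    and T: "T = {tri i j b | i j b. 0 \<le> i \<and> i < int m \<and> 0 \<le> j \<and> j < int m}"
  shows "lattice_mesh org e1 e2 f1 f2 h \<Omega> T m"
proof unfold_locales
  show "\<exists>i j b. K = tri i j b" if "K \<in> T" for K
    using that unfolding T by blast
  show "\<Omega> \<subseteq> \<Union>T"
  proof
    fix x assume x: "x \<in> \<Omega>"
    then have "0 \<le> \<lfloor>sc x\<rfloor>" "\<lfloor>sc x\<rfloor> < int m" "0 \<le> \<lfloor>tc x\<rfloor>" "\<lfloor>tc x\<rfloor> < int m"
      unfolding \<Omega> by (auto simp: floor_less_iff)
    then show "x \<in> \<Union>T" using tri_floor[of x] unfolding T by blast
  qed
  fix k
  assume k: "node k \<in> \<Omega>"
  then have k': "0 < fst k" "fst k < int m" "0 < snd k" "snd k < int m" by (auto simp: \<Omega>)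
  then show "\<bar>fst k\<bar> < int m \<and> \<bar>snd k\<bar> < int m" by simp
  fix x assume "0 < phi k x"
  from phi_posD[OF this] show "x \<in> \<Omega>" using k' unfolding \<Omega> by simp linarith
qed

end

text \<open>The conclusion for a single mesh with both bounds as parameters, so that constants can
  be weakened without reopening the quantifiers.\<close>

definition eigvec_cond_bounds :: "real \<Rightarrow> point \<Rightarrow> point set \<Rightarrow> mesh \<Rightarrow> real \<Rightarrow> real \<Rightarrow> bool" where
  "eigvec_cond_bounds a \<beta> \<Omega> T lo hi \<longleftrightarrow> (\<forall>n p. n = card (internal_nodes \<Omega> T) \<longrightarrow>
     bij_betw p {..<n} (internal_nodes \<Omega> T) \<longrightarrow>
     invertible_mat (precond \<Omega> T p (\<lambda>_. a)) \<and>
     (\<exists>V D. V \<in> carrier_mat n n \<and> D \<in> carrier_mat n n \<and>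
        invertible_mat V \<and> diagonal_mat D \<and>
        map_mat complex_of_real
          (mat_inv (precond \<Omega> T p (\<lambda>_. a)) * conv_diff_mat \<Omega> T p (\<lambda>_. a) (\<lambda>_. \<beta>))
          = V * D * mat_inv V \<and>
        lo \<le> cond2 V \<and> cond2 V \<le> hi))"

lemma eigvec_cond_bounds_mono:
  assumes "eigvec_cond_bounds a \<beta> \<Omega> T lo hi" "lo' \<le> lo" "hi \<le> hi'"
  shows "eigvec_cond_bounds a \<beta> \<Omega> T lo' hi'"
  using assms(1) order_trans[OF assms(2)] order_trans[OF _ assms(3)]
  unfolding eigvec_cond_bounds_def by meson

context lattice_mesh
begin

text \<open>N \<le> 3 R turns the lower bound R^2 / N into a multiple of N / 9, so both bounds
  become proportional to \<open>N\<close>; \<open>E\<close> collects the geometry of the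
  lattice.\<close>

lemma mesh_condition:
  assumes a: "0 < a" and R: "0 < R" "N \<le> 3 * R"
    and block: "\<And>i j. \<bar>i - p0\<bar> < int R \<Longrightarrow> \<bar>j - q0\<bar> < int R \<Longrightarrow> node (i, j) \<in> \<Omega>"
    and E: "gsize * (norm e1)\<^sup>2 = E"
  shows "eigvec_cond_bounds a \<beta> \<Omega> T (1 / (9 * sqrt (288 * E)) * real N) (sqrt (128 * E) * real N)"
proof -
  have "node (p0, q0) \<in> \<Omega>" using block R by simp
  then have N: "0 < N" using bound[of "(p0, q0)"] by auto
  have "real N \<le> 3 * real R" using R by linarith
  then have "(real N)\<^sup>2 \<le> (3 * real R)\<^sup>2" by (rule power_mono) simp
  then have N9: "real N \<le> 9 * ((real R)\<^sup>2 / real N)"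
    using N by (simp add: power2_eq_square[of "real N"] pos_le_divide_eq power_mult_distrib)
  have "real N / 9 / sqrt (288 * E) \<le> (real R)\<^sup>2 / real N / sqrt (288 * E)"
  proof (rule divide_right_mono)
    show "real N / 9 \<le> (real R)\<^sup>2 / real N"
      using N9 by linarith
  qed (simp add: E[symmetric] gsize_def)
  then have le: "1 / (9 * sqrt (288 * E)) * real N \<le> (real R)\<^sup>2 / (real N * sqrt (288 * gsize * (norm e1)\<^sup>2))"
    by (simp add: E[symmetric] mult.assoc)
  have eq: "real N * sqrt (128 * gsize * (norm e1)\<^sup>2) = sqrt (128 * E) * real N"
    by (simp add: E[symmetric] mult_ac)
  have "eigvec_cond_bounds a \<beta> \<Omega> T ((real R)\<^sup>2 / (real N * sqrt (288 * gsize * (norm e1)\<^sup>2)))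
      (real N * sqrt (128 * gsize * (norm e1)\<^sup>2))"
    unfolding eigvec_cond_bounds_def using mesh_diagonalization[OF a R(1) block] by blast
  then show ?thesis
    by (rule eigvec_cond_bounds_mono[OF _ le eq_refl[OF eq]])
qed

end

lemma point_eqI: "Finite_Cartesian_Product.vec_nth x 1 = Finite_Cartesian_Product.vec_nth y 1 \<Longrightarrow>
    Finite_Cartesian_Product.vec_nth x 2 = Finite_Cartesian_Product.vec_nth y 2 \<Longrightarrow> x = (y :: point)"
  by (simp add: vec_eq_iff forall_2)

lemma inner_vector_2 [simp]: "inner (vector [a, b] :: point) x =
    a * Finite_Cartesian_Product.vec_nth x 1 + b * Finite_Cartesian_Product.vec_nth x 2"
  by (simp add: inner_vec_def sum_2 vector_2)

lemma norm_vector_2: "(norm (vector [a, b] :: point))\<^sup>2 = a\<^sup>2 + b\<^sup>2"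
  unfolding power2_norm_eq_inner inner_vector_2 by (simp add: vector_2 power2_eq_square)

text \<open>An orthonormal basis is its own dual. The lattice triangulation has falling diagonals;
  \<sigma> = -1 reverses the first axis and produces the rising ones.\<close>

lemma fk_lattice:
  assumes m: "0 < m" and \<sigma>: "\<sigma> = 1 \<or> \<sigma> = - 1"
  shows "affine_lattice (vector [\<sigma>, 0]) (vector [0, 1]) (vector [\<sigma>, 0]) (vector [0, 1]) (1 / real m)"
proof unfold_locales
  show "inner (vector [\<sigma>, 0]) (vector [\<sigma>, 0] :: point) = 1"
    using \<sigma> by (auto simp: vector_2)
  show "x = inner (vector [\<sigma>, 0]) x *\<^sub>R vector [\<sigma>, 0] + inner (vector [0, 1]) x *\<^sub>R vector [0, 1]" for x :: point
    using \<sigma> by (intro point_eqI) (auto simp: vector_2)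
qed (use m in \<open>auto simp: vector_2\<close>)

lemma mem_unit_square: "x \<in> unit_square \<longleftrightarrow>
    0 < Finite_Cartesian_Product.vec_nth x 1 \<and> Finite_Cartesian_Product.vec_nth x 1 < 1 \<and>
    0 < Finite_Cartesian_Product.vec_nth x 2 \<and> Finite_Cartesian_Product.vec_nth x 2 < 1"
  by (auto simp: unit_square_def mem_box_cart forall_2 vector_2)

lemma fk_lattice_mesh:
  assumes m: "0 < m"
  shows "lattice_mesh (if up then vector [1, 0] else 0) (vector [if up then - 1 else 1, 0]) (vector [0, 1])
    (vector [if up then - 1 else 1, 0]) (vector [0, 1]) (1 / real m) unit_square (fk_mesh up m) m"
    (is "lattice_mesh ?o ?e1 ?e2 ?e1 ?e2 ?h _ _ _")
proof -
  interpret affine_lattice ?o ?e1 ?e2 ?e1 ?e2 ?h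
    using m by (intro fk_lattice) auto
  have s: "sc x = real m * (if up then 1 - Finite_Cartesian_Product.vec_nth x 1 else Finite_Cartesian_Product.vec_nth x 1)"
    and t: "tc x = real m * Finite_Cartesian_Product.vec_nth x 2" for x
    using m by (auto simp: sc_def tc_def vector_2)
  show ?thesis
  proof (rule square_lattice_mesh)
    show "unit_square = {x. 0 < sc x \<and> sc x < real m \<and> 0 < tc x \<and> tc x < real m}"
      using m by (auto simp: mem_unit_square s t zero_less_mult_iff)
    \<comment> \<open>Reversing the first axis renumbers the columns of squares from right to
      left.\<close>
    define i' where "i' i = (if up then int m - 1 - int i else int i)" for i
    have halves: "square_halves up (1 / real m) i j = {tri (i' i) (int j) False, tri (i' i) (int j) True}" for i j
    proof -
      let ?p = "\<lambda>k l. vector [real (i + k) * (1 / real m), real (j + l) * (1 / real m)] :: point"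
      have node: "node (k, l) = vector [if up then (real m - k) / real m else k / real m, l / real m]" for k l
        using m by (intro point_eqI) (auto simp: node_def pt_def vector_2 field_simps)
      have nodes: "node (i' i, int j) = (if up then ?p 1 0 else ?p 0 0)"
        "node (i' i + 1, int j) = (if up then ?p 0 0 else ?p 1 0)"
        "node (i' i, int j + 1) = (if up then ?p 1 1 else ?p 0 1)"
        "node (i' i + 1, int j + 1) = (if up then ?p 0 1 else ?p 1 1)"
        unfolding node i'_def by (simp_all add: add.commute)
      show ?thesis
        unfolding square_halves_def Let_def tri_eq_hull verts_def if_True if_False image_insert image_empty nodes
        by (cases up) (simp_all add: insert_commute)
    qed
    show "fk_mesh up m = {tri i j b | i j b. 0 \<le> i \<and> i < int m \<and> 0 \<le> j \<and> j < int m}" (is "_ = ?T")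
    proof (intro equalityI subsetI)
      fix K assume "K \<in> fk_mesh up m"
      then obtain i j b where "i < m" "j < m" and K: "K = tri (i' i) (int j) b"
        unfolding fk_mesh_def halves by auto
      then have "0 \<le> i' i" "i' i < int m" "0 \<le> int j" "int j < int m" by (auto simp: i'_def)
      then show "K \<in> ?T" unfolding K by blast
    next
      fix K assume "K \<in> ?T"
      then obtain k l b where K: "K = tri k l b" and kl: "0 \<le> k" "k < int m" "0 \<le> l" "l < int m" by blast
      define i where "i = nat (if up then int m - 1 - k else k)"
      have il: "i < m" "nat l < m" "i' i = k" "int (nat l) = l" using kl by (auto simp: i_def i'_def)
      have "K \<in> square_halves up (1 / real m) i (nat l)"
        unfolding halves il K by (cases b) simp_all
      then show "K \<in> fk_mesh up m" unfolding fk_mesh_def using il(1,2) by blast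
    qed
  qed
qed

lemma fk_mesh_cond_bounds:
  assumes a: "0 < a" and m: "2 \<le> m"
  shows "eigvec_cond_bounds a \<beta> unit_square (fk_mesh up m)
    (1 / (9 * sqrt (288 * 2)) * real m) (sqrt (128 * 2) * real m)"
proof -
  have m0: "0 < m" using m by simp
  interpret lattice_mesh "if up then vector [1, 0] else 0" "vector [if up then - 1 else 1, 0]" "vector [0, 1]"
    "vector [if up then - 1 else 1, 0]" "vector [0, 1]" "1 / real m" unit_square "fk_mesh up m" m
    by (rule fk_lattice_mesh[OF m0])
  \<comment> \<open>The block around (R, R) has coordinates from 1 to 2 R - 1, which are below m.
    The inequality m \<le> 3 R holds from m = 2 on and is tight at m = 3.\<close>
  let ?R = "m div 2"
  show ?thesis
  proof (rule mesh_condition[OF a, of ?R "int ?R" "int ?R"])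
    show "0 < ?R" "m \<le> 3 * ?R" using m by linarith+
    show "gsize * (norm (vector [if up then - 1 else 1, 0] :: point))\<^sup>2 = 2"
      by (auto simp: gsize_def norm_vector_2)
    fix i j assume "\<bar>i - int ?R\<bar> < int ?R" "\<bar>j - int ?R\<bar> < int ?R"
    then have "0 < i" "i < int m" "0 < j" "j < int m" by linarith+
    then show "node (i, j) \<in> unit_square"
      using m0 by (auto simp: mem_unit_square node_def pt_def vector_2 field_simps)
  qed
qed

section \<open>The meshes of the hexagon\<close>

text \<open>Lattice coordinates of the directions at multiples of 60 degrees. The first is repeated
  at index 6, so that the side starting at vertex 5 has an end point.\<close>

definition hex_offset :: "nat \<Rightarrow> int \<times> int" where
  "hex_offset k = [(1, 0), (0, 1), (-1, 1), (-1, 0), (0, -1), (1, -1), (1, 0)] ! k"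

lemma less_6_cases:
  assumes "k < (6 :: nat)"
  obtains "k = 0" | "k = 1" | "k = 2" | "k = 3" | "k = 4" | "k = 5"
  using assms by linarith

lemma hex_offset_simps [simp]:
  "hex_offset 0 = (1, 0)" "hex_offset 1 = (0, 1)" "hex_offset (Suc 0) = (0, 1)" "hex_offset 2 = (- 1, 1)"
  "hex_offset 3 = (- 1, 0)" "hex_offset 4 = (0, - 1)" "hex_offset 5 = (1, - 1)" "hex_offset 6 = (1, 0)"
  by (simp_all add: hex_offset_def eval_nat_numeral)

context affine_lattice
begin

text \<open>The open hexagon in lattice coordinates centred at \<open>org\<close>: the support
  hexagon of a hat function, enlarged \<open>m\<close> times.\<close>

definition hex_region :: "nat \<Rightarrow> point set" where
  "hex_region m = {x. \<bar>sc x\<bar> < m \<and> \<bar>tc x\<bar> < m \<and> \<bar>sc x + tc x\<bar> < m}"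

definition hex_cells :: "nat \<Rightarrow> mesh" where
  "hex_cells m = {tri i j b | i j b. otri i j b \<subseteq> hex_region m}"

lemma otri_subset_hex_region:
  assumes "- int m \<le> i" "i + 1 \<le> int m" "- int m \<le> j" "j + 1 \<le> int m"
    and "if b then - int m \<le> i + j + 1 \<and> i + j + 2 \<le> int m else - int m \<le> i + j \<and> i + j + 1 \<le> int m"
  shows "otri i j b \<subseteq> hex_region m"
proof
  fix x assume x: "x \<in> otri i j b"
  have r: "- real m \<le> i" "real_of_int i + 1 \<le> m" "- real m \<le> j" "real_of_int j + 1 \<le> m"
    using assms(1-4) by linarith+
  show "x \<in> hex_region m"
  proof (cases b)
    case True
    then have "- int m \<le> i + j + 1" "i + j + 2 \<le> int m" using assms(5) by simp_all
    then have "- real m \<le> real_of_int i + j + 1" "real_of_int i + j + 2 \<le> m" by linarith+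
    then show ?thesis using x r True by (auto simp: otri_def hex_region_def)
  next
    case False
    then have "- int m \<le> i + j" "i + j + 1 \<le> int m" using assms(5) by simp_all
    then have "- real m \<le> real_of_int i + j" "real_of_int i + j + 1 \<le> m" by linarith+
    then show ?thesis using x r False by (auto simp: otri_def hex_region_def)
  qed
qed

lemma hex_lattice_mesh: "lattice_mesh org e1 e2 f1 f2 h (hex_region m) (hex_cells m) m"
proof unfold_locales
  show "\<exists>i j b. K = tri i j b" if "K \<in> hex_cells m" for K
    using that unfolding hex_cells_def by blast
  show "hex_region m \<subseteq> \<Union>(hex_cells m)"
  proof
    fix x assume x: "x \<in> hex_region m"
    define i j where "i = \<lfloor>sc x\<rfloor>" and "j = \<lfloor>tc x\<rfloor>"
    let ?b = "i + j + 1 < sc x + tc x"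
    have ij: "i \<le> sc x" "sc x < i + 1" "j \<le> tc x" "tc x < j + 1" by (simp_all add: i_def j_def)
    have "otri i j ?b \<subseteq> hex_region m"
    proof (rule otri_subset_hex_region)
      show "- int m \<le> i" "i + 1 \<le> int m" "- int m \<le> j" "j + 1 \<le> int m"
        using x ij unfolding hex_region_def by (simp_all, linarith+)
      show "if ?b then - int m \<le> i + j + 1 \<and> i + j + 2 \<le> int m else - int m \<le> i + j \<and> i + j + 1 \<le> int m"
        using x ij unfolding hex_region_def by (simp_all, linarith+)
    qed
    then show "x \<in> \<Union>(hex_cells m)"
      using tri_floor[of x] unfolding hex_cells_def i_def j_def by blast
  qed
  fix k
  assume k: "node k \<in> hex_region m"
  then have k': "\<bar>fst k\<bar> < int m" "\<bar>snd k\<bar> < int m" "\<bar>fst k + snd k\<bar> < int m"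
    by (auto simp: hex_region_def)
  then show "\<bar>fst k\<bar> < int m \<and> \<bar>snd k\<bar> < int m" by simp
  fix x assume "0 < phi k x"
  note phi = phi_posD[OF this, unfolded abs_less_iff]
  have "real_of_int (fst k) + 1 \<le> m" "- real m + 1 \<le> fst k" "real_of_int (snd k) + 1 \<le> m" "- real m + 1 \<le> snd k"
    "real_of_int (fst k + snd k) + 1 \<le> m" "- real m + 1 \<le> real_of_int (fst k + snd k)"
    using k' by linarith+
  then show "x \<in> hex_region m"
    using phi by (auto simp: hex_region_def abs_less_iff)
qed

text \<open>The integer level lines of \<open>sc\<close>, \<open>tc\<close> and their sum separate
  exactly the open triangles, and a partition into nonempty connected open sets is the set of
  components.\<close>

lemma components_hex_region:
  "components (hex_region m - {x. sc x \<in> \<int> \<or> tc x \<in> \<int> \<or> sc x + tc x \<in> \<int>}) =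
    {otri i j b | i j b. otri i j b \<subseteq> hex_region m}" (is "components ?S = ?A")
proof (rule components_open_unique)
  have disj: "c = d" if "x \<in> ocell c" "x \<in> ocell d" for c d x
    using ocell_disjoint that .
  show "pairwise disjnt ?A"
  proof (rule pairwiseI)
    fix X Y assume "X \<in> ?A" "Y \<in> ?A" "X \<noteq> Y"
    then obtain i j b i' j' b' where "X = ocell (i, j, b)" "Y = ocell (i', j', b')"
      unfolding ocell_def prod.case by blast
    then show "disjnt X Y" using ocell_disjoint \<open>X \<noteq> Y\<close> unfolding disjnt_def by blast
  qed
  have nonint: "sc x \<notin> \<int> \<and> tc x \<notin> \<int> \<and> sc x + tc x \<notin> \<int>" if x: "x \<in> otri i j b" for x i j b
  proof -
    have no: "r \<notin> \<int>" if "real_of_int k < r" "r < real_of_int k + 1" for r k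
    proof
      assume "r \<in> \<int>"
      then obtain l where "r = real_of_int l" by (rule Ints_cases)
      then have "k < l" "l < k + 1" using that by linarith+
      then show False by simp
    qed
    show ?thesis
      using x no[of i "sc x"] no[of j "tc x"] no[of "i + j" "sc x + tc x"] no[of "i + j + 1" "sc x + tc x"]
      by (cases b) (auto simp: otri_def)
  qed
  show "\<Union>?A = ?S"
  proof (intro equalityI subsetI)
    fix x assume "x \<in> \<Union>?A"
    then show "x \<in> ?S" using nonint by blast
  next
    fix x assume x: "x \<in> ?S"
    define i j where "i = \<lfloor>sc x\<rfloor>" and "j = \<lfloor>tc x\<rfloor>"
    let ?b = "i + j + 1 < sc x + tc x"
    have ij: "i \<le> sc x" "sc x < i + 1" "j \<le> tc x" "tc x < j + 1" by (simp_all add: i_def j_def)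
    have ne: "sc x \<noteq> i" "tc x \<noteq> j" "sc x + tc x \<noteq> real_of_int (i + j + 1)" using x by (auto simp del: of_int_add)
    have "x \<in> otri i j ?b" using ij ne by (auto simp: otri_def)
    moreover have "otri i j ?b \<subseteq> hex_region m"
    proof (rule otri_subset_hex_region)
      show "- int m \<le> i" "i + 1 \<le> int m" "- int m \<le> j" "j + 1 \<le> int m"
        using x ij unfolding hex_region_def by (simp_all, linarith+)
      show "if ?b then - int m \<le> i + j + 1 \<and> i + j + 2 \<le> int m else - int m \<le> i + j \<and> i + j + 1 \<le> int m"
        using x ij unfolding hex_region_def by (simp_all, linarith+)
    qed
    ultimately show "x \<in> \<Union>?A" by blast
  qed
  fix X assume "X \<in> ?A"
  then obtain i j b where "X = otri i j b" by blast
  then show "open X \<and> connected X \<and> X \<noteq> {}"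
    using open_otri convex_otri tri_centre[of b i j] by (auto intro: convex_connected)
qed

lemma interior_Collect_sc_tc:
  assumes "\<alpha> \<noteq> 0 \<or> \<beta> \<noteq> 0"
  shows "interior {x. \<alpha> * sc x + \<beta> * tc x \<le> c} = {x. \<alpha> * sc x + \<beta> * tc x < c}"
proof -
  define g where "g = (\<alpha> / h) *\<^sub>R f1 + (\<beta> / h) *\<^sub>R f2"
  define d where "d = inner g org"
  have g: "\<alpha> * sc y + \<beta> * tc y = inner g y - d" for y
    by (simp add: g_def d_def sc_def tc_def inner_add_left inner_diff_right divide_inverse algebra_simps)
  have "inner g e1 = \<alpha> / h" "inner g e2 = \<beta> / h" by (simp_all add: g_def inner_add_left dual)
  then have "g \<noteq> 0" using assms h by auto
  then show ?thesis
    using interior_halfspace_le[of g "c + d"] by (simp add: g algebra_simps)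
qed

lemma pt_combination:
  assumes C: "convex C" "org \<in> C" "pt s t \<in> C" "pt s' t' \<in> C"
    and uv: "0 \<le> u" "0 \<le> v" "u + v \<le> 1"
  shows "pt (u * s + v * s') (u * t + v * t') \<in> C"
proof -
  have o: "sc org = 0" "tc org = 0" by (simp_all add: sc_def tc_def)
  have "pt (u * s + v * s') (u * t + v * t') = (1 - u - v) *\<^sub>R org + u *\<^sub>R pt s t + v *\<^sub>R pt s' t'"
    by (simp add: point_eq_iff sc_convex3 tc_convex3 o)
  moreover have "0 \<le> 1 - u - v" "1 - u - v + u + v = 1" using uv by auto
  ultimately have "pt (u * s + v * s') (u * t + v * t') \<in> convex hull {org, pt s t, pt s' t'}"
    unfolding convex_hull_3 using uv by blast
  moreover have "convex hull {org, pt s t, pt s' t'} \<subseteq> C"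
    using C by (intro hull_minimal) auto
  ultimately show ?thesis by blast
qed

text \<open>The signs of s, t and s + t divide the plane into six sectors spanned by consecutive
  vertex directions. In each, the condition u + v \<le> m on the coefficients is one of the
  inequalities defining the hexagon.\<close>

lemma hull_hex_vertices:
  assumes m: "0 < m"
  shows "convex hull ((\<lambda>k. pt (real m * fst (hex_offset k)) (real m * snd (hex_offset k))) ` {..<6}) =
    {x. \<bar>sc x\<bar> \<le> m \<and> \<bar>tc x\<bar> \<le> m \<and> \<bar>sc x + tc x\<bar> \<le> m}" (is "convex hull (?v ` _) = ?H")
proof
  let ?C = "convex hull (?v ` {..<6})"
  have eq: "?H = {x. 1 * sc x + 0 * tc x \<le> m} \<inter> {x. (-1) * sc x + 0 * tc x \<le> m} \<inter>
     {x. 0 * sc x + 1 * tc x \<le> m} \<inter> {x. 0 * sc x + (-1) * tc x \<le> m} \<inter>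
     {x. 1 * sc x + 1 * tc x \<le> m} \<inter> {x. (-1) * sc x + (-1) * tc x \<le> m}"
    by (auto simp: abs_le_iff)
  show "?C \<subseteq> ?H"
  proof (rule hull_minimal)
    show "?v ` {..<6} \<subseteq> ?H"
      by (auto elim!: less_6_cases)
    show "convex ?H" unfolding eq by (intro convex_Int convex_Collect_sc_tc)
  qed
  have v: "?v k \<in> ?C" if "k < 6" for k using that by (intro hull_inc) auto
  have C: "convex ?C" by (rule convex_convex_hull)
  have org: "org \<in> ?C"
  proof -
    have "sc org = 0" "tc org = 0" by (simp_all add: sc_def tc_def)
    then have "org = (1 / 2) *\<^sub>R ?v 0 + (1 / 2) *\<^sub>R ?v 3"
      by (simp add: point_eq_iff sc_convex tc_convex)
    also have "\<dots> \<in> ?C" by (intro convexD[OF C] v) auto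
    finally show ?thesis .
  qed
  have sector: "x \<in> ?C" if "k < 6" "l < 6" "0 \<le> u" "0 \<le> v" "u + v \<le> m"
    "sc x = u * fst (hex_offset k) + v * fst (hex_offset l)" "tc x = u * snd (hex_offset k) + v * snd (hex_offset l)" for x k l and u v :: real
  proof -
    have "pt ((u / m) * (real m * fst (hex_offset k)) + (v / m) * (real m * fst (hex_offset l)))
      ((u / m) * (real m * snd (hex_offset k)) + (v / m) * (real m * snd (hex_offset l))) \<in> ?C"
      using that m by (intro pt_combination[OF C org] v) (auto simp: field_simps)
    also have "pt ((u / m) * (real m * fst (hex_offset k)) + (v / m) * (real m * fst (hex_offset l)))
      ((u / m) * (real m * snd (hex_offset k)) + (v / m) * (real m * snd (hex_offset l))) = x"
      using m by (simp add: point_eq_iff that)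
    finally show ?thesis .
  qed
  show "?H \<subseteq> ?C"
  proof
    fix x assume "x \<in> ?H"
    then have x: "\<bar>sc x\<bar> \<le> m" "\<bar>tc x\<bar> \<le> m" "\<bar>sc x + tc x\<bar> \<le> m" by auto
    let ?s = "sc x" and ?t = "tc x"
    consider "0 \<le> ?s" "0 \<le> ?t" | "?s \<le> 0" "0 \<le> ?s + ?t" | "?s + ?t \<le> 0" "0 \<le> ?t"
      | "?s \<le> 0" "?t \<le> 0" | "0 \<le> ?s" "?s + ?t \<le> 0" | "0 \<le> ?s + ?t" "?t \<le> 0"
      by linarith
    then show "x \<in> ?C"
    proof cases
      case 1 then show ?thesis using x by (intro sector[where k = 0 and l = 1 and u = ?s and v = ?t]) auto
    next
      case 2 then show ?thesis using x by (intro sector[where k = 1 and l = 2 and u = "?s + ?t" and v = "- ?s"]) auto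
    next
      case 3 then show ?thesis using x by (intro sector[where k = 2 and l = 3 and u = ?t and v = "- ?s - ?t"]) auto
    next
      case 4 then show ?thesis using x by (intro sector[where k = 3 and l = 4 and u = "- ?s" and v = "- ?t"]) auto
    next
      case 5 then show ?thesis using x by (intro sector[where k = 4 and l = 5 and u = "- ?s - ?t" and v = ?s]) auto
    next
      case 6 then show ?thesis using x by (intro sector[where k = 5 and l = 0 and u = "- ?t" and v = "?s + ?t"]) auto
    qed
  qed
qed

lemma interior_hull_hex_vertices:
  assumes m: "0 < m"
  shows "interior (convex hull ((\<lambda>k. pt (real m * fst (hex_offset k)) (real m * snd (hex_offset k))) ` {..<6})) =
    hex_region m"
proof -
  have eq: "{x. \<bar>sc x\<bar> \<le> m \<and> \<bar>tc x\<bar> \<le> m \<and> \<bar>sc x + tc x\<bar> \<le> m} =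
     {x. 1 * sc x + 0 * tc x \<le> m} \<inter> {x. (-1) * sc x + 0 * tc x \<le> m} \<inter>
     {x. 0 * sc x + 1 * tc x \<le> m} \<inter> {x. 0 * sc x + (-1) * tc x \<le> m} \<inter>
     {x. 1 * sc x + 1 * tc x \<le> m} \<inter> {x. (-1) * sc x + (-1) * tc x \<le> m}"
    by (auto simp: abs_le_iff)
  have "interior {x. \<bar>sc x\<bar> \<le> m \<and> \<bar>tc x\<bar> \<le> m \<and> \<bar>sc x + tc x\<bar> \<le> m} = hex_region m"
    unfolding eq interior_Int by (subst interior_Collect_sc_tc, simp)+ (auto simp: hex_region_def abs_less_iff)
  then show ?thesis by (simp only: hull_hex_vertices[OF m])
qed

end

section \<open>The regular hexagon and its division lines in lattice coordinates\<close>

definition hex_e1 :: "real \<Rightarrow> point" where "hex_e1 \<theta> = vector [cos \<theta>, sin \<theta>]"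
definition hex_e2 :: "real \<Rightarrow> point" where "hex_e2 \<theta> = vector [cos (\<theta> + pi / 3), sin (\<theta> + pi / 3)]"
text \<open>Each dual vector is perpendicular to the other basis vector; the factor 2 / sqrt 3 is 1
  / sin (pi / 3), the inverse determinant of the basis.\<close>

definition hex_f1 :: "real \<Rightarrow> point" where
  "hex_f1 \<theta> = (2 / sqrt 3) *\<^sub>R vector [sin (\<theta> + pi / 3), - cos (\<theta> + pi / 3)]"
definition hex_f2 :: "real \<Rightarrow> point" where
  "hex_f2 \<theta> = (2 / sqrt 3) *\<^sub>R vector [- sin \<theta>, cos \<theta>]"

lemma hex_lattice:
  assumes "0 < h"
  shows "affine_lattice (hex_e1 \<theta>) (hex_e2 \<theta>) (hex_f1 \<theta>) (hex_f2 \<theta>) h"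
proof unfold_locales
  let ?c = "cos (\<theta> + pi / 3)" and ?s = "sin (\<theta> + pi / 3)"
  have "?s * cos \<theta> - ?c * sin \<theta> = sin (pi / 3)"
    using sin_diff[of "\<theta> + pi / 3" \<theta>] by simp
  then have det: "2 / sqrt 3 * (?s * cos \<theta> - ?c * sin \<theta>) = 1"
    by (simp add: sin_60)
  show "inner (hex_f1 \<theta>) (hex_e1 \<theta>) = 1" "inner (hex_f2 \<theta>) (hex_e2 \<theta>) = 1"
    using det by (simp_all add: hex_f1_def hex_f2_def hex_e1_def hex_e2_def vector_2 algebra_simps)
  show "inner (hex_f1 \<theta>) (hex_e2 \<theta>) = 0" "inner (hex_f2 \<theta>) (hex_e1 \<theta>) = 0"
    by (simp_all add: hex_f1_def hex_f2_def hex_e1_def hex_e2_def vector_2)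
  fix x :: point
  let ?x1 = "Finite_Cartesian_Product.vec_nth x 1" and ?x2 = "Finite_Cartesian_Product.vec_nth x 2"
  have "(2 / sqrt 3) * ((?s * ?x1 - ?c * ?x2) * cos \<theta> + (- sin \<theta> * ?x1 + cos \<theta> * ?x2) * ?c)
    = (2 / sqrt 3 * (?s * cos \<theta> - ?c * sin \<theta>)) * ?x1"
    by (simp add: algebra_simps)
  moreover have "(2 / sqrt 3) * ((?s * ?x1 - ?c * ?x2) * sin \<theta> + (- sin \<theta> * ?x1 + cos \<theta> * ?x2) * ?s)
    = (2 / sqrt 3 * (?s * cos \<theta> - ?c * sin \<theta>)) * ?x2"
    by (simp add: algebra_simps)
  ultimately show "x = inner (hex_f1 \<theta>) x *\<^sub>R hex_e1 \<theta> + inner (hex_f2 \<theta>) x *\<^sub>R hex_e2 \<theta>"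
    unfolding det by (intro point_eqI) (simp_all add: hex_f1_def hex_f2_def hex_e1_def hex_e2_def vector_2 algebra_simps)
qed (rule assms)

lemma hex_direction:
  assumes "k \<le> 6"
  shows "vector [cos (\<theta> + real k * pi / 3), sin (\<theta> + real k * pi / 3)] =
    of_int (fst (hex_offset k)) *\<^sub>R hex_e1 \<theta> + of_int (snd (hex_offset k)) *\<^sub>R hex_e2 \<theta>"
proof -
  define w where "w k = (vector [cos (\<theta> + real k * pi / 3), sin (\<theta> + real k * pi / 3)] :: point)" for k
  \<comment> \<open>Directions 60 degrees to either side of a direction add up to it because 2 cos
    (pi / 3) = 1; so the first two determine all.\<close>
  have rec: "w (Suc (Suc k)) = w (Suc k) - w k" for k
  proof -
    define \<psi> where "\<psi> = \<theta> + real (Suc k) * pi / 3"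
    have "\<theta> + real (Suc (Suc k)) * pi / 3 = \<psi> + pi / 3" "\<theta> + real k * pi / 3 = \<psi> - pi / 3"
      by (simp_all add: \<psi>_def field_simps)
    then show ?thesis
      unfolding w_def \<psi>_def[symmetric]
      by (intro point_eqI) (simp_all add: vector_2 cos_add cos_diff sin_add sin_diff cos_60)
  qed
  have w01: "w 0 = hex_e1 \<theta>" "w 1 = hex_e2 \<theta>" "w (Suc 0) = hex_e2 \<theta>" by (simp_all add: w_def hex_e1_def hex_e2_def)
  have w: "w 2 = w 1 - w 0" "w 3 = w 2 - w 1" "w 4 = w 3 - w 2" "w 5 = w 4 - w 3" "w 6 = w 5 - w 4"
    using rec[of 0] rec[of 1] rec[of 2] rec[of 3] rec[of 4] by (simp_all add: eval_nat_numeral)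
  have "w k = of_int (fst (hex_offset k)) *\<^sub>R hex_e1 \<theta> + of_int (snd (hex_offset k)) *\<^sub>R hex_e2 \<theta>"
  proof (cases "k = 6")
    case False
    then have "k < 6" using assms by simp
    then show ?thesis by (cases rule: less_6_cases) (simp_all add: w w01)
  qed (simp add: w w01)
  then show ?thesis by (simp add: w_def)
qed

lemma hex_vertex_eq_pt:
  assumes "0 < L" "0 < m" "k \<le> 6"
  shows "hex_vertex z \<theta> L k = affine_lattice.pt z (hex_e1 \<theta>) (hex_e2 \<theta>) (L / real m)
    (real m * of_int (fst (hex_offset k))) (real m * of_int (snd (hex_offset k)))"
proof -
  interpret affine_lattice z "hex_e1 \<theta>" "hex_e2 \<theta>" "hex_f1 \<theta>" "hex_f2 \<theta>" "L / real m"
    using assms by (intro hex_lattice) simp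
  show ?thesis
    unfolding hex_vertex_def hex_direction[OF assms(3)] pt_def using assms by (simp add: scaleR_add_right)
qed

lemma hexagon_eq_hex_region:
  assumes L: "0 < L" and m: "0 < m"
  shows "hexagon z \<theta> L = affine_lattice.hex_region z (hex_f1 \<theta>) (hex_f2 \<theta>) (L / real m) m"
proof -
  interpret affine_lattice z "hex_e1 \<theta>" "hex_e2 \<theta>" "hex_f1 \<theta>" "hex_f2 \<theta>" "L / real m"
    using L m by (intro hex_lattice) simp
  have "hex_vertex z \<theta> L ` {..<6} =
      (\<lambda>k. pt (real m * of_int (fst (hex_offset k))) (real m * of_int (snd (hex_offset k)))) ` {..<6}"
    using hex_vertex_eq_pt[OF L m] by (intro image_cong) auto
  then show ?thesis
    unfolding hexagon_def by (simp only: interior_hull_hex_vertices[OF m])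
qed

text \<open>Inside the hexagon, the lines through division points parallel to the sides are the
  integer level lines of \<open>sc\<close>, \<open>tc\<close> and their sum. Only finitely many
  levels are drawn, so \<open>lines\<close> is restricted to points of the region.\<close>

lemma hexagon_lattice_mesh:
  assumes L: "0 < L" and m: "0 < m"
  shows "lattice_mesh z (hex_e1 \<theta>) (hex_e2 \<theta>) (hex_f1 \<theta>) (hex_f2 \<theta>) (L / real m)
      (hexagon z \<theta> L) (hex_mesh z \<theta> L m) m"
proof -
  interpret affine_lattice z "hex_e1 \<theta>" "hex_e2 \<theta>" "hex_f1 \<theta>" "hex_f2 \<theta>" "L / real m"
    using L m by (intro hex_lattice) simp
  let ?a = "\<lambda>k. real_of_int (fst (hex_offset k))" and ?b = "\<lambda>k. real_of_int (snd (hex_offset k))"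
  note vertex = hex_vertex_eq_pt[OF L m]
  note hex = hexagon_eq_hex_region[OF L m]
  have side: "sc (x + t *\<^sub>R hex_side z \<theta> L l) = sc x + t * (real m * (?a (Suc l) - ?a l))"
    "tc (x + t *\<^sub>R hex_side z \<theta> L l) = tc x + t * (real m * (?b (Suc l) - ?b l))" if l: "l < 6" for x t l
  proof -
    have "x + t *\<^sub>R hex_side z \<theta> L l = 1 *\<^sub>R x + t *\<^sub>R hex_vertex z \<theta> L (Suc l) + (- t) *\<^sub>R hex_vertex z \<theta> L l"
      by (simp add: hex_side_def algebra_simps)
    then show "sc (x + t *\<^sub>R hex_side z \<theta> L l) = sc x + t * (real m * (?a (Suc l) - ?a l))"
      "tc (x + t *\<^sub>R hex_side z \<theta> L l) = tc x + t * (real m * (?b (Suc l) - ?b l))"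
      using l by (simp_all only: sc_convex3 tc_convex3) (simp_all add: vertex algebra_simps)
  qed
  define dp where "dp k j = hex_vertex z \<theta> L k + (real j / real m) *\<^sub>R hex_side z \<theta> L k" for k j
  have dp: "sc (dp k j) = real m * ?a k + real j * (?a (Suc k) - ?a k)"
    "tc (dp k j) = real m * ?b k + real j * (?b (Suc k) - ?b k)" if "k < 6" for k j
    using that m unfolding dp_def side[OF that] by (simp_all add: vertex)
  have on_line: "x \<in> \<Union>(hex_lines z \<theta> L m)"
    if "k < 6" "j \<le> m" "l < 6" "sc x = sc (dp k j) + t * (real m * (?a (Suc l) - ?a l))"
      "tc x = tc (dp k j) + t * (real m * (?b (Suc l) - ?b l))" for x k j l t
  proof -
    have "x = dp k j + t *\<^sub>R hex_side z \<theta> L l"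
      using that by (simp add: point_eq_iff side)
    moreover have "dp k j \<in> hex_division_points z \<theta> L m"
      using that by (auto simp: hex_division_points_def dp_def)
    ultimately show ?thesis using that(3) unfolding hex_lines_def by blast
  qed
  have off6: "hex_offset (Suc 5) = (1, 0)" "hex_offset (Suc 4) = (1, - 1)" "hex_offset (Suc 3) = (0, - 1)"
    "hex_offset (Suc 2) = (- 1, 0)" "hex_offset (Suc (Suc 0)) = (- 1, 1)" "hex_offset (Suc 1) = (- 1, 1)"
    by (simp_all add: hex_offset_def)
  have lines: "x \<in> \<Union>(hex_lines z \<theta> L m) \<longleftrightarrow> sc x \<in> \<int> \<or> tc x \<in> \<int> \<or> sc x + tc x \<in> \<int>"
    if x: "x \<in> hex_region m" for x
  proof
    assume "x \<in> \<Union>(hex_lines z \<theta> L m)"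
    then obtain d t l where d: "d \<in> hex_division_points z \<theta> L m" and l: "l < 6"
      and x: "x = d + t *\<^sub>R hex_side z \<theta> L l"
      unfolding hex_lines_def by blast
    obtain k j where "k < 6" "d = dp k j"
      using d by (auto simp: hex_division_points_def dp_def)
    then have d: "sc d \<in> \<int>" "tc d \<in> \<int>" by (auto simp: dp)
    have "?a (Suc l) - ?a l = 0 \<or> ?b (Suc l) - ?b l = 0 \<or> (?a (Suc l) - ?a l) + (?b (Suc l) - ?b l) = 0"
      using l by (cases rule: less_6_cases) (simp_all add: off6)
    then show "sc x \<in> \<int> \<or> tc x \<in> \<int> \<or> sc x + tc x \<in> \<int>"
    proof (elim disjE)
      assume 0: "(?a (Suc l) - ?a l) + (?b (Suc l) - ?b l) = 0"
      have "sc x + tc x = sc d + tc d + t * (real m * ((?a (Suc l) - ?a l) + (?b (Suc l) - ?b l)))"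
        unfolding x side[OF l] by (simp add: algebra_simps)
      then show ?thesis using d unfolding 0 by simp
    qed (use d in \<open>simp_all add: x side[OF l]\<close>)
  next
    assume "sc x \<in> \<int> \<or> tc x \<in> \<int> \<or> sc x + tc x \<in> \<int>"
    then obtain c :: int where c: "sc x = c \<or> tc x = c \<or> sc x + tc x = c" by (metis Ints_cases)
    then have cm: "\<bar>c\<bar> < int m"
      using x unfolding hex_region_def by auto
    \<comment> \<open>Positions along a side of the division point at level \<open>c\<close>; which
      side is used depends on the coordinate and on the sign of \<open>c\<close>.\<close>
    define j where "j = nat (int m - c)"
    define j' where "j' = nat (- c)"
    define j'' where "j'' = nat c"
    define j''' where "j''' = nat (int m + c)"
    have js: "j \<le> m \<and> real j = m - c" "j'' \<le> m \<and> real j'' = c" if "0 \<le> c"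
      using that cm by (auto simp: j_def j''_def)
    have js': "j' \<le> m \<and> real j' = - c" "j''' \<le> m \<and> real j''' = m + c" if "c < 0"
      using that cm by (auto simp: j'_def j'''_def)
    from c consider "sc x = c" "0 \<le> c" | "sc x = c" "c < 0" | "tc x = c" "0 \<le> c" | "tc x = c" "c < 0"
      | "sc x + tc x = c" "0 \<le> c" | "sc x + tc x = c" "c < 0"
      by linarith
    then show "x \<in> \<Union>(hex_lines z \<theta> L m)"
    proof cases
      case 1
      then show ?thesis using js m
        by (intro on_line[where k = 0 and j = j and l = 2 and t = "(tc (dp 0 j) - tc x) / m"]) (auto simp: dp off6)
    next
      case 2
      then show ?thesis using js' m
        by (intro on_line[where k = 1 and j = j' and l = 2 and t = "(tc (dp 1 j') - tc x) / m"]) (auto simp: dp off6)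
    next
      case 3
      then show ?thesis using js m
        by (intro on_line[where k = 0 and j = j'' and l = 1 and t = "(sc (dp 0 j'') - sc x) / m"]) (auto simp: dp off6)
    next
      case 4
      then show ?thesis using js' m
        by (intro on_line[where k = 5 and j = j''' and l = 1 and t = "(sc (dp 5 j''') - sc x) / m"]) (auto simp: dp off6)
    next
      case 5
      then show ?thesis using js m
        by (intro on_line[where k = 1 and j = j and l = 0 and t = "(sc (dp 1 j) - sc x) / m"]) (auto simp: dp off6)
    next
      case 6
      then show ?thesis using js' m
        by (intro on_line[where k = 2 and j = j' and l = 0 and t = "(sc (dp 2 j') - sc x) / m"]) (auto simp: dp off6)
    qed
  qed
  have "hexagon z \<theta> L - \<Union>(hex_lines z \<theta> L m) = hex_region m - {x. sc x \<in> \<int> \<or> tc x \<in> \<int> \<or> sc x + tc x \<in> \<int>}"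
    unfolding hex using lines by blast
  then have "hex_mesh z \<theta> L m = closure ` {otri i j b | i j b. otri i j b \<subseteq> hex_region m}"
    unfolding hex_mesh_def by (simp only: components_hex_region)
  also have "\<dots> = hex_cells m"
    unfolding hex_cells_def closure_otri[symmetric] by blast
  finally show "lattice_mesh z (hex_e1 \<theta>) (hex_e2 \<theta>) (hex_f1 \<theta>) (hex_f2 \<theta>) (L / real m)
      (hexagon z \<theta> L) (hex_mesh z \<theta> L m) m"
    using hex_lattice_mesh[of m] by (simp only: hex)
qed

definition hex_energy :: "real \<Rightarrow> real" where
  "hex_energy \<theta> = ((norm (hex_f1 \<theta>))\<^sup>2 + (norm (hex_f2 \<theta>))\<^sup>2) * (norm (hex_e1 \<theta>))\<^sup>2"

lemma hex_energy_pos: "0 < hex_energy \<theta>"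
proof -
  have "inner (hex_f1 \<theta>) (hex_e1 \<theta>) = 1"
    by (rule affine_lattice.dual(1)[OF hex_lattice[of 1]]) simp
  then have "hex_f1 \<theta> \<noteq> 0" "hex_e1 \<theta> \<noteq> 0" by auto
  then show ?thesis by (auto simp: hex_energy_def intro!: mult_pos_pos add_pos_nonneg)
qed

lemma hex_mesh_cond_bounds:
  assumes a: "0 < a" and L: "0 < L" and m: "0 < m"
  shows "eigvec_cond_bounds a \<beta> (hexagon z \<theta> L) (hex_mesh z \<theta> L m)
    (1 / (9 * sqrt (288 * hex_energy \<theta>)) * real m) (sqrt (128 * hex_energy \<theta>) * real m)"
proof -
  interpret lattice_mesh z "hex_e1 \<theta>" "hex_e2 \<theta>" "hex_f1 \<theta>" "hex_f2 \<theta>" "L / real m"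
    "hexagon z \<theta> L" "hex_mesh z \<theta> L m" m
    by (rule hexagon_lattice_mesh[OF L m])
  \<comment> \<open>The largest radius for which |i|, |j| < R forces |i + j| \<le> 2 R - 2 <
    m.\<close>
  let ?R = "(m + 1) div 2"
  show ?thesis
  proof (rule mesh_condition[OF a, of ?R 0 0])
    show "0 < ?R" "m \<le> 3 * ?R" using m by linarith+
    show "gsize * (norm (hex_e1 \<theta>))\<^sup>2 = hex_energy \<theta>"
      by (simp add: gsize_def hex_energy_def)
    fix i j assume "\<bar>i - 0\<bar> < int ?R" "\<bar>j - 0\<bar> < int ?R"
    then have "\<bar>i\<bar> < int m" "\<bar>j\<bar> < int m" "\<bar>i + j\<bar> < int m" by linarith+
    then have "\<bar>real_of_int i\<bar> < m" "\<bar>real_of_int j\<bar> < m" "\<bar>real_of_int i + j\<bar> < m" by linarith+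
    then show "node (i, j) \<in> hexagon z \<theta> L"
      by (simp add: hexagon_eq_hex_region[OF L m] hex_region_def)
  qed
qed

text \<open>Substitutes m = l / h, which turns multiples of \<open>m\<close> into multiples of 1 / h
  with constants shared by the whole family.\<close>

lemma eigvec_cond_bounds_family:
  assumes E: "0 < E" and l: "0 < l"
    and F: "\<And>h T. (h, T) \<in> F \<Longrightarrow> \<exists>m. 0 < m \<and> h = l / real m \<and>
      eigvec_cond_bounds a \<beta> \<Omega> T (1 / (9 * sqrt (288 * E)) * real m) (sqrt (128 * E) * real m)"
  shows "\<exists>c C. 0 < c \<and> c \<le> C \<and> (\<forall>(h, T)\<in>F. eigvec_cond_bounds a \<beta> \<Omega> T (c * inverse h) (C * inverse h))"
proof -
  define c where "c = l / (9 * sqrt (288 * E))"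
  \<comment> \<open>The maximum secures c \<le> C without comparing the two estimates.\<close>
  define C where "C = max c (l * sqrt (128 * E))"
  have "0 < c" "c \<le> C" using E l by (auto simp: c_def C_def)
  moreover have "eigvec_cond_bounds a \<beta> \<Omega> T (c * inverse h) (C * inverse h)" if hT: "(h, T) \<in> F" for h T
  proof -
    obtain m where m: "0 < m" "h = l / real m" and
      b: "eigvec_cond_bounds a \<beta> \<Omega> T (1 / (9 * sqrt (288 * E)) * real m) (sqrt (128 * E) * real m)"
      using F[OF hT] by blast
    have "c * inverse h \<le> 1 / (9 * sqrt (288 * E)) * real m"
      using l m by (simp add: c_def)
    moreover have "sqrt (128 * E) * real m = (l * sqrt (128 * E)) * inverse h"
      using l m by simp
    moreover have "(l * sqrt (128 * E)) * inverse h \<le> C * inverse h"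
      using l m by (intro mult_right_mono) (auto simp: C_def)
    ultimately show ?thesis
      by (intro eigvec_cond_bounds_mono[OF b]) linarith+
  qed
  ultimately show ?thesis by blast
qed

theorem theorem3p8:
  fixes \<Omega> :: "point set" and F :: "(real \<times> mesh) set" and a :: real and \<beta> :: point
  assumes dom: "(\<exists>z \<theta> L. 0 < L \<and> \<Omega> = hexagon z \<theta> L \<and> F = hex_family z \<theta> L) \<or>
                (\<Omega> = unit_square \<and> F = fk_family)"
    and a: "0 < a"
  shows "\<exists>c C. 0 < c \<and> c \<le> C \<and>
    (\<forall>(h, T)\<in>F. \<forall>n p. n = card (internal_nodes \<Omega> T) \<longrightarrow>
       bij_betw p {..<n} (internal_nodes \<Omega> T) \<longrightarrow>
       invertible_mat (precond \<Omega> T p (\<lambda>_. a)) \<and>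
       (\<exists>V D. V \<in> carrier_mat n n \<and> D \<in> carrier_mat n n \<and>
          invertible_mat V \<and> diagonal_mat D \<and>
          map_mat complex_of_real
            (mat_inv (precond \<Omega> T p (\<lambda>_. a)) * conv_diff_mat \<Omega> T p (\<lambda>_. a) (\<lambda>_. \<beta>))
            = V * D * mat_inv V \<and>
          c * inverse h \<le> cond2 V \<and> cond2 V \<le> C * inverse h))"
proof -
  have "\<exists>c C. 0 < c \<and> c \<le> C \<and> (\<forall>(h, T)\<in>F. eigvec_cond_bounds a \<beta> \<Omega> T (c * inverse h) (C * inverse h))"
    using dom
  proof (elim disjE exE conjE)
    fix z \<theta> L
    assume L: "0 < L" and \<Omega>: "\<Omega> = hexagon z \<theta> L" and F: "F = hex_family z \<theta> L"
    show ?thesis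
    proof (rule eigvec_cond_bounds_family[OF hex_energy_pos[of \<theta>] L])
      fix h T assume "(h, T) \<in> F"
      then obtain m where "1 \<le> m" "h = L / real m" "T = hex_mesh z \<theta> L m"
        unfolding F hex_family_def by auto
      then show "\<exists>m. 0 < m \<and> h = L / real m \<and> eigvec_cond_bounds a \<beta> \<Omega> T
          (1 / (9 * sqrt (288 * hex_energy \<theta>)) * real m) (sqrt (128 * hex_energy \<theta>) * real m)"
        unfolding \<Omega> using hex_mesh_cond_bounds[OF a L, of m] by (intro exI[of _ m]) auto
    qed
  next
    assume \<Omega>: "\<Omega> = unit_square" and F: "F = fk_family"
    show ?thesis
    proof (rule eigvec_cond_bounds_family[of 2 1])
      fix h T assume "(h, T) \<in> F"
      then obtain m up where "2 \<le> m" "h = 1 / real m" "T = fk_mesh up m"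
        unfolding F fk_family_def by auto
      then show "\<exists>m. 0 < m \<and> h = 1 / real m \<and> eigvec_cond_bounds a \<beta> \<Omega> T
          (1 / (9 * sqrt (288 * 2)) * real m) (sqrt (128 * 2) * real m)"
        unfolding \<Omega> using fk_mesh_cond_bounds[OF a, of m] by (intro exI[of _ m]) auto
    qed auto
  qed
  then show ?thesis
    unfolding eigvec_cond_bounds_def .
qed

end
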